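(* Let $K\subset\mathbb{R}^2$ be a curvilinear polygon, let $m\geq 1$ be an integer, and let $v,w\in V_m(K)$, with $$\Delta v=p\in\mathbb{P}_{m-2}(K)\text{ in }K,\quad v=f\in\mathbb{P}_m^*(\partial K)\text{ on }\partial K,$$ $$\Delta w=q\in\mathbb{P}_{m-2}(K)\text{ in }K,\quad w=g\in\mathbb{P}_m^*(\partial K)\text{ on }\partial K.$$ Let $P,Q\in\mathbb{P}_m(K)$ satisfy $\Delta P=p$ and $\Delta Q=q$, and let $P^*,Q^*\in\mathbb{P}_{m+2}(K)$ satisfy $\Delta P^*=P$ and $\Delta Q^*=Q$. Let $\Phi$ be a function with $\Delta\Phi=v-P$ in $K$ obtained from the harmonic function $\phi=v-P$ by the construction given in the context. Then $$\int_K vw\,dx=\int_{\partial K}\left(\frac{\partial\Phi}{\partial\mathbf{n}}(g-Q)-\Phi\,\frac{\partial(w-Q)}{\partial\mathbf{n}}\right)ds+\int_{\partial K}\left(\frac{\partial Q^*}{\partial\mathbf{n}}(f-P)-Q^*\,\frac{\partial(v-P)}{\partial\mathbf{n}}\right)ds$$ $$\qquad+\int_{\partial K}\left(\frac{\partial P^*}{\partial\mathbf{n}}(g-Q)-P^*\,\frac{\partial(w-Q)}{\partial\mathbf{n}}\right)ds+\int_K PQ\,dx.$$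
   Context: A curvilinear polygon is an open, bounded, simply connected set $K\subset\mathbb{R}^2$ whose Lipschitz boundary $\partial K$ is a union of smooth arcs with disjoint interiors (called edges). On $\partial K$, $\mathbf{n}$ is the outward unit normal and $\mathbf{t}$ the unit tangent in the counter-clockwise direction. For an integer $j$, $\mathbb{P}_j$ is the space of real polynomials on $\mathbb{R}^2$ of total degree at most $j$, with $\mathbb{P}_j=\{0\}$ for $j<0$; $\mathbb{P}_j(S)$ is the space of restrictions of elements of $\mathbb{P}_j$ to $S\subset\mathbb{R}^2$. $\mathbb{P}_m^*(\partial K)$ is the space of continuous functions on $\partial K$ whose restriction to each edge $e$ of $K$ lies in $\mathbb{P}_m(e)$. Define $$V_m(K)=\{v\in H^1(K):\ \Delta v\in\mathbb{P}_{m-2}(K)\text{ in }K,\ v|_{\partial K}\in\mathbb{P}_m^*(\partial K)\}.$$ Construction of $\Phi$ from a harmonic function $\phi\in H^1(K)$: take weak solutions in $H^1(K)$ (each unique up to an additive constant; any choice is allowed) of the successive Neumann problems (1) $\Delta\hat\phi=0$ in $K$, $\partial\hat\phi/\partial\mathbf{n}=-\partial\phi/\partial\mathbf{t}$ on $\partial K$; (2) $\Delta\rho=0$ in $K$, $\partial\rho/\partial\mathbf{n}=(\phi,-\hat\phi)\cdot\mathbf{n}$ on $\partial K$; (3) $\Delta\hat\rho=0$ in $K$, $\partial\hat\rho/\partial\mathbf{n}=(\hat\phi,\phi)\cdot\mathbf{n}$ on $\partial K$; and set $\Phi=(x_1\rho+x_2\hat\rho)/4$. This function satisfies $\Delta\Phi=\phi$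 in $K$. Here $\partial\phi/\partial\mathbf{t}$ is the distributional tangential derivative of the trace of $\phi$. For $u\in H^1(K)$ with $\Delta u\in L^2(K)$, the normal derivative $\partial u/\partial\mathbf{n}$ is the usual (weak) one in $H^{-1/2}(\partial K)$, and boundary integrals of a normal derivative against a trace are understood as the corresponding $H^{-1/2}$-$H^{1/2}$ duality pairing when necessary. *)

theory Defs
  imports "HOL-Analysis.Analysis"
begin

text \<open>
  Functions on a set (\<open>K\<close> or its boundary) are total functions on the plane; only their values on
  that set matter.  Elements of Lebesgue and Sobolev spaces are represented by arbitrary
  representatives.
\<close>

type_synonym point = "real \<times> real"

section \<open>Curvilinear polygons\<close>

definition rot :: "point \<Rightarrow> point" where  \<comment> \<open>counter-clockwise rotation by a right angle\<close>
  "rot a = (- snd a, fst a)"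

text \<open>Near every boundary point, \<open>K\<close> is the strict epigraph of a Lipschitz function in suitable
  orthonormal coordinates.\<close>

definition lipschitz_boundary :: "point set \<Rightarrow> bool" where
  "lipschitz_boundary K \<longleftrightarrow>
     (\<forall>z\<in>frontier K. \<exists>e g L r h. norm e = 1 \<and> L-lipschitz_on UNIV g \<and> 0 < r \<and> 0 < h \<and>
        (\<forall>s t. \<bar>s\<bar> < r \<longrightarrow> \<bar>t\<bar> < h \<longrightarrow>
           (z + s *\<^sub>R rot e + t *\<^sub>R e \<in> K \<longleftrightarrow> g s < (t::real))))"

abbreviation velocity :: "(real \<Rightarrow> point) \<Rightarrow> real \<Rightarrow> point" where
  "velocity \<gamma> t \<equiv> vector_derivative \<gamma> (at t within {0..1})"

text \<open>Edges are given by regular infinitely differentiable parametrisations over \<open>[0,1]\<close>.  A single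
  edge may close up (\<open>simple_path\<close> instead of \<open>arc\<close>), as for a disc or a teardrop with one edge.\<close>

definition smooth_arc :: "(real \<Rightarrow> point) \<Rightarrow> bool" where
  "smooth_arc \<gamma> \<longleftrightarrow> simple_path \<gamma> \<and>
     (\<exists>D :: nat \<Rightarrow> real \<Rightarrow> point. D 0 = \<gamma> \<and>
        (\<forall>k. \<forall>t\<in>{0..1}. (D k has_vector_derivative D (Suc k) t) (at t within {0..1}))) \<and>
     (\<forall>t\<in>{0..1}. velocity \<gamma> t \<noteq> 0)"

definition curvilinear_polygon :: "point set \<Rightarrow> (real \<Rightarrow> point) set \<Rightarrow> bool" where
  "curvilinear_polygon K E \<longleftrightarrow>
     open K \<and> bounded K \<and> simply_connected K \<and> lipschitz_boundary K \<and>
     finite E \<and> (\<forall>\<gamma>\<in>E. smooth_arc \<gamma>) \<and>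
     frontier K = (\<Union>\<gamma>\<in>E. path_image \<gamma>) \<and>
     (\<forall>\<gamma>\<in>E. \<forall>\<delta>\<in>E. \<gamma> \<noteq> \<delta> \<longrightarrow> \<gamma> ` {0<..<1} \<inter> \<delta> ` {0<..<1} = {})"

text \<open>Integration with respect to arc length.\<close>

definition boundary_integral :: "(real \<Rightarrow> point) set \<Rightarrow> (point \<Rightarrow> real) \<Rightarrow> real" where
  "boundary_integral E F =
     (\<Sum>\<gamma>\<in>E. LINT t|lebesgue_on {0..1}. F (\<gamma> t) * norm (velocity \<gamma> t))"

text \<open>Well defined at interior points of edges; the finitely many vertices are irrelevant.\<close>

definition outward_normal :: "point set \<Rightarrow> (real \<Rightarrow> point) set \<Rightarrow> point \<Rightarrow> point" where
  "outward_normal K E x = (THE \<nu>. norm \<nu> = 1 \<and>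
     (\<exists>\<gamma>\<in>E. \<exists>t\<in>{0<..<1}. \<gamma> t = x \<and> \<nu> \<bullet> velocity \<gamma> t = 0) \<and>
     (\<exists>\<epsilon>>0. \<forall>s\<in>{0<..<\<epsilon>}. x - s *\<^sub>R \<nu> \<in> K \<and> x + s *\<^sub>R \<nu> \<notin> K))"

definition ccw_tangent :: "point set \<Rightarrow> (real \<Rightarrow> point) set \<Rightarrow> point \<Rightarrow> point" where
  "ccw_tangent K E x = rot (outward_normal K E x)"


section \<open>Polynomials\<close>

definition poly_space :: "int \<Rightarrow> (point \<Rightarrow> real) set" where
  "poly_space j = {p. \<exists>c :: nat \<Rightarrow> nat \<Rightarrow> real.
     \<forall>x y. p (x, y) = (\<Sum>(i, k) \<in> {(i, k). int i + int k \<le> j}. c i k * x ^ i * y ^ k)}"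

definition boundary_poly_space ::
    "point set \<Rightarrow> (real \<Rightarrow> point) set \<Rightarrow> int \<Rightarrow> (point \<Rightarrow> real) set" where
  "boundary_poly_space K E m = {f. continuous_on (frontier K) f \<and>
     (\<forall>\<gamma>\<in>E. \<exists>p\<in>poly_space m. \<forall>x\<in>path_image \<gamma>. f x = p x)}"

definition grad :: "(point \<Rightarrow> real) \<Rightarrow> point \<Rightarrow> point" where  \<comment> \<open>classical gradient\<close>
  "grad u x = (frechet_derivative u (at x) (1, 0), frechet_derivative u (at x) (0, 1))"

definition laplacian :: "(point \<Rightarrow> real) \<Rightarrow> point \<Rightarrow> real" where  \<comment> \<open>classical Laplacian\<close>
  "laplacian u x = fst (grad (\<lambda>y. fst (grad u y)) x) + snd (grad (\<lambda>y. snd (grad u y)) x)"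


section \<open>Sobolev functions\<close>

definition C1 :: "(point \<Rightarrow> real) \<Rightarrow> bool" where
  "C1 \<psi> \<longleftrightarrow> (\<forall>x. \<psi> differentiable (at x)) \<and> continuous_on UNIV (grad \<psi>)"

text \<open>As in Brezis' textbook, weak derivatives are tested against compactly supported \<open>C\<^sup>1\<close>
  functions; this gives the same spaces as testing against smooth ones.\<close>

definition test_function :: "point set \<Rightarrow> (point \<Rightarrow> real) \<Rightarrow> bool" where
  "test_function K \<psi> \<longleftrightarrow> C1 \<psi> \<and> (\<exists>C. compact C \<and> C \<subseteq> K \<and> (\<forall>x. x \<notin> C \<longrightarrow> \<psi> x = 0))"

definition L2 :: "point set \<Rightarrow> (point \<Rightarrow> 'a::euclidean_space) \<Rightarrow> bool" where
  "L2 K u \<longleftrightarrow> u \<in> borel_measurable (lebesgue_on K) \<and>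
     integrable (lebesgue_on K) (\<lambda>x. (norm (u x))\<^sup>2)"

definition weak_gradient :: "point set \<Rightarrow> (point \<Rightarrow> real) \<Rightarrow> (point \<Rightarrow> point) \<Rightarrow> bool" where
  "weak_gradient K u G \<longleftrightarrow> (\<forall>\<psi>. test_function K \<psi> \<longrightarrow>
     (LINT x|lebesgue_on K. u x *\<^sub>R grad \<psi> x) = - (LINT x|lebesgue_on K. \<psi> x *\<^sub>R G x))"

definition H1 :: "point set \<Rightarrow> (point \<Rightarrow> real) \<Rightarrow> bool" where
  "H1 K u \<longleftrightarrow> L2 K u \<and> (\<exists>G. L2 K G \<and> weak_gradient K u G)"

definition wgrad :: "point set \<Rightarrow> (point \<Rightarrow> real) \<Rightarrow> point \<Rightarrow> point" where
    \<comment> \<open>unique almost everywhere on \<open>K\<close>\<close>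
  "wgrad K u = (SOME G. L2 K G \<and> weak_gradient K u G)"

text \<open>\<open>u \<in> H\<^sup>1(K)\<close> and \<open>\<Delta> u = p \<in> L\<^sup>2(K)\<close> in \<open>K\<close>.\<close>

definition weak_laplacian :: "point set \<Rightarrow> (point \<Rightarrow> real) \<Rightarrow> (point \<Rightarrow> real) \<Rightarrow> bool" where
  "weak_laplacian K u p \<longleftrightarrow> H1 K u \<and> L2 K p \<and> (\<forall>\<psi>. test_function K \<psi> \<longrightarrow>
     (LINT x|lebesgue_on K. wgrad K u x \<bullet> grad \<psi> x) = - (LINT x|lebesgue_on K. p x * \<psi> x))"

definition wlap :: "point set \<Rightarrow> (point \<Rightarrow> real) \<Rightarrow> point \<Rightarrow> real" where
  "wlap K u = (SOME p. weak_laplacian K u p)"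

definition L2_boundary :: "(real \<Rightarrow> point) set \<Rightarrow> (point \<Rightarrow> real) \<Rightarrow> bool" where
  "L2_boundary E h \<longleftrightarrow> (\<forall>\<gamma>\<in>E. (\<lambda>t. h (\<gamma> t)) \<in> borel_measurable (lebesgue_on {0..1}) \<and>
     integrable (lebesgue_on {0..1}) (\<lambda>t. (h (\<gamma> t))\<^sup>2 * norm (velocity \<gamma> t)))"

text \<open>The trace operator is the continuous extension, from \<open>H\<^sup>1(K)\<close> to \<open>L\<^sup>2(\<partial>K)\<close>, of the restriction
  to \<open>\<partial>K\<close> of functions that are \<open>C\<^sup>1\<close> up to the boundary; \<open>has_trace\<close> is its graph.\<close>

definition has_trace ::
    "point set \<Rightarrow> (real \<Rightarrow> point) set \<Rightarrow> (point \<Rightarrow> real) \<Rightarrow> (point \<Rightarrow> real) \<Rightarrow> bool" where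
  "has_trace K E u h \<longleftrightarrow> H1 K u \<and> L2_boundary E h \<and>
     (\<exists>\<psi> :: nat \<Rightarrow> point \<Rightarrow> real. (\<forall>n. C1 (\<psi> n)) \<and>
        (\<lambda>n. LINT x|lebesgue_on K. (\<psi> n x - u x)\<^sup>2) \<longlonglongrightarrow> 0 \<and>
        (\<lambda>n. LINT x|lebesgue_on K. (norm (grad (\<psi> n) x - wgrad K u x))\<^sup>2) \<longlonglongrightarrow> 0 \<and>
        (\<lambda>n. boundary_integral E (\<lambda>x. (\<psi> n x - h x)\<^sup>2)) \<longlonglongrightarrow> 0)"

text \<open>The normal derivative of \<open>u \<in> H\<^sup>1(K)\<close> with \<open>\<Delta> u \<in> L\<^sup>2(K)\<close>, as a functional on \<open>H\<^sup>1\<^sup>/\<^sup>2(\<partial>K)\<close>, the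
  range of the trace operator: \<open>normal_derivative K E u h\<close> is the duality pairing
  \<open>\<langle>\<partial>u/\<partial>n, h\<rangle>\<close>, given by Green's formula for any \<open>\<psi> \<in> H\<^sup>1(K)\<close> with trace \<open>h\<close>.\<close>

definition normal_derivative ::
    "point set \<Rightarrow> (real \<Rightarrow> point) set \<Rightarrow> (point \<Rightarrow> real) \<Rightarrow> (point \<Rightarrow> real) \<Rightarrow> real" where
  "normal_derivative K E u h = (THE c. \<forall>\<psi>. has_trace K E \<psi> h \<longrightarrow>
     c = (LINT x|lebesgue_on K. wgrad K u x \<bullet> wgrad K \<psi> x)
       + (LINT x|lebesgue_on K. wlap K u x * \<psi> x))"

definition V_space :: "point set \<Rightarrow> (real \<Rightarrow> point) set \<Rightarrow> int \<Rightarrow> (point \<Rightarrow> real) set" where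
  "V_space K E m = {v. H1 K v \<and> (\<exists>p\<in>poly_space (m - 2). weak_laplacian K v p) \<and>
     (\<exists>f\<in>boundary_poly_space K E m. has_trace K E v f)}"


section \<open>Neumann problems and the construction of \<open>\<Phi>\<close>\<close>

text \<open>Distributional tangential derivative of \<open>h \<in> L\<^sup>2(\<partial>K)\<close>, acting on restrictions to \<open>\<partial>K\<close> of
  \<open>C\<^sup>1\<close> functions.\<close>

definition tangential_derivative ::
    "point set \<Rightarrow> (real \<Rightarrow> point) set \<Rightarrow> (point \<Rightarrow> real) \<Rightarrow> (point \<Rightarrow> real) \<Rightarrow> real" where
  "tangential_derivative K E h \<psi> =
     - boundary_integral E (\<lambda>x. h x * (grad \<psi> x \<bullet> ccw_tangent K E x))"

text \<open>Weak solution in \<open>H\<^sup>1(K)\<close> of \<open>\<Delta> u = 0\<close> in \<open>K\<close>, \<open>\<partial>u/\<partial>n = l\<close> on \<open>\<partial>K\<close>, where \<open>l\<close> is given by its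
  action on \<open>C\<^sup>1\<close> functions; these are dense in \<open>H\<^sup>1(K)\<close>.\<close>

definition neumann_solution ::
    "point set \<Rightarrow> (point \<Rightarrow> real) \<Rightarrow> ((point \<Rightarrow> real) \<Rightarrow> real) \<Rightarrow> bool" where
  "neumann_solution K u l \<longleftrightarrow> weak_laplacian K u (\<lambda>_. 0) \<and>
     (\<forall>\<psi>. C1 \<psi> \<longrightarrow> (LINT x|lebesgue_on K. wgrad K u x \<bullet> grad \<psi> x) = l \<psi>)"

definition Phi_construction ::
    "point set \<Rightarrow> (real \<Rightarrow> point) set \<Rightarrow> (point \<Rightarrow> real) \<Rightarrow> (point \<Rightarrow> real) \<Rightarrow> bool" where
  "Phi_construction K E \<phi> \<Phi> \<longleftrightarrow>
     (\<exists>\<phi>b \<phi>' \<phi>b' \<rho> \<rho>'.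
        has_trace K E \<phi> \<phi>b \<and>
        neumann_solution K \<phi>' (\<lambda>\<psi>. - tangential_derivative K E \<phi>b \<psi>) \<and>
        has_trace K E \<phi>' \<phi>b' \<and>
        neumann_solution K \<rho>
          (\<lambda>\<psi>. boundary_integral E (\<lambda>x. ((\<phi>b x, - \<phi>b' x) \<bullet> outward_normal K E x) * \<psi> x)) \<and>
        neumann_solution K \<rho>'
          (\<lambda>\<psi>. boundary_integral E (\<lambda>x. ((\<phi>b' x, \<phi>b x) \<bullet> outward_normal K E x) * \<psi> x)) \<and>
        (\<forall>x\<in>K. \<Phi> x = (fst x * \<rho> x + snd x * \<rho>' x) / 4))"

end

theory Submission
  imports Defs
begin

text \<open>
  Put \<open>\<phi> = v - P\<close> and \<open>\<psi> = w - Q\<close>; both are harmonic, and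
  \<open>v w = \<phi> \<psi> + Q \<phi> + P \<psi> + P Q\<close>.  Each of the first three products is the Laplacian of a known
  function times a harmonic function (\<open>\<phi> = \<Delta>\<Phi>\<close>, \<open>Q = \<Delta>Qs\<close>, \<open>P = \<Delta>Ps\<close>), so Green's second identity
  turns its integral into one of the three boundary expressions of the theorem.

  The work lies in Green's formula itself, in two forms.  The normal derivative is defined as the
  value of \<open>\<integral> \<nabla>u \<bullet> \<nabla>\<eta> + \<integral> \<Delta>u \<eta>\<close> for any \<open>\<eta> \<in> H\<^sup>1(K)\<close> with the given trace, so one has to show
  that this value does not depend on \<open>\<eta>\<close> (\<open>normal_derivative_eq\<close>).  For the polynomials \<open>Qs\<close> and
  \<open>Ps\<close> the normal derivative is classical, and Green's formula is the divergence theorem on \<open>K\<close>,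
  carried over to traces by approximation (\<open>green_C2_trace\<close>).

  The divergence theorem (\<open>divergence_theorem\<close>) is local by a partition of unity
  (\<open>C1_localisation\<close>).  Near a boundary point, \<open>K\<close> lies above a graph along each direction \<open>d\<close> of an
  open cone, and for such a \<open>d\<close> the integral of the derivative along \<open>d\<close> is an integral over that
  graph, by Fubini's theorem and the fundamental theorem of calculus
  (\<open>integral_directional_derivative\<close>).  The edges parametrise the graph, and the change of variables
  \<open>edge_graph_integral\<close> produces exactly the factor \<open>n \<bullet> d\<close>.  Two independent directions suffice,
  because both sides are linear in \<open>d\<close>; this avoids differentiating the graph.

  Independence of \<open>\<eta>\<close> means that the weak formulation of \<open>\<Delta>u = p\<close>, known for test functions,
  persists for limits \<open>\<eta>\<close> of \<open>C\<^sup>1\<close> functions \<open>d\<^sub>n\<close> with boundary values tending to zero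
  (\<open>weak_form_zero_trace\<close>).  One cuts \<open>d\<^sub>n\<close> off in a boundary layer of width \<open>\<delta>\<close>.  The cut-off has a
  gradient of order \<open>1 / \<delta>\<close>, which a Hardy-type inequality (\<open>boundary_layer_inequality\<close>), itself a
  consequence of the divergence theorem, compensates up to the boundary values of \<open>d\<^sub>n\<close> and its
  energy in the layer.  Letting first \<open>n \<rightarrow> \<infinity>\<close> and then \<open>\<delta> \<rightarrow> 0\<close> gives the claim.
\<close>

section \<open>Calculus of continuously differentiable functions\<close>

text \<open>Carrying the gradient as a second argument lets the closure rules below compute it.\<close>

definition gradient_field :: "(point \<Rightarrow> real) \<Rightarrow> (point \<Rightarrow> point) \<Rightarrow> bool" where
  "gradient_field f g \<longleftrightarrow>
     (\<forall>x. (f has_derivative (\<lambda>h. g x \<bullet> h)) (at x)) \<and> continuous_on UNIV g"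

lemma grad_eqI:
  assumes "(f has_derivative (\<lambda>h. v \<bullet> h)) (at x)"
  shows "grad f x = v"
  using frechet_derivative_at[OF assms] unfolding grad_def
  by (metis inner_Pair inner_real_def mult.right_neutral mult_zero_right add.right_neutral
      add.left_neutral prod.collapse)

lemma has_derivative_grad:
  assumes "f differentiable (at x)"
  shows "(f has_derivative (\<lambda>h. grad f x \<bullet> h)) (at x)"
proof -
  let ?D = "frechet_derivative f (at x)"
  have D: "(f has_derivative ?D) (at x)"
    using assms frechet_derivative_works by blast
  then have lin: "linear ?D" by (rule has_derivative_linear)
  have "?D h = grad f x \<bullet> h" for h
  proof -
    have "h = fst h *\<^sub>R (1, 0) + snd h *\<^sub>R (0, 1)" by (cases h) simp
    then have "?D h = ?D (fst h *\<^sub>R (1, 0) + snd h *\<^sub>R (0, 1))" by (rule arg_cong)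
    then have "?D h = fst h *\<^sub>R ?D (1, 0) + snd h *\<^sub>R ?D (0, 1)"
      unfolding linear_add[OF lin] linear_scale[OF lin] .
    then show ?thesis by (cases h) (simp add: grad_def)
  qed
  then have "?D = (\<lambda>h. grad f x \<bullet> h)" by auto
  with D show ?thesis by simp
qed

lemma C1_gradient_field: "C1 f \<Longrightarrow> gradient_field f (grad f)"
  unfolding C1_def gradient_field_def using has_derivative_grad by blast

lemma gradient_fieldD:
  assumes "gradient_field f g"
  shows "C1 f" "grad f = g"
proof -
  show "grad f = g"
    using assms grad_eqI unfolding gradient_field_def by blast
  then show "C1 f"
    using assms unfolding gradient_field_def C1_def differentiable_def by auto
qed

lemma C1_continuous_on: "C1 f \<Longrightarrow> continuous_on S f"
  unfolding C1_def
  by (meson continuous_at_imp_continuous_on differentiable_imp_continuous_within)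

lemma C1_continuous_on_grad: "C1 f \<Longrightarrow> continuous_on S (grad f)"
  unfolding C1_def by (meson continuous_on_subset subset_UNIV)

lemma gradient_field_const: "gradient_field (\<lambda>_. c) (\<lambda>_. 0)"
  unfolding gradient_field_def by (auto intro!: derivative_eq_intros)

lemma gradient_field_inner: "gradient_field (\<lambda>x. (x - z) \<bullet> e) (\<lambda>_. e)"
  unfolding gradient_field_def
  by (auto intro!: derivative_eq_intros simp: inner_commute)

lemma gradient_field_add:
  assumes "gradient_field f f'" "gradient_field g g'"
  shows "gradient_field (\<lambda>x. f x + g x) (\<lambda>x. f' x + g' x)"
  using assms unfolding gradient_field_def
  by (auto intro!: derivative_eq_intros continuous_intros simp: inner_add_left)

lemma gradient_field_diff:
  assumes "gradient_field f f'" "gradient_field g g'"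
  shows "gradient_field (\<lambda>x. f x - g x) (\<lambda>x. f' x - g' x)"
  using assms unfolding gradient_field_def
  by (auto intro!: derivative_eq_intros continuous_intros simp: inner_diff_left)

lemma gradient_field_imp_continuous:
  "gradient_field f f' \<Longrightarrow> continuous_on S f"
  using C1_continuous_on gradient_fieldD(1) by blast

lemma gradient_field_mult:
  assumes "gradient_field f f'" "gradient_field g g'"
  shows "gradient_field (\<lambda>x. f x * g x) (\<lambda>x. f x *\<^sub>R g' x + g x *\<^sub>R f' x)"
proof -
  have "((\<lambda>x. f x * g x) has_derivative (\<lambda>h. (f x *\<^sub>R g' x + g x *\<^sub>R f' x) \<bullet> h)) (at x)" for x
  proof -
    have "(f has_derivative (\<lambda>h. f' x \<bullet> h)) (at x)" "(g has_derivative (\<lambda>h. g' x \<bullet> h)) (at x)"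
      using assms unfolding gradient_field_def by blast+
    from has_derivative_mult[OF this] show ?thesis
      by (simp add: inner_add_left algebra_simps)
  qed
  moreover have "continuous_on UNIV (\<lambda>x. f x *\<^sub>R g' x + g x *\<^sub>R f' x)"
    using assms gradient_field_imp_continuous[OF assms(1)] gradient_field_imp_continuous[OF assms(2)]
    unfolding gradient_field_def by (auto intro!: continuous_intros)
  ultimately show ?thesis unfolding gradient_field_def by blast
qed

lemma gradient_field_compose:
  assumes f: "gradient_field f f'"
    and F: "\<And>s. s \<in> range f \<Longrightarrow> (F has_real_derivative F' s) (at s)"
    and F': "continuous_on (range f) F'"
  shows "gradient_field (\<lambda>x. F (f x)) (\<lambda>x. F' (f x) *\<^sub>R f' x)"
proof -
  have "((\<lambda>x. F (f x)) has_derivative (\<lambda>h. (F' (f x) *\<^sub>R f' x) \<bullet> h)) (at x)" for x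
  proof -
    have "(f has_derivative (\<lambda>h. f' x \<bullet> h)) (at x)"
      using f unfolding gradient_field_def by blast
    moreover have "(F has_derivative (\<lambda>t. F' (f x) * t)) (at (f x))"
      using F[of "f x"] unfolding has_field_derivative_def by simp
    ultimately have "((\<lambda>x. F (f x)) has_derivative (\<lambda>h. F' (f x) * (f' x \<bullet> h))) (at x)"
      by (rule has_derivative_compose)
    then show ?thesis by simp
  qed
  moreover have "continuous_on UNIV (\<lambda>x. F' (f x) *\<^sub>R f' x)"
    using f F' gradient_field_imp_continuous[OF f] unfolding gradient_field_def
    by (auto intro!: continuous_intros continuous_on_compose2[of "range f" F' UNIV f])
  ultimately show ?thesis unfolding gradient_field_def by blast
qed

lemma gradient_field_sum:
  assumes "\<And>i. i \<in> I \<Longrightarrow> gradient_field (f i) (f' i)"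
  shows "gradient_field (\<lambda>x. \<Sum>i\<in>I. f i x) (\<lambda>x. \<Sum>i\<in>I. f' i x)"
  using assms
  by (induction I rule: infinite_finite_induct)
     (auto intro: gradient_field_const gradient_field_add)

lemma C1_const: "C1 (\<lambda>_. c)"
  using gradient_field_const gradient_fieldD(1) by blast

lemma C1_add: "C1 f \<Longrightarrow> C1 g \<Longrightarrow> C1 (\<lambda>x. f x + g x)"
  using gradient_field_add C1_gradient_field gradient_fieldD(1) by blast

lemma C1_diff: "C1 f \<Longrightarrow> C1 g \<Longrightarrow> C1 (\<lambda>x. f x - g x)"
  using gradient_field_diff C1_gradient_field gradient_fieldD(1) by blast

lemma C1_mult: "C1 f \<Longrightarrow> C1 g \<Longrightarrow> C1 (\<lambda>x. f x * g x)"
  using gradient_field_mult C1_gradient_field gradient_fieldD(1) by blast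

lemma C1_sum: "(\<And>i. i \<in> I \<Longrightarrow> C1 (f i)) \<Longrightarrow> C1 (\<lambda>x. \<Sum>i\<in>I. f i x)"
  using gradient_field_sum[of I f "\<lambda>i. grad (f i)"] C1_gradient_field gradient_fieldD(1) by blast

lemma grad_add: "C1 f \<Longrightarrow> C1 g \<Longrightarrow> grad (\<lambda>x. f x + g x) = (\<lambda>x. grad f x + grad g x)"
  by (intro gradient_fieldD(2) gradient_field_add C1_gradient_field)

lemma grad_diff: "C1 f \<Longrightarrow> C1 g \<Longrightarrow> grad (\<lambda>x. f x - g x) = (\<lambda>x. grad f x - grad g x)"
  by (intro gradient_fieldD(2) gradient_field_diff C1_gradient_field)

lemma grad_mult:
  "C1 f \<Longrightarrow> C1 g \<Longrightarrow> grad (\<lambda>x. f x * g x) = (\<lambda>x. f x *\<^sub>R grad g x + g x *\<^sub>R grad f x)"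
  by (intro gradient_fieldD(2) gradient_field_mult C1_gradient_field)

lemma grad_eq_0_open:
  assumes "open S" "x \<in> S" "\<And>y. y \<in> S \<Longrightarrow> f y = 0"
  shows "grad f x = 0"
proof -
  have "((\<lambda>_. 0) has_derivative (\<lambda>h. 0 \<bullet> h)) (at x)" by simp
  then have "(f has_derivative (\<lambda>h. 0 \<bullet> h)) (at x)"
    by (rule has_derivative_transform_within_open[OF _ assms(1,2)]) (use assms in auto)
  then show ?thesis by (rule grad_eqI)
qed

lemma test_function_grad_eq_0:
  assumes "test_function U \<phi>" "x \<notin> U"
  shows "grad \<phi> x = 0"
proof -
  obtain C where "compact C" "C \<subseteq> U" "\<forall>x. x \<notin> C \<longrightarrow> \<phi> x = 0"
    using assms unfolding test_function_def by blast
  then show ?thesis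
    using assms(2) by (intro grad_eq_0_open[of "- C"]) (auto simp: compact_imp_closed open_Compl)
qed

lemma test_function_mult:
  assumes "test_function U \<phi>" "C1 \<psi>"
  shows "test_function U (\<lambda>x. \<phi> x * \<psi> x)"
  using assms C1_mult unfolding test_function_def by (metis mult_zero_left)

lemma test_function_subset: "test_function U \<phi> \<Longrightarrow> U \<subseteq> V \<Longrightarrow> test_function V \<phi>"
  unfolding test_function_def by blast

text \<open>Squares of positive parts serve throughout as elementary \<open>C\<^sup>1\<close> cut-offs.\<close>

lemma has_real_derivative_max0_sq:
  "((\<lambda>s::real. (max 0 s)\<^sup>2) has_real_derivative 2 * max 0 s) (at s)"
proof (cases s "0::real" rule: linorder_cases)
  case less
  have "((\<lambda>_::real. 0) has_real_derivative 2 * max 0 s) (at s)" using less by simp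
  then show ?thesis
    by (rule has_field_derivative_transform_within_open[of _ _ _ "{..<0}"]) (use less in auto)
next
  case greater
  have "((\<lambda>s::real. s\<^sup>2) has_real_derivative 2 * max 0 s) (at s)"
    using greater by (auto intro!: derivative_eq_intros)
  then show ?thesis
    by (rule has_field_derivative_transform_within_open[of _ _ _ "{0<..}"]) (use greater in auto)
next
  case equal
  have "((\<lambda>h. ((max 0 (0 + h))\<^sup>2 - (max 0 0)\<^sup>2) / h) \<longlongrightarrow> 0) (at (0::real))"
  proof (rule Lim_null_comparison)
    show "\<forall>\<^sub>F h in at 0. norm (((max 0 (0 + h))\<^sup>2 - (max 0 0)\<^sup>2) / h) \<le> \<bar>h::real\<bar>"
      by (rule always_eventually) (auto simp: max_def power2_eq_square)
    show "((\<lambda>h::real. \<bar>h\<bar>) \<longlongrightarrow> 0) (at 0)" by (auto intro!: tendsto_eq_intros)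
  qed
  then show ?thesis using equal unfolding DERIV_def by simp
qed

lemma gradient_field_max0_sq:
  assumes "gradient_field f f'"
  shows "gradient_field (\<lambda>x. (max 0 (f x))\<^sup>2) (\<lambda>x. (2 * max 0 (f x)) *\<^sub>R f' x)"
  by (intro gradient_field_compose[OF assms] has_real_derivative_max0_sq continuous_intros)

definition bump :: "point \<Rightarrow> real \<Rightarrow> point \<Rightarrow> real" where
  "bump z \<rho> x = (max 0 (\<rho>\<^sup>2 - (x - z) \<bullet> (x - z)))\<^sup>2"

lemma C1_bump: "C1 (bump z \<rho>)"
proof -
  have "gradient_field (\<lambda>x. (x - z) \<bullet> (x - z)) (\<lambda>x. 2 *\<^sub>R (x - z))"
    unfolding gradient_field_def
    by (auto intro!: derivative_eq_intros continuous_intros simp: inner_commute algebra_simps)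
  then have "gradient_field (\<lambda>x. \<rho>\<^sup>2 - (x - z) \<bullet> (x - z)) (\<lambda>x. 0 - 2 *\<^sub>R (x - z))"
    by (rule gradient_field_diff[OF gradient_field_const])
  from gradient_field_max0_sq[OF this] show ?thesis
    unfolding bump_def[abs_def] by (rule gradient_fieldD(1))
qed

lemma bump_nonneg: "0 \<le> bump z \<rho> x" by (simp add: bump_def)

lemma bump_pos_iff: "0 < \<rho> \<Longrightarrow> 0 < bump z \<rho> x \<longleftrightarrow> x \<in> ball z \<rho>"
proof -
  assume "0 < \<rho>"
  have "(x - z) \<bullet> (x - z) < \<rho>\<^sup>2 \<longleftrightarrow> norm (x - z) < \<rho>"
    using \<open>0 < \<rho>\<close> by (simp add: power2_norm_eq_inner[symmetric] power2_less_imp_less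
        power_strict_mono abs_le_square_iff linorder_not_le[symmetric] power2_le_iff_abs_le)
  then show ?thesis
    by (auto simp: bump_def dist_norm norm_minus_commute max_def)
qed

lemma bump_eq_0: "0 < \<rho> \<Longrightarrow> x \<notin> ball z \<rho> \<Longrightarrow> bump z \<rho> x = 0"
  using bump_pos_iff[of \<rho> z x] bump_nonneg[of z \<rho> x] by linarith

text \<open>Locality principle: a partition of unity made of bumps, normalised by a function that
  agrees with their sum near \<open>C\<close> and is bounded away from zero, splits \<open>\<phi>\<close> into pieces
  supported in small balls and a remainder that vanishes near \<open>C\<close>.\<close>

lemma C1_localisation:
  assumes C: "compact C"
    and add: "\<And>\<phi> \<psi>. C1 \<phi> \<Longrightarrow> C1 \<psi> \<Longrightarrow> P \<phi> \<Longrightarrow> P \<psi> \<Longrightarrow> P (\<lambda>x. \<phi> x + \<psi> x)"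
    and away: "\<And>\<phi> V. C1 \<phi> \<Longrightarrow> open V \<Longrightarrow> C \<subseteq> V \<Longrightarrow> (\<And>x. x \<in> V \<Longrightarrow> \<phi> x = 0) \<Longrightarrow> P \<phi>"
    and local: "\<And>z. z \<in> C \<Longrightarrow>
      \<exists>\<rho>>0. \<forall>\<phi>. C1 \<phi> \<longrightarrow> (\<forall>x. x \<notin> ball z \<rho> \<longrightarrow> \<phi> x = 0) \<longrightarrow> P \<phi>"
    and \<phi>: "C1 \<phi>"
  shows "P \<phi>"
proof -
  obtain r where r: "\<And>z. z \<in> C \<Longrightarrow> 0 < r z \<and>
      (\<forall>\<phi>. C1 \<phi> \<longrightarrow> (\<forall>x. x \<notin> ball z (r z) \<longrightarrow> \<phi> x = 0) \<longrightarrow> P \<phi>)"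
    using local by metis
  have "C \<subseteq> (\<Union>z\<in>C. ball z (r z))" using r by auto
  then obtain Z where Z: "Z \<subseteq> C" "finite Z" "C \<subseteq> (\<Union>z\<in>Z. ball z (r z))"
    using compactE_image[OF C, of C "\<lambda>z. ball z (r z)"] by auto
  define b where "b = (\<lambda>z. bump z (r z))"
  define S where "S = (\<lambda>x. \<Sum>z\<in>Z. b z x)"
  have C1S: "C1 S" unfolding S_def by (intro C1_sum) (simp add: b_def C1_bump)
  have Snn: "0 \<le> S x" for x unfolding S_def b_def by (simp add: sum_nonneg bump_nonneg)
  have Spos: "0 < S x" if x: "x \<in> C" for x
  proof -
    obtain z where z: "z \<in> Z" "x \<in> ball z (r z)" using Z x by blast
    then have "0 < b z x" using r Z bump_pos_iff unfolding b_def by blast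
    then show ?thesis unfolding S_def
      using z Z(2) by (intro sum_pos2[of Z z]) (auto simp: b_def bump_nonneg)
  qed
  obtain \<epsilon> where \<epsilon>: "0 < \<epsilon>" "\<And>x. x \<in> C \<Longrightarrow> 2 * \<epsilon> \<le> S x"
  proof (cases "C = {}")
    case False
    then obtain x0 where "x0 \<in> C" "\<And>x. x \<in> C \<Longrightarrow> S x0 \<le> S x"
      using continuous_attains_inf[OF C _ C1_continuous_on[OF C1S]] by blast
    then show ?thesis using that[of "S x0 / 2"] Spos by auto
  qed (use that[of 1] in auto)
  define T where "T = (\<lambda>x. S x + (max 0 (\<epsilon> - S x))\<^sup>2)"
  have C1T: "C1 T"
    unfolding T_def
    by (intro C1_add C1S gradient_fieldD(1)[OF gradient_field_max0_sq[OF C1_gradient_field]]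
        C1_diff C1_const)
  have Tpos: "0 < T x" for x
  proof (cases "S x = 0")
    case False
    then show ?thesis using Snn[of x] unfolding T_def by (simp add: add_pos_nonneg)
  qed (use \<epsilon> in \<open>simp add: T_def\<close>)
  have C1inv: "C1 (\<lambda>x. inverse (T x))"
  proof -
    have "gradient_field (\<lambda>x. inverse (T x)) (\<lambda>x. (- (inverse (T x) ^ Suc (Suc 0))) *\<^sub>R grad T x)"
      by (rule gradient_field_compose[OF C1_gradient_field[OF C1T]])
         (use Tpos in \<open>force intro!: DERIV_inverse continuous_intros simp: less_imp_neq[symmetric]\<close>)+
    then show ?thesis by (rule gradient_fieldD(1))
  qed
  have C1p: "C1 (\<lambda>x. b z x * (\<phi> x * inverse (T x)))" for z
    unfolding b_def by (intro C1_mult C1_bump \<phi> C1inv)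
  have piece: "P (\<lambda>x. b z x * (\<phi> x * inverse (T x)))" if "z \<in> Z" for z
    using r[of z] that Z C1p[of z] by (auto simp: b_def bump_eq_0)
  define rest where "rest = (\<lambda>x. \<phi> x * (1 - S x * inverse (T x)))"
  have C1r: "C1 rest" unfolding rest_def
    by (intro C1_mult C1_diff C1_const \<phi> C1S C1inv)
  have prest: "P rest"
  proof (rule away[OF C1r, of "{x. \<epsilon> < S x}"])
    show "open {x. \<epsilon> < S x}"
      by (intro open_Collect_less continuous_on_const C1_continuous_on C1S)
    show "C \<subseteq> {x. \<epsilon> < S x}" using \<epsilon> by force
    show "rest x = 0" if "x \<in> {x. \<epsilon> < S x}" for x
    proof -
      have "T x = S x" "S x \<noteq> 0" using that \<epsilon> by (auto simp: T_def)
      then show ?thesis by (simp add: rest_def)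
    qed
  qed
  have all: "P (\<lambda>x. rest x + (\<Sum>z\<in>Z'. b z x * (\<phi> x * inverse (T x))))"
    if "Z' \<subseteq> Z" for Z'
    using finite_subset[OF that Z(2)] that
  proof (induction Z')
    case empty
    then show ?case using prest by simp
  next
    case (insert z Z')
    have "P (\<lambda>x. (rest x + (\<Sum>z\<in>Z'. b z x * (\<phi> x * inverse (T x))))
        + b z x * (\<phi> x * inverse (T x)))"
    proof (rule add)
      show "C1 (\<lambda>x. rest x + (\<Sum>z\<in>Z'. b z x * (\<phi> x * inverse (T x))))"
        by (intro C1_add C1r C1_sum C1p)
    qed (use insert C1p piece in auto)
    then show ?case using insert by (simp add: add_ac)
  qed
  have "(\<lambda>x. rest x + (\<Sum>z\<in>Z. b z x * (\<phi> x * inverse (T x)))) = \<phi>"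
  proof
    fix x
    have "(\<Sum>z\<in>Z. b z x * (\<phi> x * inverse (T x))) = S x * (\<phi> x * inverse (T x))"
      by (simp add: S_def sum_distrib_right)
    then show "rest x + (\<Sum>z\<in>Z. b z x * (\<phi> x * inverse (T x))) = \<phi> x"
      by (simp add: rest_def algebra_simps)
  qed
  with all[OF order_refl] show ?thesis by simp
qed

section \<open>Square-integrable functions\<close>

text \<open>An arbitrary measure is allowed so that the same limit theorems serve for \<open>K\<close> and, after
  weighting with the square root of the speed, for the edges.\<close>

definition sq_int :: "'b measure \<Rightarrow> ('b \<Rightarrow> 'a::euclidean_space) \<Rightarrow> bool" where
  "sq_int M f \<longleftrightarrow> f \<in> borel_measurable M \<and> integrable M (\<lambda>x. (norm (f x))\<^sup>2)"

lemma L2_iff_sq_int: "L2 K f \<longleftrightarrow> sq_int (lebesgue_on K) f"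
  by (simp add: L2_def sq_int_def)

lemma sq_int_measurable: "sq_int M f \<Longrightarrow> f \<in> borel_measurable M"
  and sq_int_norm_sq: "sq_int M f \<Longrightarrow> integrable M (\<lambda>x. (norm (f x))\<^sup>2)"
  by (simp_all add: sq_int_def)

lemma sq_int_add:
  assumes "sq_int M f" "sq_int M g"
  shows "sq_int M (\<lambda>x. f x + g x)"
proof -
  have "integrable M (\<lambda>x. (norm (f x + g x))\<^sup>2)"
  proof (rule Bochner_Integration.integrable_bound)
    show "integrable M (\<lambda>x. 2 * (norm (f x))\<^sup>2 + 2 * (norm (g x))\<^sup>2)"
      by (intro Bochner_Integration.integrable_add integrable_mult_right impI sq_int_norm_sq assms)
    show "(\<lambda>x. (norm (f x + g x))\<^sup>2) \<in> borel_measurable M"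
      using assms[THEN sq_int_measurable] by measurable
    have "(norm (a + b))\<^sup>2 \<le> 2 * (norm a)\<^sup>2 + 2 * (norm b)\<^sup>2" for a b :: 'b
    proof -
      have "(norm (a + b))\<^sup>2 \<le> (norm a + norm b)\<^sup>2"
        by (intro power_mono norm_triangle_ineq norm_ge_zero)
      also have "\<dots> \<le> 2 * (norm a)\<^sup>2 + 2 * (norm b)\<^sup>2"
        using sum_squares_bound[of "norm a" "norm b"] by (simp add: power2_sum)
      finally show ?thesis .
    qed
    then show "AE x in M. norm ((norm (f x + g x))\<^sup>2) \<le> norm (2 * (norm (f x))\<^sup>2 + 2 * (norm (g x))\<^sup>2)"
      by simp
  qed
  then show ?thesis
    using assms[THEN sq_int_measurable] unfolding sq_int_def by simp
qed

lemma sq_int_scaleR_bounded: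
  fixes a :: "'b \<Rightarrow> real"
  assumes f: "sq_int M f" and a: "a \<in> borel_measurable M"
    and B: "\<And>x. x \<in> space M \<Longrightarrow> \<bar>a x\<bar> \<le> B"
  shows "sq_int M (\<lambda>x. a x *\<^sub>R f x)"
proof -
  note [measurable] = sq_int_measurable[OF f] a
  have "integrable M (\<lambda>x. (norm (a x *\<^sub>R f x))\<^sup>2)"
  proof (rule Bochner_Integration.integrable_bound)
    show "integrable M (\<lambda>x. B\<^sup>2 * (norm (f x))\<^sup>2)"
      using f by (auto dest: sq_int_norm_sq)
    show "(\<lambda>x. (norm (a x *\<^sub>R f x))\<^sup>2) \<in> borel_measurable M" by measurable
    show "AE x in M. norm ((norm (a x *\<^sub>R f x))\<^sup>2) \<le> norm (B\<^sup>2 * (norm (f x))\<^sup>2)"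
    proof (rule AE_I2)
      fix x assume "x \<in> space M"
      then have "(a x)\<^sup>2 \<le> B\<^sup>2" using B[of x] by (simp add: abs_le_square_iff[symmetric])
      then show "norm ((norm (a x *\<^sub>R f x))\<^sup>2) \<le> norm (B\<^sup>2 * (norm (f x))\<^sup>2)"
        by (simp add: power_mult_distrib mult_right_mono)
    qed
  qed
  then show ?thesis unfolding sq_int_def by simp
qed

lemma sq_int_scaleR: "sq_int M f \<Longrightarrow> sq_int M (\<lambda>x. c *\<^sub>R f x)"
  by (rule sq_int_scaleR_bounded[where B = "\<bar>c\<bar>"]) auto

lemma sq_int_diff: "sq_int M f \<Longrightarrow> sq_int M g \<Longrightarrow> sq_int M (\<lambda>x. f x - g x)"
  using sq_int_add[of M f "\<lambda>x. (-1) *\<^sub>R g x"] sq_int_scaleR[of M g "-1"] by simp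

lemma integrable_inner_sq_int:
  assumes "sq_int M f" "sq_int M g"
  shows "integrable M (\<lambda>x. f x \<bullet> g x)"
proof (rule Bochner_Integration.integrable_bound)
  show "integrable M (\<lambda>x. (norm (f x))\<^sup>2 + (norm (g x))\<^sup>2)"
    using assms by (auto dest: sq_int_norm_sq)
  show "(\<lambda>x. f x \<bullet> g x) \<in> borel_measurable M"
    using assms[THEN sq_int_measurable] by measurable
  have "\<bar>a \<bullet> b\<bar> \<le> (norm a)\<^sup>2 + (norm b)\<^sup>2" for a b :: 'b
    using Cauchy_Schwarz_ineq2[of a b] sum_squares_bound[of "norm a" "norm b"]
      mult_nonneg_nonneg[OF norm_ge_zero[of a] norm_ge_zero[of b]] by linarith
  then show "AE x in M. norm (f x \<bullet> g x) \<le> norm ((norm (f x))\<^sup>2 + (norm (g x))\<^sup>2)"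
    by simp
qed

lemma integrable_mult_sq_int:
  fixes f g :: "'b \<Rightarrow> real"
  shows "sq_int M f \<Longrightarrow> sq_int M g \<Longrightarrow> integrable M (\<lambda>x. f x * g x)"
  using integrable_inner_sq_int[of M f g] by (simp add: inner_real_def)

lemma Cauchy_Schwarz_integral:
  assumes f: "sq_int M f" and g: "sq_int M g"
  shows "\<bar>\<integral>x. f x \<bullet> g x \<partial>M\<bar> \<le> sqrt (\<integral>x. (norm (f x))\<^sup>2 \<partial>M) * sqrt (\<integral>x. (norm (g x))\<^sup>2 \<partial>M)"
proof -
  let ?A = "\<integral>x. (norm (f x))\<^sup>2 \<partial>M" and ?B = "\<integral>x. (norm (g x))\<^sup>2 \<partial>M" and ?C = "\<integral>x. f x \<bullet> g x \<partial>M"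
  \<comment> \<open>the quadratic polynomial \<open>t \<mapsto> \<integral> |f + t g|\<^sup>2\<close> is nonnegative; evaluate it at its minimum\<close>
  have quad: "0 \<le> ?A + 2 * t * ?C + t\<^sup>2 * ?B" for t
  proof -
    have "0 \<le> (\<integral>x. (norm (f x + t *\<^sub>R g x))\<^sup>2 \<partial>M)" by simp
    also have "\<dots> = (\<integral>x. (norm (f x))\<^sup>2 + 2 * t * (f x \<bullet> g x) + t\<^sup>2 * (norm (g x))\<^sup>2 \<partial>M)"
      by (intro Bochner_Integration.integral_cong refl)
         (simp add: power2_norm_eq_inner inner_add_left inner_add_right inner_commute
           power2_eq_square[of t] algebra_simps)
    also have "\<dots> = ?A + 2 * t * ?C + t\<^sup>2 * ?B"
      using f g integrable_inner_sq_int[OF f g] by (simp add: sq_int_norm_sq)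
    finally show ?thesis .
  qed
  have B0: "0 \<le> ?B" and A0: "0 \<le> ?A" by simp_all
  have "?C\<^sup>2 \<le> ?A * ?B"
  proof (cases "?B = 0")
    case True
    have "?C = 0"
    proof (rule ccontr)
      assume C: "?C \<noteq> 0"
      have "0 \<le> ?A + 2 * (- (?A + 1) / (2 * ?C)) * ?C"
        using quad[of "- (?A + 1) / (2 * ?C)"] True by simp
      also have "\<dots> = - 1" using C by (simp add: field_simps)
      finally show False by simp
    qed
    then show ?thesis using True by simp
  next
    case False
    then have "0 < ?B" using B0 by linarith
    have "0 \<le> ?A + 2 * (- ?C / ?B) * ?C + (- ?C / ?B)\<^sup>2 * ?B" by (rule quad)
    also have "\<dots> = ?A - ?C\<^sup>2 / ?B" using False by (simp add: power2_eq_square field_simps)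
    finally show ?thesis using \<open>0 < ?B\<close> by (simp add: field_simps)
  qed
  then have "sqrt (?C\<^sup>2) \<le> sqrt (?A * ?B)" by (rule real_sqrt_le_mono)
  then show ?thesis by (simp add: real_sqrt_mult)
qed

lemma tendsto_integral_inner:
  assumes F: "sq_int M F" and f: "sq_int M f" and fn: "\<And>n. sq_int M (fn n)"
    and lim: "(\<lambda>n. \<integral>x. (norm (fn n x - f x))\<^sup>2 \<partial>M) \<longlonglongrightarrow> 0"
  shows "(\<lambda>n. \<integral>x. F x \<bullet> fn n x \<partial>M) \<longlonglongrightarrow> (\<integral>x. F x \<bullet> f x \<partial>M)"
proof (rule LIM_zero_cancel)
  show "(\<lambda>n. (\<integral>x. F x \<bullet> fn n x \<partial>M) - (\<integral>x. F x \<bullet> f x \<partial>M)) \<longlonglongrightarrow> 0"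
  proof (rule Lim_null_comparison)
    show "\<forall>\<^sub>F n in sequentially. norm ((\<integral>x. F x \<bullet> fn n x \<partial>M) - (\<integral>x. F x \<bullet> f x \<partial>M))
       \<le> sqrt (\<integral>x. (norm (F x))\<^sup>2 \<partial>M) * sqrt (\<integral>x. (norm (fn n x - f x))\<^sup>2 \<partial>M)"
    proof (rule always_eventually, rule allI)
      fix n
      have "(\<integral>x. F x \<bullet> (fn n x - f x) \<partial>M) = (\<integral>x. F x \<bullet> fn n x \<partial>M) - (\<integral>x. F x \<bullet> f x \<partial>M)"
        using integrable_inner_sq_int[OF F fn] integrable_inner_sq_int[OF F f]
        by (simp add: inner_diff_right)
      then show "norm ((\<integral>x. F x \<bullet> fn n x \<partial>M) - (\<integral>x. F x \<bullet> f x \<partial>M))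
         \<le> sqrt (\<integral>x. (norm (F x))\<^sup>2 \<partial>M) * sqrt (\<integral>x. (norm (fn n x - f x))\<^sup>2 \<partial>M)"
        using Cauchy_Schwarz_integral[OF F sq_int_diff[OF fn[of n] f]] by simp
    qed
    have "(\<lambda>n. sqrt (\<integral>x. (norm (fn n x - f x))\<^sup>2 \<partial>M)) \<longlonglongrightarrow> sqrt 0"
      by (intro tendsto_real_sqrt lim)
    then show "(\<lambda>n. sqrt (\<integral>x. (norm (F x))\<^sup>2 \<partial>M) * sqrt (\<integral>x. (norm (fn n x - f x))\<^sup>2 \<partial>M)) \<longlonglongrightarrow> 0"
      using tendsto_mult_left by fastforce
  qed
qed

lemma norm_diff_sq_le: "(norm (a - b))\<^sup>2 \<le> 2 * (norm a)\<^sup>2 + 2 * (norm b)\<^sup>2"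
  for a b :: "'a::real_normed_vector"
proof -
  have "(norm (a - b))\<^sup>2 \<le> (norm a + norm b)\<^sup>2"
    by (intro power_mono norm_triangle_ineq4 norm_ge_zero)
  also have "\<dots> \<le> 2 * (norm a)\<^sup>2 + 2 * (norm b)\<^sup>2"
    using sum_squares_bound[of "norm a" "norm b"] by (simp add: power2_sum)
  finally show ?thesis .
qed

lemma sq_int_lim_diff:
  assumes "sq_int M f" "sq_int M g" "\<And>n. sq_int M (fn n)" "\<And>n. sq_int M (gn n)"
    and "(\<lambda>n. \<integral>x. (norm (fn n x - f x))\<^sup>2 \<partial>M) \<longlonglongrightarrow> 0"
    and "(\<lambda>n. \<integral>x. (norm (gn n x - g x))\<^sup>2 \<partial>M) \<longlonglongrightarrow> 0"
  shows "(\<lambda>n. \<integral>x. (norm ((fn n x - gn n x) - (f x - g x)))\<^sup>2 \<partial>M) \<longlonglongrightarrow> 0"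
proof (rule Lim_null_comparison)
  show "\<forall>\<^sub>F n in sequentially. norm (\<integral>x. (norm ((fn n x - gn n x) - (f x - g x)))\<^sup>2 \<partial>M)
     \<le> 2 * (\<integral>x. (norm (fn n x - f x))\<^sup>2 \<partial>M) + 2 * (\<integral>x. (norm (gn n x - g x))\<^sup>2 \<partial>M)"
  proof (rule always_eventually, rule allI)
    fix n
    have i: "integrable M (\<lambda>x. (norm (fn n x - f x))\<^sup>2)" "integrable M (\<lambda>x. (norm (gn n x - g x))\<^sup>2)"
      "integrable M (\<lambda>x. (norm ((fn n x - gn n x) - (f x - g x)))\<^sup>2)"
      using assms(1-4) by (auto intro!: sq_int_norm_sq sq_int_diff)
    have "(\<integral>x. (norm ((fn n x - gn n x) - (f x - g x)))\<^sup>2 \<partial>M)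
       \<le> (\<integral>x. 2 * (norm (fn n x - f x))\<^sup>2 + 2 * (norm (gn n x - g x))\<^sup>2 \<partial>M)"
    proof (rule integral_mono)
      show "(norm ((fn n x - gn n x) - (f x - g x)))\<^sup>2
          \<le> 2 * (norm (fn n x - f x))\<^sup>2 + 2 * (norm (gn n x - g x))\<^sup>2" for x
        using norm_diff_sq_le[of "fn n x - f x" "gn n x - g x"] by (simp add: algebra_simps)
    qed (use i in auto)
    then show "norm (\<integral>x. (norm ((fn n x - gn n x) - (f x - g x)))\<^sup>2 \<partial>M)
     \<le> 2 * (\<integral>x. (norm (fn n x - f x))\<^sup>2 \<partial>M) + 2 * (\<integral>x. (norm (gn n x - g x))\<^sup>2 \<partial>M)"
      using i by simp
  qed
  show "(\<lambda>n. 2 * (\<integral>x. (norm (fn n x - f x))\<^sup>2 \<partial>M) + 2 * (\<integral>x. (norm (gn n x - g x))\<^sup>2 \<partial>M)) \<longlonglongrightarrow> 0"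
    using assms(5,6) by (auto intro!: tendsto_eq_intros)
qed

lemma finite_measure_lebesgue_on_bounded:
  assumes "open K" "bounded (K :: 'a::euclidean_space set)"
  shows "finite_measure (lebesgue_on K)"
proof
  have "K \<in> lmeasurable" by (rule lmeasurable_open[OF assms(2,1)])
  then show "emeasure (lebesgue_on K) (space (lebesgue_on K)) \<noteq> \<infinity>"
    using fmeasurableD2[of K lebesgue] by (simp add: emeasure_restrict_space fmeasurableD del: emeasure_completion)
qed

lemma borel_measurable_lebesgue_on_continuous:
  assumes "continuous_on UNIV f"
  shows "f \<in> borel_measurable (lebesgue_on K)"
  using borel_measurable_continuous_onI[OF assms]
  by (intro measurable_restrict_space1 measurable_completion) simp

lemma bounded_on_bounded_continuous:
  fixes f :: "'a::euclidean_space \<Rightarrow> 'b::real_normed_vector"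
  assumes "continuous_on UNIV f" "bounded K"
  obtains B where "0 \<le> B" "\<And>x. x \<in> K \<Longrightarrow> norm (f x) \<le> B"
proof -
  have "bounded (f ` closure K)"
    using assms by (intro compact_imp_bounded compact_continuous_image)
      (auto intro: continuous_on_subset simp: compact_closure)
  then obtain B where "\<And>x. x \<in> closure K \<Longrightarrow> norm (f x) \<le> B"
    unfolding bounded_iff by auto
  then have "\<And>x. x \<in> K \<Longrightarrow> norm (f x) \<le> max 0 B" using closure_subset[of K] by force
  then show ?thesis using that[of "max 0 B"] by auto
qed

lemma integrable_continuous_bounded_open:
  fixes f :: "'a::euclidean_space \<Rightarrow> 'b::euclidean_space"
  assumes "open K" "bounded K" "continuous_on UNIV f"
  shows "integrable (lebesgue_on K) f"
proof -
  obtain B where "\<And>x. x \<in> K \<Longrightarrow> norm (f x) \<le> B"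
    using bounded_on_bounded_continuous[OF assms(3,2)] by metis
  then show ?thesis
    by (intro finite_measure.integrable_const_bound[where B = B]
        finite_measure_lebesgue_on_bounded assms borel_measurable_lebesgue_on_continuous AE_I2) simp
qed

lemma sq_int_continuous:
  fixes f :: "'a::euclidean_space \<Rightarrow> 'b::euclidean_space"
  assumes "open K" "bounded K" "continuous_on UNIV f"
  shows "sq_int (lebesgue_on K) f"
  unfolding sq_int_def using assms
  by (auto intro!: borel_measurable_lebesgue_on_continuous integrable_continuous_bounded_open
      continuous_intros)

lemma sq_int_scaleR_continuous:
  fixes a :: "'a::euclidean_space \<Rightarrow> real"
  assumes "bounded K" "continuous_on UNIV a" "sq_int (lebesgue_on K) f"
  shows "sq_int (lebesgue_on K) (\<lambda>x. a x *\<^sub>R f x)"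
proof -
  obtain B where "\<And>x. x \<in> K \<Longrightarrow> \<bar>a x\<bar> \<le> B"
    using bounded_on_bounded_continuous[OF assms(2,1)] by (metis real_norm_def)
  then show ?thesis
    by (intro sq_int_scaleR_bounded[where B = B] assms borel_measurable_lebesgue_on_continuous) simp
qed

lemma integrable_sq_int:
  assumes "sq_int M f" "finite_measure M"
  shows "integrable M f"
proof (rule Bochner_Integration.integrable_bound)
  interpret finite_measure M by fact
  show "integrable M (\<lambda>x. 1 + (norm (f x))\<^sup>2)"
    using assms by (auto dest: sq_int_norm_sq)
  show "f \<in> borel_measurable M" using assms by (simp add: sq_int_measurable)
  have "norm a \<le> 1 + (norm a)\<^sup>2" for a :: 'b
  proof -
    have "0 \<le> (norm a - 1)\<^sup>2" by simp
    then have "2 * norm a \<le> 1 + (norm a)\<^sup>2" by (simp add: power2_diff)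
    then show ?thesis using norm_ge_zero[of a] by linarith
  qed
  then show "AE x in M. norm (f x) \<le> norm (1 + (norm (f x))\<^sup>2)"
    by (simp add: abs_of_nonneg add_nonneg_nonneg)
qed

section \<open>Integration along lines\<close>

lemma test_functionE:
  assumes "test_function U \<phi>"
  obtains R where "0 < R" "\<And>x. R < norm x \<Longrightarrow> \<phi> x = 0" "\<And>x. R < norm x \<Longrightarrow> grad \<phi> x = 0"
proof -
  obtain C where C: "compact C" "C \<subseteq> U" "\<forall>x. x \<notin> C \<longrightarrow> \<phi> x = 0"
    using assms unfolding test_function_def by blast
  then obtain R where R: "0 < R" "\<And>x. x \<in> C \<Longrightarrow> norm x \<le> R"
    using bounded_pos[of C] compact_imp_bounded by metis
  have "grad \<phi> x = 0" if "R < norm x" for x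
  proof (rule grad_eq_0_open[of "- C"])
    show "x \<in> - C" using R(2)[of x] that by auto
  qed (use C in \<open>auto simp: compact_imp_closed open_Compl\<close>)
  then show ?thesis using that[of R] C R by (metis not_less)
qed

lemma line_integral_derivative:
  fixes a c g y :: real
  assumes \<phi>: "test_function U \<phi>" and a: "a \<noteq> 0"
    and g: "\<And>l. (a * l, y + c * l) \<in> U \<Longrightarrow> (a * l, y + c * l) \<in> K \<longleftrightarrow> g < l"
  shows "(\<integral>l. indicator K (a * l, y + c * l) * (grad \<phi> (a * l, y + c * l) \<bullet> (a, c)) \<partial>lborel)
    = - \<phi> (a * g, y + c * g)"
proof -
  obtain R where R: "0 < R" "\<And>x. R < norm x \<Longrightarrow> \<phi> x = 0" "\<And>x. R < norm x \<Longrightarrow> grad \<phi> x = 0"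
    using test_functionE[OF \<phi>] by blast
  have C1: "C1 \<phi>" using \<phi> by (simp add: test_function_def)
  define p where "p = (\<lambda>l. (a * l, y + c * l))"
  have p: "(p has_vector_derivative (a, c)) (at l within S)" for l S
    unfolding p_def by (auto intro!: derivative_eq_intros simp: has_vector_derivative_def algebra_simps)
  have cp: "continuous_on S p" for S unfolding p_def by (intro continuous_intros)
  have far: "R < norm (p l)" if "R / \<bar>a\<bar> < \<bar>l\<bar>" for l
  proof -
    have "R < \<bar>a * l\<bar>" using that a by (simp add: abs_mult field_simps)
    also have "\<dots> \<le> norm (p l)" unfolding p_def using norm_fst_le[of "a * l" "y + c * l"] by simp
    finally show ?thesis .
  qed
  define r where "r = max g (R / \<bar>a\<bar>) + 1"
  have r: "g < r" "R / \<bar>a\<bar> < r" by (auto simp: r_def)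
  have "0 < R / \<bar>a\<bar>" using a R by simp
  have der: "((\<lambda>l. \<phi> (p l)) has_vector_derivative (grad \<phi> (p l) \<bullet> (a, c))) (at l within S)" for l S
  proof -
    have "(\<phi> has_derivative (\<lambda>h. grad \<phi> (p l) \<bullet> h)) (at (p l))"
      using C1 unfolding C1_def by (blast intro: has_derivative_grad)
    from has_derivative_compose[OF p[unfolded has_vector_derivative_def] this]
    show ?thesis by (simp add: has_vector_derivative_def del: scaleR_Pair)
  qed
  have "(\<integral>l. indicator K (p l) * (grad \<phi> (p l) \<bullet> (a, c)) \<partial>lborel)
      = (\<integral>l. indicator {g..r} l *\<^sub>R (grad \<phi> (p l) \<bullet> (a, c)) \<partial>lborel)"
  proof (rule integral_cong_AE)
    have "AE l in lborel. l \<noteq> g" by (rule AE_lborel_singleton)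
    then show "AE l in lborel. indicator K (p l) * (grad \<phi> (p l) \<bullet> (a, c))
        = indicator {g..r} l *\<^sub>R (grad \<phi> (p l) \<bullet> (a, c))"
    proof eventually_elim
      case (elim l)
      consider "grad \<phi> (p l) = 0" | "p l \<in> U" "l \<le> r"
        using test_function_grad_eq_0[OF \<phi>, of "p l"] R(3)[OF far[of l]] r \<open>0 < R / \<bar>a\<bar>\<close> by fastforce
      then show ?case
      proof cases
        case 2
        then show ?thesis using g[of l] elim by (auto simp: p_def indicator_def)
      qed simp
    qed
    have cg: "continuous_on UNIV (\<lambda>l. grad \<phi> (p l) \<bullet> (a, c))"
      by (intro continuous_intros continuous_on_compose2[OF C1_continuous_on_grad[OF C1, of UNIV] cp]) simp
    then have [measurable]: "(\<lambda>l. grad \<phi> (p l) \<bullet> (a, c)) \<in> borel_measurable borel"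
      by (rule borel_measurable_continuous_onI)
    show "(\<lambda>l. indicator {g..r} l *\<^sub>R (grad \<phi> (p l) \<bullet> (a, c))) \<in> borel_measurable lborel"
      by measurable
    have "(\<lambda>l. indicator K (p l) * (grad \<phi> (p l) \<bullet> (a, c)))
        = (\<lambda>l. indicator {g<..} l * (grad \<phi> (p l) \<bullet> (a, c)))"
    proof
      fix l
      show "indicator K (p l) * (grad \<phi> (p l) \<bullet> (a, c)) = indicator {g<..} l * (grad \<phi> (p l) \<bullet> (a, c))"
        using test_function_grad_eq_0[OF \<phi>, of "p l"] g[of l]
        by (cases "p l \<in> U") (auto simp: p_def indicator_def)
    qed
    then show "(\<lambda>l. indicator K (p l) * (grad \<phi> (p l) \<bullet> (a, c))) \<in> borel_measurable lborel"
      by simp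
  qed
  also have "\<dots> = \<phi> (p r) - \<phi> (p g)"
    using r by (intro integral_FTC_Icc der continuous_intros
        continuous_on_compose2[OF C1_continuous_on_grad[OF C1, of UNIV] cp]) auto
  also have "\<phi> (p r) = 0" using R(2) far[of r] r \<open>0 < R / \<bar>a\<bar>\<close> by simp
  finally show ?thesis by (simp add: p_def)
qed

text \<open>Fubini's theorem in the oblique coordinates \<open>(l, y) \<mapsto> (a l, y + c l)\<close>: the integral of
  a directional derivative over a region lying above a graph reduces to an integral over that
  graph, since the fundamental theorem of calculus applies on every line.\<close>

lemma integral_directional_derivative:
  fixes a c :: real and G :: "real \<Rightarrow> real"
  assumes \<phi>: "test_function U \<phi>" and a: "a \<noteq> 0" and K: "open K"
    and G: "\<And>y l. (a * l, y + c * l) \<in> U \<Longrightarrow> (a * l, y + c * l) \<in> K \<longleftrightarrow> G y < l"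
  shows "integrable lborel (\<lambda>y. \<phi> (a * G y, y + c * G y))"
    and "(LINT x|lebesgue_on K. grad \<phi> x \<bullet> (a, c))
    = - (\<bar>a\<bar> * (\<integral>y. \<phi> (a * G y, y + c * G y) \<partial>lborel))"
proof -
  obtain R where R: "0 < R" "\<And>x. R < norm x \<Longrightarrow> \<phi> x = 0" "\<And>x. R < norm x \<Longrightarrow> grad \<phi> x = 0"
    using test_functionE[OF \<phi>] by blast
  have C1: "C1 \<phi>" using \<phi> by (simp add: test_function_def)
  define F where "F = (\<lambda>x. indicator K x * (grad \<phi> x \<bullet> (a, c)))"
  have cont: "continuous_on UNIV (\<lambda>x. grad \<phi> x \<bullet> (a, c))"
    by (intro continuous_intros C1_continuous_on_grad[OF C1])
  have [measurable]: "(\<lambda>x. grad \<phi> x \<bullet> (a, c)) \<in> borel_measurable borel" "K \<in> sets borel"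
    using cont K by (auto intro: borel_measurable_continuous_onI)
  have F[measurable]: "F \<in> borel_measurable borel" unfolding F_def by measurable
  obtain B where B: "0 \<le> B" "\<And>x. x \<in> cball 0 R \<Longrightarrow> norm (grad \<phi> x \<bullet> (a, c)) \<le> B"
    using bounded_on_bounded_continuous[OF cont bounded_cball] by metis
  have Fbd: "norm (F x) \<le> B" for x
    using B(1) B(2)[of x] R(3)[of x] by (cases "R < norm x") (auto simp: F_def indicator_def)
  have F0: "F x = 0" if "R < norm x" for x using R(3)[OF that] by (simp add: F_def)
  have F0': "F (s, t) = 0" if "R < \<bar>s\<bar> \<or> R < \<bar>t\<bar>" for s t
    using that norm_fst_le[of s t] norm_snd_le[of t s] by (intro F0) auto
  have intF: "integrable lborel F"
    by (rule integrableI_bounded_set[where A = "cball 0 R" and B = B])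
       (use Fbd F0 emeasure_bounded_finite[OF bounded_cball] in auto)
  define H where "H = (\<lambda>(l, y). F (a * l, y + c * l))"
  have H[measurable]: "H \<in> borel_measurable borel"
  proof -
    have "(\<lambda>x::real \<times> real. (a * fst x, snd x + c * fst x)) \<in> borel_measurable borel"
      by (intro borel_measurable_continuous_onI continuous_intros)
    from measurable_compose[OF this F] show ?thesis by (simp add: H_def case_prod_beta)
  qed
  define S where "S = cbox (- (R / \<bar>a\<bar>), - (R + \<bar>c\<bar> * (R / \<bar>a\<bar>))) (R / \<bar>a\<bar>, R + \<bar>c\<bar> * (R / \<bar>a\<bar>))"
  have H0: "H (l, y) = 0" if "(l, y) \<notin> S" for l y
  proof (cases "\<bar>l\<bar> \<le> R / \<bar>a\<bar>")
    case True
    then have "R + \<bar>c\<bar> * (R / \<bar>a\<bar>) < \<bar>y\<bar>" using that by (auto simp: S_def cbox_Pair_eq abs_le_iff)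
    moreover have "\<bar>c * l\<bar> \<le> \<bar>c\<bar> * (R / \<bar>a\<bar>)" 
      unfolding abs_mult using True by (rule mult_left_mono) simp
    ultimately have "R < \<bar>y + c * l\<bar>" by linarith
    then show ?thesis by (simp add: H_def F0')
  next
    case False
    then have "R < \<bar>a * l\<bar>" using a by (simp add: abs_mult field_simps)
    then show ?thesis by (simp add: H_def F0')
  qed
  have intH: "integrable lborel H"
  proof (rule integrableI_bounded_set[where A = S and B = B])
    show "emeasure lborel S < \<infinity>" unfolding S_def using emeasure_bounded_finite[OF bounded_cbox] .
    show "AE x in lborel. x \<in> S \<longrightarrow> norm (H x) \<le> B" using Fbd by (auto simp: H_def)
    show "AE x in lborel. x \<notin> S \<longrightarrow> H x = 0" using H0 by auto
  qed (auto simp: S_def)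
  have intH': "integrable (lborel \<Otimes>\<^sub>M lborel) (case_prod (\<lambda>l y. F (a * l, y + c * l)))"
    using intH unfolding lborel_prod H_def .
  have line: "(\<integral>l. F (a * l, y + c * l) \<partial>lborel) = - \<phi> (a * G y, y + c * G y)" for y
    unfolding F_def by (rule line_integral_derivative[OF \<phi> a G])
  have "integrable lborel (\<lambda>y. - \<phi> (a * G y, y + c * G y))"
    using lborel_pair.integrable_snd[OF intH'] by (simp only: line)
  from Bochner_Integration.integrable_minus[OF this]
  show "integrable lborel (\<lambda>y. \<phi> (a * G y, y + c * G y))" by simp
  have shift: "(\<integral>t. F (s, t) \<partial>lborel) = (\<integral>y. F (s, c * s / a + y) \<partial>lborel)" for s
    using lborel_integral_real_affine[of 1 "\<lambda>t. F (s, t)" "c * s / a"] by simp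
  have "(LINT x|lebesgue_on K. grad \<phi> x \<bullet> (a, c)) = (\<integral>x. F x \<partial>lebesgue)"
    using K by (subst integral_restrict_space) (auto simp: F_def)
  also have "\<dots> = (\<integral>x. F x \<partial>lborel)" by (rule integral_completion) simp
  also have "\<dots> = (\<integral>x. F x \<partial>(lborel \<Otimes>\<^sub>M lborel))" by (simp add: lborel_prod)
  also have "\<dots> = (\<integral>s. (\<integral>t. F (s, t) \<partial>lborel) \<partial>lborel)"
    using intF by (intro lborel_pair.integral_fst'[symmetric]) (simp add: lborel_prod)
  also have "\<dots> = (\<integral>s. (\<integral>y. F (s, c * s / a + y) \<partial>lborel) \<partial>lborel)"
    by (rule Bochner_Integration.integral_cong[OF refl shift])
  also have "\<dots> = \<bar>a\<bar> * (\<integral>l. (\<integral>y. F (a * l, y + c * l) \<partial>lborel) \<partial>lborel)"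
    using a by (subst lborel_integral_real_affine[of a _ 0]) (auto simp: add.commute)
  also have "(\<integral>l. (\<integral>y. F (a * l, y + c * l) \<partial>lborel) \<partial>lborel)
      = (\<integral>y. (\<integral>l. F (a * l, y + c * l) \<partial>lborel) \<partial>lborel)"
    by (rule lborel_pair.Fubini_integral[OF intH', symmetric])
  also have "\<dots> = (\<integral>y. - \<phi> (a * G y, y + c * G y) \<partial>lborel)"
    by (simp only: line)
  finally show "(LINT x|lebesgue_on K. grad \<phi> x \<bullet> (a, c))
    = - (\<bar>a\<bar> * (\<integral>y. \<phi> (a * G y, y + c * G y) \<partial>lborel))" by simp
qed

section \<open>Local defining functions and edges\<close>

text \<open>Locally \<open>K\<close> is the set where a Lipschitz function \<open>h\<close> is positive.  Transversality of a
  direction \<open>d\<close> is a quantitative monotonicity of \<open>h\<close> along \<open>d\<close>; it replaces differentiability of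
  \<open>h\<close>.\<close>

definition defining_function :: "point set \<Rightarrow> point set \<Rightarrow> (point \<Rightarrow> real) \<Rightarrow> bool" where
  "defining_function K U h \<longleftrightarrow>
     open U \<and> (\<exists>L. L-lipschitz_on UNIV h) \<and> (\<forall>x\<in>U. x \<in> K \<longleftrightarrow> 0 < h x)"

definition transversal :: "(point \<Rightarrow> real) \<Rightarrow> point \<Rightarrow> bool" where
  "transversal h d \<longleftrightarrow> (\<exists>\<mu>>0. \<forall>x. \<forall>l\<ge>0. h x + \<mu> * l \<le> h (x + l *\<^sub>R d))"

lemma defining_function_continuous: "defining_function K U h \<Longrightarrow> continuous_on S h"
  unfolding defining_function_def
  by (meson continuous_on_subset lipschitz_on_continuous_on subset_UNIV)

lemma frontier_iff_defining_zero:
  assumes h: "defining_function K U h" and d: "transversal h d" and K: "open K" and x: "x \<in> U"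
  shows "x \<in> frontier K \<longleftrightarrow> h x = 0"
proof
  assume f: "x \<in> frontier K"
  then have "x \<notin> K" using K by (simp add: frontier_def interior_open)
  then have "h x \<le> 0" using h x unfolding defining_function_def by force
  moreover have "\<not> h x < 0"
  proof
    assume "h x < 0"
    define V where "V = U \<inter> {y. h y < 0}"
    have "open V" unfolding V_def
      using h by (intro open_Int open_Collect_less continuous_on_const defining_function_continuous[OF h])
        (simp add: defining_function_def)
    moreover have "V \<inter> K = {}"
    proof -
      have "y \<notin> K" if "y \<in> V" for y
      proof -
        have "y \<in> U" "h y < 0" using that by (simp_all add: V_def)
        then show ?thesis using h unfolding defining_function_def by (metis less_asym)
      qed
      then show ?thesis by blast
    qed
    ultimately have "V \<inter> closure K = {}" by (simp add: open_Int_closure_eq_empty)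
    then show False using f x \<open>h x < 0\<close> by (auto simp: V_def frontier_def)
  qed
  ultimately show "h x = 0" by simp
next
  assume z: "h x = 0"
  then have "x \<notin> K" using h x unfolding defining_function_def by auto
  moreover have "x \<in> closure K"
  proof -
    obtain \<mu> where \<mu>: "\<mu> > 0" "\<And>x l. l \<ge> 0 \<Longrightarrow> h x + \<mu> * l \<le> h (x + l *\<^sub>R d)"
      using d unfolding transversal_def by auto
    have lim: "(\<lambda>n. x + (1 / real (Suc n)) *\<^sub>R d) \<longlonglongrightarrow> x + 0 *\<^sub>R d"
      by (intro tendsto_intros LIMSEQ_Suc[OF lim_1_over_n])
    have "\<forall>\<^sub>F n in sequentially. x + (1 / real (Suc n)) *\<^sub>R d \<in> U"
      using h x by (intro topological_tendstoD[OF lim]) (auto simp: defining_function_def)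
    then have "\<forall>\<^sub>F n in sequentially. x + (1 / real (Suc n)) *\<^sub>R d \<in> closure K"
    proof eventually_elim
      case (elim n)
      have "0 < \<mu> * (1 / real (Suc n))" using \<mu> by simp
      also have "\<dots> \<le> h (x + (1 / real (Suc n)) *\<^sub>R d)" using \<mu>(2)[of "1 / real (Suc n)" x] z by simp
      finally show ?case using h elim closure_subset[of K] unfolding defining_function_def by blast
    qed
    from Lim_in_closed_set[OF closed_closure this _ lim] show ?thesis by simp
  qed
  ultimately show "x \<in> frontier K" using K by (simp add: frontier_def interior_open)
qed

text \<open>Along a transversal direction \<open>h\<close> increases at least linearly, hence has a unique zero on
  each line; these zeros form the graph.\<close>

lemma transversal_graph:
  assumes h: "defining_function K U h" and d: "transversal h (a, c)"
  obtains G where "\<And>y l. 0 < h (a * l, y + c * l) \<longleftrightarrow> G y < l"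
    and "\<And>y l. h (a * l, y + c * l) = 0 \<longleftrightarrow> l = G y"
proof -
  obtain \<mu> where \<mu>: "\<mu> > 0" "\<And>x l. l \<ge> 0 \<Longrightarrow> h x + \<mu> * l \<le> h (x + l *\<^sub>R (a, c))"
    using d unfolding transversal_def by auto
  have mono: "h (a * l, y + c * l) < h (a * l', y + c * l')" if "l < l'" for y l l'
  proof -
    have "h (a * l, y + c * l) < h (a * l, y + c * l) + \<mu> * (l' - l)" using \<mu> that by simp
    also have "\<dots> \<le> h ((a * l, y + c * l) + (l' - l) *\<^sub>R (a, c))" using that by (intro \<mu>) simp
    finally show ?thesis by (simp add: algebra_simps)
  qed
  have ex: "\<exists>l. h (a * l, y + c * l) = 0" for y
  proof -
    define f where "f = (\<lambda>l. h (a * l, y + c * l))"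
    define M where "M = \<bar>f 0\<bar> / \<mu>"
    have M: "0 \<le> M" "\<mu> * M = \<bar>f 0\<bar>" using \<mu> by (auto simp: M_def)
    have "f (- M) + \<mu> * M \<le> f 0"
      using \<mu>(2)[of M "(a * (- M), y + c * (- M))"] M by (simp add: f_def)
    moreover have "f 0 + \<mu> * M \<le> f M" using \<mu>(2)[of M "(0, y)"] M by (simp add: f_def mult.commute)
    ultimately have "f (- M) \<le> 0" "0 \<le> f M" using M by linarith+
    moreover have "continuous_on {- M..M} f" unfolding f_def
      by (intro continuous_on_compose2[OF defining_function_continuous[OF h, of UNIV]] continuous_intros) simp
    ultimately show ?thesis
      using IVT'[of f "- M" 0 M] M by (auto simp: f_def)
  qed
  then obtain G where G: "\<And>y. h (a * G y, y + c * G y) = 0" by metis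
  show ?thesis
  proof
    fix y l
    show "0 < h (a * l, y + c * l) \<longleftrightarrow> G y < l"
      using mono[of l "G y" y] mono[of "G y" l y] G[of y]
      by (cases l "G y" rule: linorder_cases) auto
    show "h (a * l, y + c * l) = 0 \<longleftrightarrow> l = G y"
      using mono[of l "G y" y] mono[of "G y" l y] G[of y]
      by (cases l "G y" rule: linorder_cases) auto
  qed
qed

lemma rot_orthonormal: "norm e = 1 \<Longrightarrow> rot e \<bullet> rot e = 1 \<and> e \<bullet> rot e = 0 \<and> e \<bullet> e = 1"
  by (cases e) (auto simp: rot_def norm_eq_1 add.commute)

lemma orthonormal_expansion: "norm e = 1 \<Longrightarrow> x = (x \<bullet> rot e) *\<^sub>R rot e + (x \<bullet> e) *\<^sub>R e"
proof -
  assume "norm e = 1"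
  then have "(fst e)\<^sup>2 + (snd e)\<^sup>2 = 1"
    by (cases e) (auto simp: norm_eq_1 power2_eq_square)
  then show ?thesis
    by (intro prod_eqI; simp add: rot_def inner_prod_def; algebra)
qed

lemma lipschitz_boundary_chart:
  assumes "lipschitz_boundary K" "z \<in> frontier K"
  obtains e g L U where "norm e = 1" "0 \<le> L" "L-lipschitz_on UNIV g" "open U" "z \<in> U"
    "\<And>x. x \<in> U \<Longrightarrow> x \<in> K \<longleftrightarrow> 0 < (x - z) \<bullet> e - g ((x - z) \<bullet> rot e)"
proof -
  obtain e g L r h where e: "norm e = 1" and g: "L-lipschitz_on UNIV g" and "0 < r" "0 < h"
    and K: "\<And>s t. \<bar>s\<bar> < r \<Longrightarrow> \<bar>t\<bar> < h \<Longrightarrow>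
           z + s *\<^sub>R rot e + t *\<^sub>R e \<in> K \<longleftrightarrow> g s < (t::real)"
    using assms unfolding lipschitz_boundary_def by metis
  define U where "U = {x. \<bar>(x - z) \<bullet> rot e\<bar> < r \<and> \<bar>(x - z) \<bullet> e\<bar> < h}"
  have "open U" unfolding U_def by (intro open_Collect_conj open_Collect_less continuous_intros)
  moreover have "z \<in> U" using \<open>0 < r\<close> \<open>0 < h\<close> by (simp add: U_def)
  moreover have "x \<in> K \<longleftrightarrow> 0 < (x - z) \<bullet> e - g ((x - z) \<bullet> rot e)" if "x \<in> U" for x
  proof -
    have "z + ((x - z) \<bullet> rot e) *\<^sub>R rot e + ((x - z) \<bullet> e) *\<^sub>R e = x"
      using orthonormal_expansion[OF e, of "x - z"] by (metis add.assoc add_diff_cancel_left' diff_add_cancel add.commute)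
    then show ?thesis
      using K[of "(x - z) \<bullet> rot e" "(x - z) \<bullet> e"] that by (auto simp: U_def)
  qed
  ultimately show ?thesis using that e g lipschitz_on_nonneg[OF g] by blast
qed

lemma chart_defining_function:
  assumes e: "norm e = 1" and g: "L-lipschitz_on UNIV g" and U: "open U"
    and K: "\<And>x. x \<in> U \<Longrightarrow> x \<in> K \<longleftrightarrow> 0 < (x - z) \<bullet> e - g ((x - z) \<bullet> rot e)"
  shows "defining_function K U (\<lambda>x. (x - z) \<bullet> e - g ((x - z) \<bullet> rot e))"
proof -
  have L: "0 \<le> L" by (rule lipschitz_on_nonneg[OF g])
  have nr: "norm (rot e) = 1" using rot_orthonormal[OF e] by (simp add: norm_eq_1)
  have "(1 + L)-lipschitz_on UNIV (\<lambda>x. (x - z) \<bullet> e - g ((x - z) \<bullet> rot e))"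
  proof (rule lipschitz_onI)
    fix x y
    have "\<bar>(x - z) \<bullet> e - (y - z) \<bullet> e\<bar> \<le> norm (x - y)"
      using Cauchy_Schwarz_ineq2[of "x - y" e] e by (simp add: inner_diff_left)
    moreover have "\<bar>g ((x - z) \<bullet> rot e) - g ((y - z) \<bullet> rot e)\<bar> \<le> L * norm (x - y)"
    proof -
      have "\<bar>g ((x - z) \<bullet> rot e) - g ((y - z) \<bullet> rot e)\<bar> \<le> L * \<bar>(x - z) \<bullet> rot e - (y - z) \<bullet> rot e\<bar>"
        using lipschitz_onD[OF g, of "(x - z) \<bullet> rot e" "(y - z) \<bullet> rot e"] by (simp add: dist_real_def)
      also have "\<bar>(x - z) \<bullet> rot e - (y - z) \<bullet> rot e\<bar> \<le> norm (x - y)"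
        using Cauchy_Schwarz_ineq2[of "x - y" "rot e"] nr by (simp add: inner_diff_left)
      finally show ?thesis using L by (simp add: mult_left_mono)
    qed
    ultimately show "dist ((x - z) \<bullet> e - g ((x - z) \<bullet> rot e)) ((y - z) \<bullet> e - g ((y - z) \<bullet> rot e))
        \<le> (1 + L) * dist x y"
      by (simp add: dist_real_def dist_norm algebra_simps)
  qed (use L in simp)
  then show ?thesis unfolding defining_function_def using U K by blast
qed

lemma chart_transversal:
  assumes e: "norm e = 1" and g: "L-lipschitz_on UNIV g" and eta: "\<bar>\<eta>\<bar> * L < 1"
  shows "transversal (\<lambda>x. (x - z) \<bullet> e - g ((x - z) \<bullet> rot e)) (e + \<eta> *\<^sub>R rot e)"
  unfolding transversal_def
proof (intro exI conjI allI impI)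
  show "0 < 1 - \<bar>\<eta>\<bar> * L" using eta by simp
  fix x and l :: real assume l: "0 \<le> l"
  have o: "e \<bullet> rot e = 0" "rot e \<bullet> e = 0" "rot e \<bullet> rot e = 1" "e \<bullet> e = 1"
    using rot_orthonormal[OF e] by (auto simp: inner_commute)
  have 1: "(x + l *\<^sub>R (e + \<eta> *\<^sub>R rot e) - z) \<bullet> e = (x - z) \<bullet> e + l"
    by (simp add: inner_add_left inner_diff_left o)
  have 2: "(x + l *\<^sub>R (e + \<eta> *\<^sub>R rot e) - z) \<bullet> rot e = (x - z) \<bullet> rot e + l * \<eta>"
    by (simp add: inner_add_left inner_diff_left o)
  have "\<bar>g ((x - z) \<bullet> rot e + l * \<eta>) - g ((x - z) \<bullet> rot e)\<bar> \<le> L * \<bar>l * \<eta>\<bar>"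
    using lipschitz_onD[OF g, of "(x - z) \<bullet> rot e + l * \<eta>" "(x - z) \<bullet> rot e"] by (simp add: dist_real_def)
  also have "\<dots> = \<bar>\<eta>\<bar> * L * l" using l by (simp add: abs_mult)
  finally show "(x - z) \<bullet> e - g ((x - z) \<bullet> rot e) + (1 - \<bar>\<eta>\<bar> * L) * l
      \<le> (x + l *\<^sub>R (e + \<eta> *\<^sub>R rot e) - z) \<bullet> e - g ((x + l *\<^sub>R (e + \<eta> *\<^sub>R rot e) - z) \<bullet> rot e)"
    unfolding 1 2 by (simp add: algebra_simps)
qed

text \<open>The cone of transversal directions around \<open>e\<close> is open, so it contains two independent
  directions that are not vertical, as the oblique coordinates require.\<close>

lemma two_transversal_directions:
  assumes "lipschitz_boundary K" "z \<in> frontier K"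
  obtains U h d1 d2 where "defining_function K U h" "z \<in> U"
    "transversal h d1" "transversal h d2" "fst d1 \<noteq> 0" "fst d2 \<noteq> 0"
    "\<And>v. \<exists>\<alpha> \<beta>. v = \<alpha> *\<^sub>R d1 + \<beta> *\<^sub>R d2"
proof -
  obtain e g L U where e: "norm e = 1" and L: "0 \<le> L" "L-lipschitz_on UNIV g" and U: "open U" "z \<in> U"
    "\<And>x. x \<in> U \<Longrightarrow> x \<in> K \<longleftrightarrow> 0 < (x - z) \<bullet> e - g ((x - z) \<bullet> rot e)"
    by (rule lipschitz_boundary_chart[OF assms]) (rule that)
  let ?h = "\<lambda>x. (x - z) \<bullet> e - g ((x - z) \<bullet> rot e)"
  \<comment> \<open>of the three slopes \<open>0\<close>, \<open>q\<close>, \<open>-q\<close> at most one gives a vertical direction\<close>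
  define q where "q = inverse (2 * (L + 1))"
  have q: "0 < q" "q * L < 1" using L by (auto simp: q_def field_simps)
  let ?d = "\<lambda>\<eta>. e + \<eta> *\<^sub>R rot e"
  have tr: "transversal ?h (?d \<eta>)" if "\<eta> \<in> {0, q, - q}" for \<eta>
    using that q by (intro chart_transversal[OF e L(2)]) auto
  have fd: "fst (?d \<eta>) = fst e - \<eta> * snd e" for \<eta> by (simp add: rot_def)
  have ne: "fst e \<noteq> 0 \<or> snd e \<noteq> 0" using e by (metis norm_zero prod.collapse zero_neq_one zero_prod_def)
  have "\<exists>\<eta> \<eta>'. \<eta> \<in> {0, q, - q} \<and> \<eta>' \<in> {0, q, - q} \<and> \<eta> \<noteq> \<eta>' \<and> fst (?d \<eta>) \<noteq> 0 \<and> fst (?d \<eta>') \<noteq> 0"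
  proof (cases "fst (?d 0) = 0")
    case True
    then show ?thesis using q ne unfolding fd by (intro exI[of _ q] exI[of _ "- q"]) auto
  next
    case False
    show ?thesis
    proof (cases "fst (?d q) = 0")
      case True
      then have "fst (?d (- q)) \<noteq> 0" using False q unfolding fd by auto
      then show ?thesis using False q by (intro exI[of _ 0] exI[of _ "- q"]) auto
    next
      case F2: False
      then show ?thesis using False q by (intro exI[of _ 0] exI[of _ q]) auto
    qed
  qed
  then obtain \<eta> \<eta>' where \<eta>: "\<eta> \<in> {0, q, - q}" "\<eta>' \<in> {0, q, - q}" "\<eta> \<noteq> \<eta>'"
    "fst (?d \<eta>) \<noteq> 0" "fst (?d \<eta>') \<noteq> 0" by blast
  have span: "\<exists>\<alpha> \<beta>. v = \<alpha> *\<^sub>R ?d \<eta> + \<beta> *\<^sub>R ?d \<eta>'" for v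
  proof -
    define s t where "s = v \<bullet> rot e" and "t = v \<bullet> e"
    define \<beta> where "\<beta> = (s - t * \<eta>) / (\<eta>' - \<eta>)"
    have b: "\<beta> * (\<eta>' - \<eta>) = s - t * \<eta>" using \<eta> by (simp add: \<beta>_def)
    have "(t - \<beta>) *\<^sub>R ?d \<eta> + \<beta> *\<^sub>R ?d \<eta>' = t *\<^sub>R e + (t * \<eta> + \<beta> * (\<eta>' - \<eta>)) *\<^sub>R rot e"
      by (simp add: algebra_simps)
    also have "\<dots> = v" unfolding b using orthonormal_expansion[OF e, of v]
      by (simp add: s_def t_def add.commute)
    finally show ?thesis by metis
  qed
  show ?thesis
    by (rule that[of U ?h "?d \<eta>" "?d \<eta>'"])
       (use chart_defining_function[OF e L(2) U(1,3)] U tr \<eta> span in auto)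
qed

lemma smooth_arcD:
  assumes "smooth_arc \<gamma>"
  shows "continuous_on {0..1} \<gamma>"
    and "continuous_on {0..1} (velocity \<gamma>)"
    and "\<And>t. t \<in> {0..1} \<Longrightarrow> (\<gamma> has_vector_derivative velocity \<gamma> t) (at t within {0..1})"
    and "\<And>t. t \<in> {0..1} \<Longrightarrow> velocity \<gamma> t \<noteq> 0"
    and "\<And>s t. s \<in> {0<..<1} \<Longrightarrow> t \<in> {0..1} \<Longrightarrow> \<gamma> s = \<gamma> t \<Longrightarrow> s = t"
proof -
  obtain D :: "nat \<Rightarrow> real \<Rightarrow> point" where D: "D 0 = \<gamma>"
    "\<And>k t. t \<in> {0..1} \<Longrightarrow> (D k has_vector_derivative D (Suc k) t) (at t within {0..1})"
    and s: "simple_path \<gamma>" and v: "\<And>t. t \<in> {0..1} \<Longrightarrow> velocity \<gamma> t \<noteq> 0"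
    using assms unfolding smooth_arc_def by blast
  have vel: "velocity \<gamma> t = D 1 t" if "t \<in> {0..1}" for t
    using D(2)[of t 0] that vector_derivative_within_cbox[of 0 1 t \<gamma>] by (simp add: D(1))
  show "continuous_on {0..1} \<gamma>" using s by (simp add: simple_path_def path_def)
  have "continuous_on {0..1} (D 1)"
    using D(2) by (meson continuous_on_vector_derivative)
  then show "continuous_on {0..1} (velocity \<gamma>)" by (rule continuous_on_eq) (simp add: vel)
  show "(\<gamma> has_vector_derivative velocity \<gamma> t) (at t within {0..1})" if "t \<in> {0..1}" for t
    using D(2)[of t 0] that vel by (simp add: D(1))
  show "velocity \<gamma> t \<noteq> 0" if "t \<in> {0..1}" for t using v that by blast
  show "s = t" if "s \<in> {0<..<1}" "t \<in> {0..1}" "\<gamma> s = \<gamma> t" for s t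
    using s that by (force simp: simple_path_def loop_free_def)
qed

lemma planar_decomposition:
  fixes v w \<nu> :: point
  assumes "norm \<nu> = 1" "\<nu> \<bullet> v = 0" "v \<noteq> 0"
  shows "w = (\<nu> \<bullet> w) *\<^sub>R \<nu> + ((w \<bullet> v) / (v \<bullet> v)) *\<^sub>R v"
    and "\<bar>\<nu> \<bullet> w\<bar> * norm v = \<bar>fst w * snd v - snd w * fst v\<bar>"
proof -
  obtain a b p q x y where eq: "\<nu> = (a, b)" "v = (p, q)" "w = (x, y)" by (cases \<nu>, cases v, cases w)
  have 1: "a\<^sup>2 + b\<^sup>2 = 1" "a * p + b * q = 0"
    using assms by (auto simp: eq norm_eq_1 power2_eq_square)
  define k where "k = a * q - b * p"
  have p: "p = - b * k" and q: "q = a * k" unfolding k_def using 1 by algebra+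
  have k2: "v \<bullet> v = k * k" using 1 unfolding eq by (simp add: p q) algebra
  have k0: "k \<noteq> 0" using assms by (auto simp: eq p q zero_prod_def)
  have r: "(w \<bullet> v) / (v \<bullet> v) = (a * y - b * x) / k"
    unfolding k2 using k0 by (simp add: eq p q field_simps)
  have "((a * y - b * x) / k) *\<^sub>R v = (- b * (a * y - b * x), a * (a * y - b * x))"
    using k0 by (simp add: eq p q)
  then show "w = (\<nu> \<bullet> w) *\<^sub>R \<nu> + ((w \<bullet> v) / (v \<bullet> v)) *\<^sub>R v"
    unfolding r using 1 by (simp add: eq) algebra
  have "norm v = \<bar>k\<bar>" using k2 by (metis norm_eq_sqrt_inner real_sqrt_abs2)
  moreover have "fst w * snd v - snd w * fst v = (\<nu> \<bullet> w) * k"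
    by (simp add: eq p q algebra_simps)
  ultimately show "\<bar>\<nu> \<bullet> w\<bar> * norm v = \<bar>fst w * snd v - snd w * fst v\<bar>"
    by (simp add: abs_mult)
qed

locale polygon =
  fixes K :: "point set" and E :: "(real \<Rightarrow> point) set"
  assumes polygon: "curvilinear_polygon K E"
begin

lemma K_open: "open K" and K_bounded: "bounded K" and K_lipschitz: "lipschitz_boundary K"
  and E_finite: "finite E" and E_smooth: "\<gamma> \<in> E \<Longrightarrow> smooth_arc \<gamma>"
  using polygon by (simp_all add: curvilinear_polygon_def)

lemma frontier_eq: "frontier K = (\<Union>\<gamma>\<in>E. path_image \<gamma>)"
  using polygon by (simp add: curvilinear_polygon_def)

lemma edge_in_frontier: "\<gamma> \<in> E \<Longrightarrow> t \<in> {0..1} \<Longrightarrow> \<gamma> t \<in> frontier K"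
  unfolding frontier_eq path_image_def by blast

lemma edges_injective:
  assumes "\<gamma> \<in> E" "\<delta> \<in> E" "s \<in> {0<..<1}" "t \<in> {0<..<1}" "\<gamma> s = \<delta> t"
  shows "\<gamma> = \<delta> \<and> s = t"
proof -
  have "\<forall>\<gamma>\<in>E. \<forall>\<delta>\<in>E. \<gamma> \<noteq> \<delta> \<longrightarrow> \<gamma> ` {0<..<1} \<inter> \<delta> ` {0<..<1} = {}"
    using polygon by (simp add: curvilinear_polygon_def)
  moreover have "\<gamma> s \<in> \<gamma> ` {0<..<1} \<inter> \<delta> ` {0<..<1}"
    using imageI[OF assms(3), of \<gamma>] imageI[OF assms(4), of \<delta>] assms(5) by simp
  ultimately have "\<gamma> = \<delta>" using assms(1,2) by auto
  then show ?thesis using smooth_arcD(5)[OF E_smooth, of \<gamma> s t] assms by auto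
qed

section \<open>The outward normal\<close>

text \<open>Near \<open>\<gamma> t\<close> the edge follows its tangent line up to an error of smaller order.  As \<open>h\<close> vanishes
  on the edge and is Lipschitz, it is of smaller order along the tangent line.\<close>

lemma defining_function_near_edge:
  assumes h: "defining_function K U h" and d: "transversal h d"
    and \<gamma>: "\<gamma> \<in> E" and t: "t \<in> {0<..<1}" and U: "\<gamma> t \<in> U" and "0 < \<epsilon>"
  shows "\<exists>\<delta>>0. \<forall>s\<in>{0<..<\<delta>}. \<bar>h (\<gamma> t + (s * b) *\<^sub>R velocity \<gamma> t)\<bar> \<le> \<epsilon> * s"
proof -
  let ?v = "velocity \<gamma> t"
  note arc = smooth_arcD[OF E_smooth[OF \<gamma>]]
  obtain L where L: "L-lipschitz_on UNIV h" and oU: "open U"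
    using h unfolding defining_function_def by blast
  have L0: "0 \<le> L" by (rule lipschitz_on_nonneg[OF L])
  define e where "e = \<epsilon> / (L * \<bar>b\<bar> + 1)"
  have den: "0 < L * \<bar>b\<bar> + 1" using L0 by (simp add: add_nonneg_pos)
  have e: "0 < e" using den \<open>0 < \<epsilon>\<close> by (simp add: e_def)
  have eL: "L * \<bar>b\<bar> * e \<le> \<epsilon>"
    using den \<open>0 < \<epsilon>\<close> by (simp add: e_def field_simps)
  have "(\<gamma> has_derivative (\<lambda>h. h *\<^sub>R ?v)) (at t within {0..1})"
    using arc(3)[of t] t by (simp add: has_vector_derivative_def)
  then obtain d1 where d1: "0 < d1"
    "\<And>y. y \<in> {0..1} \<Longrightarrow> \<bar>y - t\<bar> < d1 \<Longrightarrow> norm (\<gamma> y - \<gamma> t - (y - t) *\<^sub>R ?v) \<le> e * \<bar>y - t\<bar>"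
    using e unfolding has_derivative_within_alt real_norm_def by meson
  obtain r where r: "0 < r" "ball (\<gamma> t) r \<subseteq> U" using oU U openE by blast
  obtain d2 where d2: "0 < d2" "\<And>y. y \<in> {0..1} \<Longrightarrow> \<bar>y - t\<bar> < d2 \<Longrightarrow> dist (\<gamma> y) (\<gamma> t) < r"
    using arc(1) t r(1) unfolding continuous_on_iff dist_real_def
    by (metis atLeastAtMost_iff greaterThanLessThan_iff less_imp_le)
  define m where "m = min (min d1 d2) (min t (1 - t))"
  have m: "0 < m" using d1 d2 t by (simp add: m_def)
  have "0 < m / (\<bar>b\<bar> + 1)" using m by simp
  moreover have "\<bar>h (\<gamma> t + (s * b) *\<^sub>R ?v)\<bar> \<le> \<epsilon> * s" if s: "s \<in> {0<..<m / (\<bar>b\<bar> + 1)}" for s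
  proof -
    have s0: "0 < s" using s by simp
    have "s * (\<bar>b\<bar> + 1) < m" using s by (simp add: field_simps)
    then have sb: "\<bar>s * b\<bar> < m" using s0 by (simp add: abs_mult algebra_simps)
    define y where "y = t + s * b"
    have y: "y \<in> {0..1}" "\<bar>y - t\<bar> < d1" "\<bar>y - t\<bar> < d2"
      using sb t by (auto simp: y_def m_def)
    have "\<gamma> y \<in> U" using d2(2)[OF y(1,3)] r by (auto simp: dist_commute)
    then have "h (\<gamma> y) = 0"
      using frontier_iff_defining_zero[OF h d K_open] edge_in_frontier[OF \<gamma> y(1)] by blast
    then have "\<bar>h (\<gamma> t + (s * b) *\<^sub>R ?v)\<bar> = dist (h (\<gamma> t + (s * b) *\<^sub>R ?v)) (h (\<gamma> y))"
      by (simp add: dist_real_def)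
    also have "\<dots> \<le> L * dist (\<gamma> t + (s * b) *\<^sub>R ?v) (\<gamma> y)"
      by (rule lipschitz_onD[OF L]) auto
    also have "dist (\<gamma> t + (s * b) *\<^sub>R ?v) (\<gamma> y) = norm (\<gamma> y - \<gamma> t - (y - t) *\<^sub>R ?v)"
      by (simp add: y_def dist_norm norm_minus_commute algebra_simps)
    also have "L * \<dots> \<le> L * (e * \<bar>y - t\<bar>)" by (intro mult_left_mono d1 y L0)
    also have "\<dots> = (L * \<bar>b\<bar> * e) * s" using s0 by (simp add: y_def abs_mult)
    also have "\<dots> \<le> \<epsilon> * s" using eL s0 by (intro mult_right_mono) auto
    finally show ?thesis .
  qed
  ultimately show ?thesis by blast
qed

text \<open>A normal vector is a multiple of \<open>d\<close> plus a tangential vector.  Tangential displacements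
  change \<open>h\<close> only to smaller order, whereas displacements along \<open>d\<close> change it linearly, so they
  decide on which side of \<open>\<partial>K\<close> one arrives.\<close>

lemma normal_crosses_boundary:
  assumes h: "defining_function K U h" and d: "transversal h d"
    and \<gamma>: "\<gamma> \<in> E" and t: "t \<in> {0<..<1}" and U: "\<gamma> t \<in> U"
    and \<nu>: "norm \<nu> = 1" "\<nu> \<bullet> velocity \<gamma> t = 0"
  shows "\<nu> \<bullet> d \<noteq> 0"
    and "\<nu> \<bullet> d < 0 \<Longrightarrow> \<exists>\<delta>>0. \<forall>s\<in>{0<..<\<delta>}. \<gamma> t - s *\<^sub>R \<nu> \<in> K \<and> \<gamma> t + s *\<^sub>R \<nu> \<notin> K"
proof -
  let ?v = "velocity \<gamma> t" and ?x = "\<gamma> t"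
  have v0: "?v \<noteq> 0" using smooth_arcD(4)[OF E_smooth[OF \<gamma>]] t by auto
  obtain \<mu> where \<mu>: "\<mu> > 0" "\<And>x l. l \<ge> 0 \<Longrightarrow> h x + \<mu> * l \<le> h (x + l *\<^sub>R d)"
    using d unfolding transversal_def by auto
  have oU: "open U" and hK: "\<And>x. x \<in> U \<Longrightarrow> x \<in> K \<longleftrightarrow> 0 < h x"
    using h unfolding defining_function_def by auto
  have hx: "h ?x = 0"
    using frontier_iff_defining_zero[OF h d K_open U] edge_in_frontier[OF \<gamma>, of t] t by auto
  define b where "b = (d \<bullet> ?v) / (?v \<bullet> ?v)"
  have dec: "d = (\<nu> \<bullet> d) *\<^sub>R \<nu> + b *\<^sub>R ?v"
    unfolding b_def by (rule planar_decomposition(1)[OF \<nu> v0])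
  show ne: "\<nu> \<bullet> d \<noteq> 0"
  proof
    assume "\<nu> \<bullet> d = 0"
    then have db: "d = b *\<^sub>R ?v" using dec by simp
    obtain \<delta> where \<delta>: "0 < \<delta>" "\<And>s. s \<in> {0<..<\<delta>} \<Longrightarrow> \<bar>h (?x + (s * b) *\<^sub>R ?v)\<bar> \<le> \<mu> / 2 * s"
      using defining_function_near_edge[OF h d \<gamma> t U, of "\<mu> / 2" b] \<mu> by auto
    have "\<mu> * (\<delta> / 2) \<le> h (?x + (\<delta> / 2) *\<^sub>R d)" using \<mu>(2)[of "\<delta> / 2" ?x] \<delta>(1) hx by simp
    also have "\<dots> \<le> \<mu> / 2 * (\<delta> / 2)" using \<delta>(2)[of "\<delta> / 2"] \<delta>(1) by (simp add: db)
    finally show False using \<mu> \<delta> by simp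
  qed
  assume neg: "\<nu> \<bullet> d < 0"
  define q where "q = - (\<nu> \<bullet> d)"
  have q: "0 < q" using neg by (simp add: q_def)
  have \<nu>eq: "q *\<^sub>R \<nu> = b *\<^sub>R ?v - d" using dec by (simp add: q_def algebra_simps)
  have \<nu>eq': "\<nu> = (b / q) *\<^sub>R ?v - (1 / q) *\<^sub>R d"
  proof -
    have "\<nu> = (1 / q) *\<^sub>R (q *\<^sub>R \<nu>)" using q by simp
    then show ?thesis unfolding \<nu>eq by (simp add: algebra_simps)
  qed
  have "\<mu> / (2 * q) > 0" using \<mu> q by simp
  note near = defining_function_near_edge[OF h d \<gamma> t U this]
  obtain \<delta>1 where \<delta>1: "0 < \<delta>1"
    "\<And>s. s \<in> {0<..<\<delta>1} \<Longrightarrow> \<bar>h (?x + (s * (b / q)) *\<^sub>R ?v)\<bar> \<le> \<mu> / (2 * q) * s"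
    using near[of "b / q"] by auto
  obtain \<delta>2 where \<delta>2: "0 < \<delta>2"
    "\<And>s. s \<in> {0<..<\<delta>2} \<Longrightarrow> \<bar>h (?x + (s * (- b / q)) *\<^sub>R ?v)\<bar> \<le> \<mu> / (2 * q) * s"
    using near[of "- b / q"] by auto
  obtain r where r: "0 < r" "ball ?x r \<subseteq> U" using oU U openE by blast
  have "?x - s *\<^sub>R \<nu> \<in> K \<and> ?x + s *\<^sub>R \<nu> \<notin> K" if s: "s \<in> {0<..<min r (min \<delta>1 \<delta>2)}" for s
  proof
    have s0: "0 < s" "s < r" using s by auto
    have inU: "?x - s *\<^sub>R \<nu> \<in> U" "?x + s *\<^sub>R \<nu> \<in> U"
      using s0 r(2) \<nu> by (auto intro!: subsetD[OF r(2)] simp: dist_norm)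
    have small: "\<mu> / (2 * q) * s < \<mu> * (s / q)" using \<mu> q s0 by (simp add: field_simps)
    have A: "?x - s *\<^sub>R \<nu> = (?x + (s * (- b / q)) *\<^sub>R ?v) + (s / q) *\<^sub>R d"
      by (subst \<nu>eq') (simp add: algebra_simps)
    have "h (?x + (s * (- b / q)) *\<^sub>R ?v) + \<mu> * (s / q) \<le> h (?x - s *\<^sub>R \<nu>)"
      unfolding A by (rule \<mu>(2)) (use s0 q in simp)
    then have "0 < h (?x - s *\<^sub>R \<nu>)" using \<delta>2(2)[of s] s small by auto
    then show "?x - s *\<^sub>R \<nu> \<in> K" using hK inU by blast
    have A': "(?x + s *\<^sub>R \<nu>) + (s / q) *\<^sub>R d = ?x + (s * (b / q)) *\<^sub>R ?v"
      by (subst \<nu>eq') (simp add: algebra_simps)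
    have "h (?x + s *\<^sub>R \<nu>) + \<mu> * (s / q) \<le> h (?x + (s * (b / q)) *\<^sub>R ?v)"
      unfolding A'[symmetric] by (rule \<mu>(2)) (use s0 q in simp)
    then have "h (?x + s *\<^sub>R \<nu>) < 0" using \<delta>1(2)[of s] s small by auto
    then show "?x + s *\<^sub>R \<nu> \<notin> K" using hK[OF inU(2)] by linarith
  qed
  moreover have "0 < min r (min \<delta>1 \<delta>2)" using r \<delta>1 \<delta>2 by simp
  ultimately show "\<exists>\<delta>>0. \<forall>s\<in>{0<..<\<delta>}. ?x - s *\<^sub>R \<nu> \<in> K \<and> ?x + s *\<^sub>R \<nu> \<notin> K" by blast
qed

lemma outward_normal_edge:
  assumes h: "defining_function K U h" and d: "transversal h d"
    and \<gamma>: "\<gamma> \<in> E" and t: "t \<in> {0<..<1}" and U: "\<gamma> t \<in> U"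
  shows "norm (outward_normal K E (\<gamma> t)) = 1"
    and "outward_normal K E (\<gamma> t) \<bullet> velocity \<gamma> t = 0"
    and "outward_normal K E (\<gamma> t) \<bullet> d < 0"
proof -
  let ?v = "velocity \<gamma> t" and ?x = "\<gamma> t"
  have v0: "?v \<noteq> 0" using smooth_arcD(4)[OF E_smooth[OF \<gamma>]] t by auto
  note cross = normal_crosses_boundary[OF h d \<gamma> t U]
  define \<nu>0 where "\<nu>0 = (1 / norm ?v) *\<^sub>R rot ?v"
  have nr: "norm (rot ?v) = norm ?v" by (simp add: rot_def norm_Pair norm_prod_def add.commute)
  have \<nu>0: "norm \<nu>0 = 1" "\<nu>0 \<bullet> ?v = 0"
    unfolding \<nu>0_def using v0 by (simp add: nr) (simp add: rot_def inner_prod_def)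
  define \<nu> where "\<nu> = (if \<nu>0 \<bullet> d < 0 then \<nu>0 else - \<nu>0)"
  have \<nu>: "norm \<nu> = 1" "\<nu> \<bullet> ?v = 0" "\<nu> \<bullet> d < 0"
    using \<nu>0 cross(1)[OF \<nu>0] by (auto simp: \<nu>_def)
  obtain \<delta> where \<delta>: "0 < \<delta>" "\<And>s. s \<in> {0<..<\<delta>} \<Longrightarrow> ?x - s *\<^sub>R \<nu> \<in> K \<and> ?x + s *\<^sub>R \<nu> \<notin> K"
    using cross(2)[OF \<nu>] by blast
  have "outward_normal K E ?x = \<nu>"
    unfolding outward_normal_def
  proof (rule the_equality)
    show "norm \<nu> = 1 \<and> (\<exists>\<gamma>'\<in>E. \<exists>t'\<in>{0<..<1}. \<gamma>' t' = ?x \<and> \<nu> \<bullet> velocity \<gamma>' t' = 0) \<and>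
        (\<exists>\<epsilon>>0. \<forall>s\<in>{0<..<\<epsilon>}. ?x - s *\<^sub>R \<nu> \<in> K \<and> ?x + s *\<^sub>R \<nu> \<notin> K)"
      using \<nu> \<gamma> t \<delta> by blast
    fix \<nu>'
    assume a: "norm \<nu>' = 1 \<and> (\<exists>\<gamma>'\<in>E. \<exists>t'\<in>{0<..<1}. \<gamma>' t' = ?x \<and> \<nu>' \<bullet> velocity \<gamma>' t' = 0) \<and>
        (\<exists>\<epsilon>>0. \<forall>s\<in>{0<..<\<epsilon>}. ?x - s *\<^sub>R \<nu>' \<in> K \<and> ?x + s *\<^sub>R \<nu>' \<notin> K)"
    then obtain \<gamma>' t' where \<gamma>': "\<gamma>' \<in> E" "t' \<in> {0<..<1}" "\<gamma>' t' = ?x" "\<nu>' \<bullet> velocity \<gamma>' t' = 0"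
      by blast
    then have \<nu>'v: "\<nu>' \<bullet> ?v = 0" using edges_injective[OF \<gamma>'(1) \<gamma> \<gamma>'(2) t \<gamma>'(3)] by blast
    obtain \<epsilon> where \<epsilon>: "0 < \<epsilon>" "\<And>s. s \<in> {0<..<\<epsilon>} \<Longrightarrow> ?x - s *\<^sub>R \<nu>' \<in> K \<and> ?x + s *\<^sub>R \<nu>' \<notin> K"
      using a by blast
    have eq: "\<nu>' = (\<nu> \<bullet> \<nu>') *\<^sub>R \<nu>"
      using planar_decomposition(1)[OF \<nu>(1,2) v0, of \<nu>'] \<nu>'v by simp
    then have "\<bar>\<nu> \<bullet> \<nu>'\<bar> = 1" using a \<nu>(1) by (metis mult.right_neutral norm_scaleR)
    then consider "\<nu>' = \<nu>" | "\<nu>' = - \<nu>" using eq by (metis abs_eq_iff' abs_one scaleR_minus1_left scaleR_one)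
    then show "\<nu>' = \<nu>"
    proof cases
      case 2
      define s where "s = min \<epsilon> \<delta> / 2"
      have "s \<in> {0<..<\<epsilon>}" "s \<in> {0<..<\<delta>}" using \<epsilon>(1) \<delta>(1) by (auto simp: s_def)
      then have "?x + s *\<^sub>R \<nu>' \<notin> K" "?x - s *\<^sub>R \<nu> \<in> K" using \<epsilon>(2) \<delta>(2) by auto
      then show ?thesis using 2 by simp
    qed
  qed
  then show "norm (outward_normal K E ?x) = 1" "outward_normal K E ?x \<bullet> ?v = 0"
    "outward_normal K E ?x \<bullet> d < 0"
    using \<nu> by auto
qed

lemma outward_normal_transversal:
  assumes h: "defining_function K U h" and d: "transversal h d"
    and \<gamma>: "\<gamma> \<in> E" and t: "t \<in> {0<..<1}" and U: "\<gamma> t \<in> U"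
  shows "(outward_normal K E (\<gamma> t) \<bullet> d) * norm (velocity \<gamma> t)
    = - \<bar>fst d * snd (velocity \<gamma> t) - snd d * fst (velocity \<gamma> t)\<bar>"
proof -
  note n = outward_normal_edge[OF assms]
  have "velocity \<gamma> t \<noteq> 0" using smooth_arcD(4)[OF E_smooth[OF \<gamma>]] t by auto
  from planar_decomposition(2)[OF n(1,2) this, of d] n(3) show ?thesis by simp
qed

lemma edge_chart:
  assumes "\<gamma> \<in> E" "t \<in> {0..1}"
  obtains U h d1 d2 where "defining_function K U h" "\<gamma> t \<in> U"
    "transversal h d1" "transversal h d2" "fst d1 \<noteq> 0" "fst d2 \<noteq> 0"
    "\<And>v. \<exists>\<alpha> \<beta>. v = \<alpha> *\<^sub>R d1 + \<beta> *\<^sub>R d2"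
  by (rule two_transversal_directions[OF K_lipschitz edge_in_frontier[OF assms]]) (rule that)

lemma norm_outward_normal: "\<gamma> \<in> E \<Longrightarrow> t \<in> {0<..<1} \<Longrightarrow> norm (outward_normal K E (\<gamma> t)) = 1"
  by (rule edge_chart[of \<gamma> t]) (auto intro: outward_normal_edge(1))

text \<open>Locally \<open>(n \<bullet> d) |\<gamma>'|\<close> is given by a formula that is continuous in \<open>t\<close>, for two independent
  directions \<open>d\<close>, hence for all vectors \<open>a\<close>.  This supplies the measurability of the normal,
  which is given by a definite description.\<close>

lemma continuous_normal_speed:
  assumes \<gamma>: "\<gamma> \<in> E"
  shows "continuous_on {0<..<1} (\<lambda>t. (outward_normal K E (\<gamma> t) \<bullet> a) * norm (velocity \<gamma> t))"
    (is "continuous_on _ (?N a)")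
proof (rule continuous_at_imp_continuous_on, rule ballI)
  fix t :: real assume t: "t \<in> {0<..<1}"
  note arc = smooth_arcD[OF E_smooth[OF \<gamma>]]
  from t have t': "t \<in> {0..1}" by simp
  obtain U h d1 d2 where h: "defining_function K U h" "\<gamma> t \<in> U"
    and d: "transversal h d1" "transversal h d2" and "fst d1 \<noteq> 0" "fst d2 \<noteq> 0"
    and span: "\<And>v. \<exists>\<alpha> \<beta>. v = \<alpha> *\<^sub>R d1 + \<beta> *\<^sub>R d2"
    by (rule edge_chart[OF \<gamma> t']) (rule that)
  have oU: "open U" using h by (simp add: defining_function_def)
  define S where "S = {0<..<1} \<inter> \<gamma> -` U"
  have cg: "continuous_on {0<..<1} \<gamma>" by (rule continuous_on_subset[OF arc(1)]) auto
  have S: "open S" "t \<in> S" unfolding S_def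
    using continuous_open_preimage[OF cg _ oU] t h by auto
  have dir: "continuous_on S (?N d)" if "transversal h d" for d
  proof -
    have "continuous_on S (velocity \<gamma>)" by (rule continuous_on_subset[OF arc(2)]) (auto simp: S_def)
    then have "continuous_on S (\<lambda>t. - \<bar>fst d * snd (velocity \<gamma> t) - snd d * fst (velocity \<gamma> t)\<bar>)"
      by (intro continuous_intros)
    then show ?thesis
      by (rule continuous_on_eq) (use outward_normal_transversal[OF h(1) that \<gamma>] in \<open>auto simp: S_def\<close>)
  qed
  obtain \<alpha> \<beta> where ab: "a = \<alpha> *\<^sub>R d1 + \<beta> *\<^sub>R d2" using span by blast
  have Na: "?N a = (\<lambda>t. \<alpha> * ?N d1 t + \<beta> * ?N d2 t)"
    unfolding ab by (simp add: inner_add_right algebra_simps)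
  have "continuous_on S (\<lambda>t. \<alpha> * ?N d1 t + \<beta> * ?N d2 t)"
    by (intro continuous_on_add continuous_on_mult_left dir d)
  then have "continuous_on S (?N a)" unfolding Na .
  then show "isCont (?N a) t" using S by (simp add: continuous_on_eq_continuous_at)
qed

end

section \<open>The divergence theorem\<close>

lemma borel_measurable_Icc_continuous_Ioo:
  fixes f :: "real \<Rightarrow> real"
  assumes "continuous_on {0<..<1} f"
  shows "f \<in> borel_measurable (lebesgue_on {0..1})"
proof -
  have "f \<in> borel_measurable (lebesgue_on {0<..<1})"
    by (rule continuous_imp_measurable_on_sets_lebesgue[OF assms]) simp
  then have m: "(\<lambda>t. if t \<in> {0<..<1} then f t else 0) \<in> borel_measurable lebesgue"
    by (rule borel_measurable_if_I) simp
  have [measurable]: "(\<lambda>t. if t \<in> {0<..<1} then f t else 0) \<in> borel_measurable (lebesgue_on {0..1})"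
    by (rule measurable_restrict_space1[OF m])
  have [measurable]: "{0} \<in> sets (lebesgue_on {0..1::real})" "{1} \<in> sets (lebesgue_on {0..1::real})"
    by (auto simp: sets_restrict_space_iff)
  have "(\<lambda>t. (if t \<in> {0<..<1} then f t else 0) + f 0 * indicator {0} t + f 1 * indicator {1} t)
      \<in> borel_measurable (lebesgue_on {0..1})" by measurable
  then show ?thesis
    by (rule measurable_cong[THEN iffD1, rotated]) (auto simp: indicator_def)
qed

lemma AE_Icc_interior: "AE t in lebesgue_on {0..1::real}. t \<in> {0<..<1}"
proof -
  have "AE t in lebesgue. t \<noteq> (0::real)" "AE t in lebesgue. t \<noteq> (1::real)"
    by (auto intro: AE_completion AE_lborel_singleton)
  then have "AE t in lebesgue. t \<in> {0..1::real} \<longrightarrow> t \<in> {0<..<1}"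
    by eventually_elim auto
  then show ?thesis by (subst AE_restrict_space_iff) auto
qed

context polygon
begin

lemma normal_speed_measurable:
  "\<gamma> \<in> E \<Longrightarrow> (\<lambda>t. (outward_normal K E (\<gamma> t) \<bullet> a) * norm (velocity \<gamma> t)) \<in> borel_measurable (lebesgue_on {0..1})"
  by (intro borel_measurable_Icc_continuous_Ioo continuous_normal_speed)

lemma continuous_on_edge:
  "continuous_on UNIV \<phi> \<Longrightarrow> \<gamma> \<in> E \<Longrightarrow> continuous_on {0..1} (\<lambda>t. \<phi> (\<gamma> t))"
  by (rule continuous_on_compose2[OF _ smooth_arcD(1)[OF E_smooth]]) auto

lemma integrable_normal_edge:
  assumes \<phi>: "continuous_on UNIV \<phi>" and \<gamma>: "\<gamma> \<in> E"
  shows "integrable (lebesgue_on {0..1})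
    (\<lambda>t. \<phi> (\<gamma> t) * (outward_normal K E (\<gamma> t) \<bullet> a) * norm (velocity \<gamma> t))"
proof (rule Bochner_Integration.integrable_bound)
  note arc = smooth_arcD[OF E_smooth[OF \<gamma>]]
  have c: "continuous_on {0..1} (\<lambda>t. \<phi> (\<gamma> t))" by (rule continuous_on_edge[OF \<phi> \<gamma>])
  show "integrable (lebesgue_on {0..1}) (\<lambda>t. \<phi> (\<gamma> t) * norm a * norm (velocity \<gamma> t))"
    by (intro continuous_imp_integrable_real continuous_intros c arc)
  have [measurable]: "(\<lambda>t. \<phi> (\<gamma> t)) \<in> borel_measurable (lebesgue_on {0..1})"
    by (rule continuous_imp_measurable_on_sets_lebesgue[OF c]) simp
  note [measurable] = normal_speed_measurable[OF \<gamma>, of a]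
  have "(\<lambda>t. \<phi> (\<gamma> t) * ((outward_normal K E (\<gamma> t) \<bullet> a) * norm (velocity \<gamma> t)))
      \<in> borel_measurable (lebesgue_on {0..1})" by measurable
  then show "(\<lambda>t. \<phi> (\<gamma> t) * (outward_normal K E (\<gamma> t) \<bullet> a) * norm (velocity \<gamma> t))
      \<in> borel_measurable (lebesgue_on {0..1})" by (simp add: mult.assoc)
  show "AE t in lebesgue_on {0..1}. norm (\<phi> (\<gamma> t) * (outward_normal K E (\<gamma> t) \<bullet> a) * norm (velocity \<gamma> t))
      \<le> norm (\<phi> (\<gamma> t) * norm a * norm (velocity \<gamma> t))"
    using AE_Icc_interior
  proof eventually_elim
    case (elim t)
    have "\<bar>outward_normal K E (\<gamma> t) \<bullet> a\<bar> \<le> norm a"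
      using Cauchy_Schwarz_ineq2[of "outward_normal K E (\<gamma> t)" a] norm_outward_normal[OF \<gamma> elim] by simp
    then show ?case by (auto simp: abs_mult intro!: mult_right_mono mult_left_mono)
  qed
qed

lemma boundary_integral_add:
  assumes "\<And>\<gamma>. \<gamma> \<in> E \<Longrightarrow> integrable (lebesgue_on {0..1}) (\<lambda>t. f (\<gamma> t) * norm (velocity \<gamma> t))"
    and "\<And>\<gamma>. \<gamma> \<in> E \<Longrightarrow> integrable (lebesgue_on {0..1}) (\<lambda>t. g (\<gamma> t) * norm (velocity \<gamma> t))"
  shows "boundary_integral E (\<lambda>x. f x + g x) = boundary_integral E f + boundary_integral E g"
  unfolding boundary_integral_def using assms by (simp add: distrib_right sum.distrib)

lemma boundary_integral_cmult: "boundary_integral E (\<lambda>x. c * f x) = c * boundary_integral E f"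
  unfolding boundary_integral_def by (simp add: sum_distrib_left mult.assoc)

lemma boundary_integral_cong:
  assumes "\<And>x. x \<in> frontier K \<Longrightarrow> f x = g x"
  shows "boundary_integral E f = boundary_integral E g"
  unfolding boundary_integral_def
  by (intro sum.cong Bochner_Integration.integral_cong refl) (use assms edge_in_frontier in auto)

text \<open>On the part of \<open>\<partial>K\<close> inside a chart, each point is determined by its coordinate \<open>y\<close> transversal
  to \<open>d = (a, c)\<close>.  The edges are thus injectively parametrised by \<open>y\<close> with disjoint images that
  miss only finitely many points, and the change of variables formula turns the integral over
  them into an integral over the graph.\<close>

lemma edge_graph_integral:
  assumes h: "defining_function K U h" and d: "transversal h (a, c)" and a: "a \<noteq> 0"
    and \<phi>: "test_function U \<phi>"
    and G: "\<And>y l. h (a * l, y + c * l) = 0 \<longleftrightarrow> l = G y"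
    and int: "integrable lborel (\<lambda>y. \<phi> (a * G y, y + c * G y))"
  shows "(\<Sum>\<gamma>\<in>E. LINT t|lebesgue_on {0..1}.
      \<phi> (\<gamma> t) * \<bar>a * snd (velocity \<gamma> t) - c * fst (velocity \<gamma> t)\<bar>)
    = \<bar>a\<bar> * (\<integral>y. \<phi> (a * G y, y + c * G y) \<partial>lborel)"
proof -
  have C1: "C1 \<phi>" using \<phi> by (simp add: test_function_def)
  have \<phi>0: "\<phi> x = 0" if "x \<notin> U" for x using \<phi> that unfolding test_function_def by blast
  have oU: "open U" using h by (simp add: defining_function_def)
  define \<sigma> where "\<sigma> = (\<lambda>x::point. snd x - c / a * fst x)"
  define pt where "pt = (\<lambda>y. (a * G y, y + c * G y))"
  define F where "F = (\<lambda>y. \<phi> (pt y))"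
  define s' where "s' = (\<lambda>\<gamma> t. snd (velocity \<gamma> t) - c / a * fst (velocity \<gamma> t))"
  define S where "S = (\<lambda>\<gamma>::real \<Rightarrow> point. {0<..<1} \<inter> \<gamma> -` U)"
  define I where "I = (\<lambda>\<gamma>. LINT t|lebesgue_on {0..1}. \<phi> (\<gamma> t) * \<bar>s' \<gamma> t\<bar>)"
  have pt: "pt (\<sigma> x) = x" if "h x = 0" for x
  proof -
    have x: "x = (a * (fst x / a), \<sigma> x + c * (fst x / a))"
      using a by (cases x) (simp add: \<sigma>_def)
    then have "fst x / a = G (\<sigma> x)" using G[of "fst x / a" "\<sigma> x"] that by metis
    then show ?thesis using x by (simp add: pt_def)
  qed
  have h0: "h (\<gamma> t) = 0" if "\<gamma> \<in> E" "t \<in> {0..1}" "\<gamma> t \<in> U" for \<gamma> t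
    using frontier_iff_defining_zero[OF h d K_open that(3)] edge_in_frontier[OF that(1,2)] by blast
  have ptS: "pt (\<sigma> (\<gamma> t)) = \<gamma> t" if "\<gamma> \<in> E" "t \<in> S \<gamma>" for \<gamma> t
    using that by (intro pt h0) (auto simp: S_def)
  have edge: "(F has_integral I \<gamma>) ((\<lambda>t. \<sigma> (\<gamma> t)) ` S \<gamma>)" if \<gamma>: "\<gamma> \<in> E" for \<gamma>
  proof -
    note arc = smooth_arcD[OF E_smooth[OF \<gamma>]]
    have cg: "continuous_on {0<..<1} \<gamma>" by (rule continuous_on_subset[OF arc(1)]) auto
    have oS: "open (S \<gamma>)" unfolding S_def by (rule continuous_open_preimage[OF cg _ oU]) simp
    then have Sl: "S \<gamma> \<in> sets lebesgue" by auto
    define f where "f = (\<lambda>t. \<phi> (\<gamma> t) * \<bar>s' \<gamma> t\<bar>)"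
    have cf: "continuous_on {0..1} f" unfolding f_def s'_def
      by (intro continuous_intros continuous_on_edge[OF C1_continuous_on[OF C1] \<gamma>] arc)
    have absS: "f absolutely_integrable_on S \<gamma>"
      by (rule set_integrable_subset[OF absolutely_integrable_continuous_real[OF cf] Sl])
         (auto simp: S_def)
    have "I \<gamma> = integral {0..1} f" unfolding I_def f_def[symmetric]
      by (intro lebesgue_integral_eq_integral continuous_imp_integrable_real cf) simp
    also have "\<dots> = integral (S \<gamma>) f"
    proof (rule integral_spike_set)
      have "{t \<in> {0..1} - S \<gamma>. f t \<noteq> 0} \<subseteq> {0, 1}"
      proof
        fix t assume t: "t \<in> {t \<in> {0..1} - S \<gamma>. f t \<noteq> 0}"
        then have "\<gamma> t \<in> U" using \<phi>0[of "\<gamma> t"] by (auto simp: f_def)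
        then show "t \<in> {0, 1}" using t by (auto simp: S_def)
      qed
      then show "negligible {t \<in> {0..1} - S \<gamma>. f t \<noteq> 0}"
        by (meson finite.emptyI finite_insert negligible_finite negligible_subset)
      have "{t \<in> S \<gamma> - {0..1}. f t \<noteq> 0} = {}" by (auto simp: S_def)
      then show "negligible {t \<in> S \<gamma> - {0..1}. f t \<noteq> 0}" by (metis negligible_empty)
    qed
    finally have I: "I \<gamma> = integral (S \<gamma>) f" .
    have fF: "\<bar>s' \<gamma> t\<bar> * F (\<sigma> (\<gamma> t)) = f t" if "t \<in> S \<gamma>" for t
      using ptS[OF \<gamma> that] by (simp add: f_def F_def)
    have "(\<lambda>t. \<bar>s' \<gamma> t\<bar> * F (\<sigma> (\<gamma> t))) absolutely_integrable_on S \<gamma>"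
      using absS fF by (simp cong: set_integrable_cong)
    moreover have "integral (S \<gamma>) (\<lambda>t. \<bar>s' \<gamma> t\<bar> * F (\<sigma> (\<gamma> t))) = I \<gamma>"
      unfolding I by (rule integral_cong) (rule fF)
    moreover have "((\<lambda>t. \<sigma> (\<gamma> t)) has_field_derivative s' \<gamma> t) (at t within S \<gamma>)" if "t \<in> S \<gamma>" for t
    proof -
      have "(\<gamma> has_derivative (\<lambda>h. h *\<^sub>R velocity \<gamma> t)) (at t within S \<gamma>)"
        using arc(3)[of t] that unfolding has_vector_derivative_def
        by (rule_tac has_derivative_subset[of _ _ _ "{0..1}"]) (auto simp: S_def)
      then have "((\<lambda>t. \<sigma> (\<gamma> t)) has_derivative (\<lambda>h. snd (h *\<^sub>R velocity \<gamma> t) - c / a * fst (h *\<^sub>R velocity \<gamma> t)))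
          (at t within S \<gamma>)"
        unfolding \<sigma>_def by (intro derivative_intros)
      then show ?thesis
        unfolding has_field_derivative_def s'_def
        by (rule has_derivative_eq_rhs) (auto simp: algebra_simps)
    qed
    moreover have "inj_on (\<lambda>t. \<sigma> (\<gamma> t)) (S \<gamma>)"
    proof (rule inj_onI)
      fix s t assume "s \<in> S \<gamma>" "t \<in> S \<gamma>" "\<sigma> (\<gamma> s) = \<sigma> (\<gamma> t)"
      then have "\<gamma> s = \<gamma> t" using ptS[OF \<gamma>] by metis
      then show "s = t" using edges_injective[OF \<gamma> \<gamma>] \<open>s \<in> S \<gamma>\<close> \<open>t \<in> S \<gamma>\<close> by (auto simp: S_def)
    qed
    ultimately have "F absolutely_integrable_on ((\<lambda>t. \<sigma> (\<gamma> t)) ` S \<gamma>)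
        \<and> integral ((\<lambda>t. \<sigma> (\<gamma> t)) ` S \<gamma>) F = I \<gamma>"
      using has_absolute_integral_change_of_variables_1'[OF Sl, of "\<lambda>t. \<sigma> (\<gamma> t)" "s' \<gamma>" F "I \<gamma>"] by blast
    then show ?thesis
      unfolding has_integral_integrable_integral absolutely_integrable_on_def by simp
  qed
  have "pairwise (\<lambda>\<gamma> \<delta>. negligible ((\<lambda>t. \<sigma> (\<gamma> t)) ` S \<gamma> \<inter> (\<lambda>t. \<sigma> (\<delta> t)) ` S \<delta>)) E"
  proof (rule pairwiseI)
    fix \<gamma> \<delta> assume gd: "\<gamma> \<in> E" "\<delta> \<in> E" "\<gamma> \<noteq> \<delta>"
    have "(\<lambda>t. \<sigma> (\<gamma> t)) ` S \<gamma> \<inter> (\<lambda>t. \<sigma> (\<delta> t)) ` S \<delta> = {}"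
    proof (rule ccontr)
      assume "\<not> ?thesis"
      then obtain s t where st: "s \<in> S \<gamma>" "t \<in> S \<delta>" "\<sigma> (\<gamma> s) = \<sigma> (\<delta> t)" by auto
      then have "\<gamma> s = \<delta> t" using ptS gd by metis
      then show False using edges_injective[OF gd(1,2)] st gd by (auto simp: S_def)
    qed
    then show "negligible ((\<lambda>t. \<sigma> (\<gamma> t)) ` S \<gamma> \<inter> (\<lambda>t. \<sigma> (\<delta> t)) ` S \<delta>)" by simp
  qed
  from has_integral_UN[OF E_finite edge this]
  have "((\<lambda>y. if y \<in> (\<Union>\<gamma>\<in>E. (\<lambda>t. \<sigma> (\<gamma> t)) ` S \<gamma>) then F y else 0) has_integral (\<Sum>\<gamma>\<in>E. I \<gamma>)) UNIV"
    by (simp only: has_integral_restrict_UNIV)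
  then have "(F has_integral (\<Sum>\<gamma>\<in>E. I \<gamma>)) UNIV"
  proof (rule has_integral_spike_finite[rotated 2])
    show "finite (\<Union>\<gamma>\<in>E. {\<sigma> (\<gamma> 0), \<sigma> (\<gamma> 1)})" using E_finite by simp
    fix y assume y: "y \<in> UNIV - (\<Union>\<gamma>\<in>E. {\<sigma> (\<gamma> 0), \<sigma> (\<gamma> 1)})"
    show "F y = (if y \<in> (\<Union>\<gamma>\<in>E. (\<lambda>t. \<sigma> (\<gamma> t)) ` S \<gamma>) then F y else 0)"
    proof (cases "pt y \<in> U")
      case True
      have "h (pt y) = 0" using G[of "G y" y] by (simp add: pt_def)
      then have "pt y \<in> frontier K" using frontier_iff_defining_zero[OF h d K_open True] by blast
      then obtain \<gamma> t where \<gamma>t: "\<gamma> \<in> E" "t \<in> {0..1}" "\<gamma> t = pt y"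
        unfolding frontier_eq path_image_def by force
      have "\<sigma> (pt y) = y" using a by (simp add: \<sigma>_def pt_def)
      then have \<sigma>y: "\<sigma> (\<gamma> t) = y" using \<gamma>t by simp
      then have "t \<noteq> 0" "t \<noteq> 1" using y \<gamma>t(1) by auto
      then have "t \<in> S \<gamma>" using \<gamma>t True by (auto simp: S_def)
      then show ?thesis using \<sigma>y \<gamma>t(1) by auto
    next
      case False
      then show ?thesis by (simp add: F_def \<phi>0)
    qed
  qed
  moreover have "(F has_integral (\<integral>y. F y \<partial>lborel)) UNIV"
    using has_integral_integral_lborel[OF int] by (simp add: F_def pt_def)
  ultimately have "(\<Sum>\<gamma>\<in>E. I \<gamma>) = (\<integral>y. F y \<partial>lborel)" by (rule has_integral_unique)
  moreover have "(LINT t|lebesgue_on {0..1}. \<phi> (\<gamma> t) * \<bar>a * snd (velocity \<gamma> t) - c * fst (velocity \<gamma> t)\<bar>)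
      = \<bar>a\<bar> * I \<gamma>" for \<gamma>
  proof -
    have "\<bar>a * snd (velocity \<gamma> t) - c * fst (velocity \<gamma> t)\<bar> = \<bar>a\<bar> * \<bar>s' \<gamma> t\<bar>" for t
      using a by (simp add: s'_def abs_mult[symmetric] right_diff_distrib)
    then have "(\<lambda>t. \<phi> (\<gamma> t) * \<bar>a * snd (velocity \<gamma> t) - c * fst (velocity \<gamma> t)\<bar>)
        = (\<lambda>t. \<bar>a\<bar> * (\<phi> (\<gamma> t) * \<bar>s' \<gamma> t\<bar>))" by auto
    then show ?thesis by (simp add: I_def)
  qed
  ultimately show ?thesis by (simp add: F_def pt_def sum_distrib_left[symmetric])
qed

definition divergence_formula :: "(point \<Rightarrow> real) \<Rightarrow> point \<Rightarrow> bool" where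
  "divergence_formula \<phi> a \<longleftrightarrow> (LINT x|lebesgue_on K. grad \<phi> x \<bullet> a)
     = boundary_integral E (\<lambda>x. \<phi> x * (outward_normal K E x \<bullet> a))"

lemma divergence_formula_transversal:
  assumes h: "defining_function K U h" and d: "transversal h d" "fst d \<noteq> 0"
    and \<phi>: "test_function U \<phi>"
  shows "divergence_formula \<phi> d"
proof -
  obtain a c where ac: "d = (a, c)" by (cases d)
  have C1: "C1 \<phi>" using \<phi> by (simp add: test_function_def)
  have d': "transversal h (a, c)" and a: "a \<noteq> 0" using d by (auto simp: ac)
  obtain G where G: "\<And>y l. 0 < h (a * l, y + c * l) \<longleftrightarrow> G y < l"
    and G0: "\<And>y l. h (a * l, y + c * l) = 0 \<longleftrightarrow> l = G y"
    by (rule transversal_graph[OF h d']) (rule that)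
  have GK: "(a * l, y + c * l) \<in> K \<longleftrightarrow> G y < l" if "(a * l, y + c * l) \<in> U" for y l
    using h that G unfolding defining_function_def by blast
  note lines = integral_directional_derivative[OF \<phi> a K_open GK]
  have "boundary_integral E (\<lambda>x. \<phi> x * (outward_normal K E x \<bullet> d))
      = (\<Sum>\<gamma>\<in>E. - (LINT t|lebesgue_on {0..1}. \<phi> (\<gamma> t) * \<bar>a * snd (velocity \<gamma> t) - c * fst (velocity \<gamma> t)\<bar>))"
    unfolding boundary_integral_def
  proof (rule sum.cong[OF refl])
    fix \<gamma> assume \<gamma>: "\<gamma> \<in> E"
    note arc = smooth_arcD[OF E_smooth[OF \<gamma>]]
    have c: "continuous_on {0..1} (\<lambda>t. \<phi> (\<gamma> t) * \<bar>a * snd (velocity \<gamma> t) - c * fst (velocity \<gamma> t)\<bar>)"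
      by (intro continuous_intros continuous_on_edge[OF C1_continuous_on[OF C1] \<gamma>] arc)
    have "(LINT t|lebesgue_on {0..1}. \<phi> (\<gamma> t) * (outward_normal K E (\<gamma> t) \<bullet> d) * norm (velocity \<gamma> t))
        = (LINT t|lebesgue_on {0..1}. - (\<phi> (\<gamma> t) * \<bar>a * snd (velocity \<gamma> t) - c * fst (velocity \<gamma> t)\<bar>))"
    proof (rule integral_cong_AE)
      show "(\<lambda>t. \<phi> (\<gamma> t) * (outward_normal K E (\<gamma> t) \<bullet> d) * norm (velocity \<gamma> t))
          \<in> borel_measurable (lebesgue_on {0..1})"
        by (rule borel_measurable_integrable[OF integrable_normal_edge[OF C1_continuous_on[OF C1] \<gamma>]])
      show "(\<lambda>t. - (\<phi> (\<gamma> t) * \<bar>a * snd (velocity \<gamma> t) - c * fst (velocity \<gamma> t)\<bar>))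
          \<in> borel_measurable (lebesgue_on {0..1})"
        by (rule continuous_imp_measurable_on_sets_lebesgue) (auto intro!: continuous_intros c)
      show "AE t in lebesgue_on {0..1}. \<phi> (\<gamma> t) * (outward_normal K E (\<gamma> t) \<bullet> d) * norm (velocity \<gamma> t)
          = - (\<phi> (\<gamma> t) * \<bar>a * snd (velocity \<gamma> t) - c * fst (velocity \<gamma> t)\<bar>)"
        using AE_Icc_interior
      proof eventually_elim
        case (elim t)
        show ?case
        proof (cases "\<gamma> t \<in> U")
          case True
          from outward_normal_transversal[OF h d(1) \<gamma> elim True] show ?thesis by (simp add: ac mult.assoc)
        next
          case False
          then have "\<phi> (\<gamma> t) = 0" using \<phi> unfolding test_function_def by blast
          then show ?thesis by simp
        qed
      qed
    qed
    then show "(LINT t|lebesgue_on {0..1}. \<phi> (\<gamma> t) * (outward_normal K E (\<gamma> t) \<bullet> d) * norm (velocity \<gamma> t))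
        = - (LINT t|lebesgue_on {0..1}. \<phi> (\<gamma> t) * \<bar>a * snd (velocity \<gamma> t) - c * fst (velocity \<gamma> t)\<bar>)"
      by simp
  qed
  also have "\<dots> = - (\<bar>a\<bar> * (\<integral>y. \<phi> (a * G y, y + c * G y) \<partial>lborel))"
    unfolding sum_negf using edge_graph_integral[OF h d' a \<phi> G0 lines(1)] by simp
  also have "\<dots> = (LINT x|lebesgue_on K. grad \<phi> x \<bullet> d)"
    unfolding ac by (rule lines(2)[symmetric])
  finally show ?thesis by (simp add: divergence_formula_def)
qed

lemma boundary_integral_zero: "(\<And>x. x \<in> frontier K \<Longrightarrow> f x = 0) \<Longrightarrow> boundary_integral E f = 0"
  using boundary_integral_cong[of f "\<lambda>_. 0"] by (simp add: boundary_integral_def)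

text \<open>A test function is supported in \<open>K\<close> itself, and the bounded set \<open>K\<close> lies above the constant
  graph \<open>-M\<close> for large \<open>M\<close>, on which the test function vanishes.\<close>

lemma divergence_formula_interior:
  assumes \<phi>: "test_function K \<phi>" and d: "fst d \<noteq> 0"
  shows "divergence_formula \<phi> d"
proof -
  obtain a c where ac: "d = (a, c)" by (cases d)
  obtain B where B: "\<And>x. x \<in> K \<Longrightarrow> norm x \<le> B" using K_bounded unfolding bounded_iff by auto
  define M where "M = (B + 1) / \<bar>a\<bar>"
  have a: "a \<noteq> 0" using d by (simp add: ac)
  have out: "(a * l, t) \<notin> K" if "l \<le> - M" for l t
  proof
    assume "(a * l, t) \<in> K"
    then have "\<bar>a * l\<bar> \<le> B" using B[of "(a * l, t)"] norm_fst_le[of "a * l" t] by simp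
    moreover have "B + 1 \<le> \<bar>a\<bar> * (- l)" using that a by (simp add: M_def field_simps)
    moreover have "\<bar>a\<bar> * (- l) \<le> \<bar>a * l\<bar>" 
      unfolding abs_mult by (rule mult_left_mono) auto
    ultimately show False by linarith
  qed
  have "(a * l, y + c * l) \<in> K \<longleftrightarrow> - M < l" if "(a * l, y + c * l) \<in> K" for y l
    using that out[of l "y + c * l"] by force
  from integral_directional_derivative(2)[OF \<phi> a K_open this]
  have "(LINT x|lebesgue_on K. grad \<phi> x \<bullet> d) = - (\<bar>a\<bar> * (\<integral>y. \<phi> (a * (- M), y + c * (- M)) \<partial>lborel))"
    unfolding ac .
  moreover have "\<phi> x = 0" if "x \<notin> K" for x using \<phi> that unfolding test_function_def by blast
  ultimately have "(LINT x|lebesgue_on K. grad \<phi> x \<bullet> d) = 0" using out[of "- M"] by simp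
  moreover have "boundary_integral E (\<lambda>x. \<phi> x * (outward_normal K E x \<bullet> d)) = 0"
  proof (rule boundary_integral_zero)
    fix x assume "x \<in> frontier K"
    then have "x \<notin> K" using K_open by (simp add: frontier_def interior_open)
    then show "\<phi> x * (outward_normal K E x \<bullet> d) = 0" using \<open>\<And>x. x \<notin> K \<Longrightarrow> \<phi> x = 0\<close> by simp
  qed
  ultimately show ?thesis by (simp add: divergence_formula_def)
qed

lemma integrable_continuous_K: "continuous_on UNIV f \<Longrightarrow> integrable (lebesgue_on K) f"
  for f :: "point \<Rightarrow> 'c::euclidean_space"
  by (rule integrable_continuous_bounded_open[OF K_open K_bounded])

lemma divergence_formula_combination:
  assumes \<phi>: "C1 \<phi>" and "divergence_formula \<phi> d1" "divergence_formula \<phi> d2"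
  shows "divergence_formula \<phi> (\<alpha> *\<^sub>R d1 + \<beta> *\<^sub>R d2)"
proof -
  let ?n = "outward_normal K E"
  have i: "integrable (lebesgue_on K) (\<lambda>x. c * (grad \<phi> x \<bullet> d))" for c d
    by (intro integrable_continuous_K continuous_intros C1_continuous_on_grad[OF \<phi>])
  have b: "integrable (lebesgue_on {0..1}) (\<lambda>t. c * (\<phi> (\<gamma> t) * (?n (\<gamma> t) \<bullet> d)) * norm (velocity \<gamma> t))"
    if "\<gamma> \<in> E" for \<gamma> c d
    using integrable_mult_right[OF integrable_normal_edge[OF C1_continuous_on[OF \<phi>] that, of d], of c]
    by (simp add: mult.assoc)
  have "boundary_integral E (\<lambda>x. \<phi> x * (?n x \<bullet> (\<alpha> *\<^sub>R d1 + \<beta> *\<^sub>R d2)))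
      = boundary_integral E (\<lambda>x. \<alpha> * (\<phi> x * (?n x \<bullet> d1)) + \<beta> * (\<phi> x * (?n x \<bullet> d2)))"
    by (simp add: inner_add_right algebra_simps)
  also have "\<dots> = boundary_integral E (\<lambda>x. \<alpha> * (\<phi> x * (?n x \<bullet> d1))) + boundary_integral E (\<lambda>x. \<beta> * (\<phi> x * (?n x \<bullet> d2)))"
    by (rule boundary_integral_add[OF b b])
  also have "\<dots> = (LINT x|lebesgue_on K. \<alpha> * (grad \<phi> x \<bullet> d1)) + (LINT x|lebesgue_on K. \<beta> * (grad \<phi> x \<bullet> d2))"
    using assms(2,3) by (simp add: boundary_integral_cmult divergence_formula_def)
  also have "\<dots> = (LINT x|lebesgue_on K. \<alpha> * (grad \<phi> x \<bullet> d1) + \<beta> * (grad \<phi> x \<bullet> d2))"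
    by (rule Bochner_Integration.integral_add[OF i i, symmetric])
  also have "\<dots> = (LINT x|lebesgue_on K. grad \<phi> x \<bullet> (\<alpha> *\<^sub>R d1 + \<beta> *\<^sub>R d2))"
    by (simp add: inner_add_right)
  finally show ?thesis by (simp add: divergence_formula_def)
qed

theorem divergence_theorem:
  assumes "C1 \<phi>"
  shows "(LINT x|lebesgue_on K. grad \<phi> x \<bullet> a)
    = boundary_integral E (\<lambda>x. \<phi> x * (outward_normal K E x \<bullet> a))"
proof -
  let ?n = "outward_normal K E"
  have "\<forall>a. divergence_formula \<phi> a"
  proof (rule C1_localisation[of "closure K" "\<lambda>\<phi>. \<forall>a. divergence_formula \<phi> a"])
    show "compact (closure K)" using K_bounded by (simp add: compact_closure)
    show "C1 \<phi>" by fact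
  next
    fix \<phi> \<psi> :: "point \<Rightarrow> real"
    assume C1: "C1 \<phi>" "C1 \<psi>" and D: "\<forall>a. divergence_formula \<phi> a" "\<forall>a. divergence_formula \<psi> a"
    show "\<forall>a. divergence_formula (\<lambda>x. \<phi> x + \<psi> x) a"
    proof
      fix a
      have i: "integrable (lebesgue_on K) (\<lambda>x. grad \<phi> x \<bullet> a)" if "C1 \<phi>" for \<phi>
        by (intro integrable_continuous_K continuous_intros C1_continuous_on_grad[OF that])
      have b: "integrable (lebesgue_on {0..1}) (\<lambda>t. \<phi> (\<gamma> t) * (?n (\<gamma> t) \<bullet> a) * norm (velocity \<gamma> t))"
        if "\<gamma> \<in> E" "C1 \<phi>" for \<gamma> \<phi>
        by (rule integrable_normal_edge[OF C1_continuous_on[OF that(2)] that(1)])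
      show "divergence_formula (\<lambda>x. \<phi> x + \<psi> x) a"
        using D[THEN spec, of a] i C1 unfolding divergence_formula_def
        by (simp add: grad_add inner_add_left distrib_right boundary_integral_add[OF b b])
    qed
  next
    fix \<phi> :: "point \<Rightarrow> real" and V
    assume C1: "C1 \<phi>" and V: "open V" "closure K \<subseteq> V" "\<And>x. x \<in> V \<Longrightarrow> \<phi> x = 0"
    have "grad \<phi> x = 0" if "x \<in> K" for x
      using V that closure_subset[of K] by (intro grad_eq_0_open[of V]) auto
    then have "(LINT x|lebesgue_on K. grad \<phi> x \<bullet> a) = 0" for a
      by (intro integral_eq_zero_AE AE_I2) simp
    moreover have "boundary_integral E (\<lambda>x. \<phi> x * (?n x \<bullet> a)) = 0" for a
      by (rule boundary_integral_zero) (use V in \<open>auto simp: frontier_def\<close>)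
    ultimately show "\<forall>a. divergence_formula \<phi> a" by (simp add: divergence_formula_def)
  next
    fix z assume z: "z \<in> closure K"
    have "\<exists>U d1 d2. open U \<and> z \<in> U \<and> (\<forall>v. \<exists>\<alpha> \<beta>. v = \<alpha> *\<^sub>R d1 + \<beta> *\<^sub>R d2) \<and>
      (\<forall>\<phi>. test_function U \<phi> \<longrightarrow> divergence_formula \<phi> d1 \<and> divergence_formula \<phi> d2)"
    proof (cases "z \<in> K")
      case True
      have "\<exists>\<alpha> \<beta>. v = \<alpha> *\<^sub>R (1, 0) + \<beta> *\<^sub>R (1, 1)" for v :: point
        by (rule exI[of _ "fst v - snd v"], rule exI[of _ "snd v"]) (simp add: prod_eq_iff)
      then show ?thesis
        using True K_open divergence_formula_interior
        by (intro exI[of _ K] exI[of _ "(1, 0)"] exI[of _ "(1, 1)"]) auto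
    next
      case False
      then have f: "z \<in> frontier K" using z K_open by (simp add: frontier_def interior_open)
      obtain U h d1 d2 where c: "defining_function K U h" "z \<in> U"
        "transversal h d1" "transversal h d2" "fst d1 \<noteq> 0" "fst d2 \<noteq> 0"
        "\<And>v. \<exists>\<alpha> \<beta>. v = \<alpha> *\<^sub>R d1 + \<beta> *\<^sub>R d2"
        by (rule two_transversal_directions[OF K_lipschitz f]) (rule that)
      then have "open U" by (simp add: defining_function_def)
      then show ?thesis using c divergence_formula_transversal
        by (intro exI[of _ U] exI[of _ d1] exI[of _ d2]) auto
    qed
    then obtain U d1 d2 where U: "open U" "z \<in> U" and span: "\<forall>v. \<exists>\<alpha> \<beta>. v = \<alpha> *\<^sub>R d1 + \<beta> *\<^sub>R d2"
      and D: "\<forall>\<phi>. test_function U \<phi> \<longrightarrow> divergence_formula \<phi> d1 \<and> divergence_formula \<phi> d2"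
      by blast
    obtain \<rho> where \<rho>: "0 < \<rho>" "cball z \<rho> \<subseteq> U" using U open_contains_cball by blast
    show "\<exists>\<rho>>0. \<forall>\<phi>. C1 \<phi> \<longrightarrow> (\<forall>x. x \<notin> ball z \<rho> \<longrightarrow> \<phi> x = 0) \<longrightarrow> (\<forall>a. divergence_formula \<phi> a)"
    proof (intro exI[of _ \<rho>] conjI allI impI \<rho>(1))
      fix \<phi> a assume \<phi>: "C1 \<phi>" "\<forall>x. x \<notin> ball z \<rho> \<longrightarrow> \<phi> x = 0"
      have "test_function U \<phi>"
        unfolding test_function_def using \<phi> \<rho>(2)
        by (intro conjI exI[of _ "cball z \<rho>"]) (auto simp: dist_commute)
      then have "divergence_formula \<phi> d1" "divergence_formula \<phi> d2" using D by blast+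
      then show "divergence_formula \<phi> a"
        using divergence_formula_combination[OF \<phi>(1)] span by metis
    qed
  qed
  from this[THEN spec, of a] show ?thesis by (simp add: divergence_formula_def)
qed

end

section \<open>Uniqueness of weak derivatives\<close>

lemma open_ball_sequence:
  fixes U :: "point set"
  assumes "open U" "U \<noteq> {}"
  obtains z r where "\<And>i::nat. 0 < r i \<and> cball (z i) (r i) \<subseteq> U" "(\<Union>i. ball (z i) (r i)) = U"
proof -
  let ?F = "{ball z r | z r. 0 < r \<and> cball z r \<subseteq> U}"
  obtain F where F: "F \<subseteq> ?F" "countable F" "\<Union>F = \<Union>?F"
    by (rule Lindelof[of ?F]) auto
  have "\<Union>?F = U"
  proof
    show "\<Union>?F \<subseteq> U" using ball_subset_cball by blast
    show "U \<subseteq> \<Union>?F"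
    proof
      fix x assume "x \<in> U"
      then obtain r where "0 < r" "cball x r \<subseteq> U" using assms(1) open_contains_cball by blast
      then have "ball x r \<in> ?F" by blast
      moreover have "x \<in> ball x r" using \<open>0 < r\<close> by simp
      ultimately show "x \<in> \<Union>?F" by blast
    qed
  qed
  then have F': "\<Union>F = U" "F \<noteq> {}" using F assms by auto
  have "\<exists>z r. from_nat_into F i = ball z r \<and> 0 < r \<and> cball z r \<subseteq> U" for i
    using from_nat_into[OF F'(2), of i] F(1) by blast
  then obtain z r where zr: "\<And>i. from_nat_into F i = ball (z i) (r i) \<and> 0 < r i \<and> cball (z i) (r i) \<subseteq> U"
    by metis
  have "(\<Union>i. ball (z i) (r i)) = \<Union>(range (from_nat_into F))" using zr by simp
  also have "\<dots> = U" using F' F(2) by (simp add: range_from_nat_into)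
  finally have U: "(\<Union>i. ball (z i) (r i)) = U" .
  show ?thesis
  proof (rule that[OF _ U])
    show "0 < r i \<and> cball (z i) (r i) \<subseteq> U" for i using zr[of i] by simp
  qed
qed

text \<open>With \<open>f\<^sub>n\<close> the sum of the first \<open>n\<close> bumps of a cover of \<open>U\<close> by balls, the functions
  \<open>n f\<^sub>n / (1 + n f\<^sub>n)\<close> approximate the indicator of \<open>U\<close>.\<close>

lemma indicator_limit_test_functions:
  fixes U :: "point set"
  assumes "open U"
  obtains \<psi> where "\<And>n::nat. test_function U (\<psi> n)" "\<And>n x. 0 \<le> \<psi> n x \<and> \<psi> n x \<le> 1"
    "\<And>x. (\<lambda>n. \<psi> n x) \<longlonglongrightarrow> indicator U x"
proof (cases "U = {}")
  case True
  then show ?thesis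
    by (intro that[of "\<lambda>_ _. 0"]) (auto simp: test_function_def C1_const)
next
  case False
  obtain z r where zr: "\<And>i::nat. 0 < r i \<and> cball (z i) (r i) \<subseteq> U" "(\<Union>i. ball (z i) (r i)) = U"
    by (rule open_ball_sequence[OF assms False]) (rule that)
  define f where "f = (\<lambda>n x. real n * (\<Sum>i<n. bump (z i) (r i) x))"
  have fnn: "0 \<le> f n x" for n x by (simp add: f_def sum_nonneg bump_nonneg)
  have C1f: "C1 (f n)" for n unfolding f_def by (intro C1_mult C1_const C1_sum C1_bump)
  define \<psi> where "\<psi> = (\<lambda>n x. f n x / (1 + f n x))"
  have f0: "f n x = 0" if "\<And>i. i < n \<Longrightarrow> x \<notin> ball (z i) (r i)" for n x
    unfolding f_def using that zr(1) by (auto intro!: sum.neutral bump_eq_0)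
  show ?thesis
  proof (rule that[of \<psi>])
    fix n
    have "gradient_field (\<lambda>x. f n x / (1 + f n x)) (\<lambda>x. (1 / (1 + f n x)\<^sup>2) *\<^sub>R grad (f n) x)"
    proof (rule gradient_field_compose[OF C1_gradient_field[OF C1f]])
      fix s assume "s \<in> range (f n)"
      then have "0 \<le> s" using fnn by auto
      then show "((\<lambda>s. s / (1 + s)) has_real_derivative 1 / (1 + s)\<^sup>2) (at s)"
        by (auto intro!: derivative_eq_intros simp: power2_eq_square field_simps)
    next
      have "1 + s \<noteq> 0" if s: "s \<in> range (f n)" for s
      proof -
        obtain x where "s = f n x" using s by blast
        then show ?thesis using fnn[of n x] by linarith
      qed
      then show "continuous_on (range (f n)) (\<lambda>s. 1 / (1 + s)\<^sup>2)"
        by (auto intro!: continuous_intros)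
    qed
    then have "C1 (\<psi> n)" unfolding \<psi>_def by (rule gradient_fieldD(1))
    moreover have "compact (\<Union>i<n. cball (z i) (r i))" by (intro compact_UN) auto
    moreover have "(\<Union>i<n. cball (z i) (r i)) \<subseteq> U" using zr(1) by blast
    moreover have "\<psi> n x = 0" if "x \<notin> (\<Union>i<n. cball (z i) (r i))" for x
    proof -
      have "f n x = 0" using that ball_subset_cball by (intro f0) blast
      then show ?thesis by (simp add: \<psi>_def)
    qed
    ultimately show "test_function U (\<psi> n)" unfolding test_function_def by blast
    show "0 \<le> \<psi> n x \<and> \<psi> n x \<le> 1" for x
      using fnn[of n x] by (simp add: \<psi>_def)
  next
    fix x
    show "(\<lambda>n. \<psi> n x) \<longlonglongrightarrow> indicator U x"
    proof (cases "x \<in> U")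
      case True
      then obtain i0 where i0: "x \<in> ball (z i0) (r i0)" using zr(2) by blast
      define c where "c = bump (z i0) (r i0) x"
      have c: "0 < c" using i0 zr(1) by (simp add: c_def bump_pos_iff)
      have lb: "real n * c \<le> f n x" if "i0 < n" for n
        unfolding f_def c_def using that
        by (intro mult_left_mono member_le_sum) (auto simp: bump_nonneg)
      have "(\<lambda>n. 1 - \<psi> n x) \<longlonglongrightarrow> 0"
      proof (rule Lim_null_comparison)
        show "\<forall>\<^sub>F n in sequentially. norm (1 - \<psi> n x) \<le> (1 / c) * (1 / real n)"
          using eventually_gt_at_top[of i0]
        proof eventually_elim
          case (elim n)
          have n: "0 < real n" using elim by simp
          have "1 - \<psi> n x = 1 / (1 + f n x)" using fnn[of n x] by (simp add: \<psi>_def field_simps)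
          also have "\<dots> \<le> 1 / (real n * c)"
            using lb[OF elim] n c fnn[of n x] by (intro divide_left_mono mult_pos_pos) auto
          finally have "1 - \<psi> n x \<le> (1 / c) * (1 / real n)" by (simp add: mult.commute)
          moreover have "0 \<le> 1 - \<psi> n x" using fnn[of n x] by (simp add: \<psi>_def)
          ultimately show ?case by simp
        qed
        show "(\<lambda>n. (1 / c) * (1 / real n)) \<longlonglongrightarrow> 0"
          using tendsto_mult_left[OF lim_1_over_n, of "1 / c"] by simp
      qed
      from tendsto_diff[OF tendsto_const[of 1] this] show ?thesis using True by simp
    next
      case False
      then have "x \<notin> ball (z i) (r i)" for i using zr(2) by blast
      then have "\<psi> n x = 0" for n using f0[of n x] by (simp add: \<psi>_def)
      then show ?thesis using False by simp
    qed
  qed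
qed

text \<open>The sets over which \<open>h\<close> has integral zero form a Dynkin system, and the open sets are stable
  under intersection.\<close>

lemma AE_zero_of_open_integrals:
  fixes h :: "'a::euclidean_space \<Rightarrow> real"
  assumes h: "integrable lborel h"
    and op: "\<And>V. open V \<Longrightarrow> (\<integral>x. indicator V x *\<^sub>R h x \<partial>lborel) = 0"
  shows "AE x in lborel. h x = 0"
proof -
  have ind: "set_integrable lborel A h" if "A \<in> sets borel" for A
    unfolding set_integrable_def using that h by (intro integrable_mult_indicator) auto
  have Int_open: "Int_stable {S :: 'a set. open S}" by (auto simp: Int_stable_def)
  have Pow_open: "{S :: 'a set. open S} \<subseteq> Pow UNIV" by simp
  have "(LINT x:A|lborel. h x) = 0" if "A \<in> sigma_sets UNIV {S. open S}" for A
    using Int_open Pow_open that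
  proof (induction rule: sigma_sets_induct_disjoint)
    case (compl A)
    have A: "A \<in> sets borel" using compl(1) unfolding borel_def by simp
    have "(LINT x:A \<union> (UNIV - A)|lborel. h x) = (LINT x:A|lborel. h x) + (LINT x:UNIV - A|lborel. h x)"
      using A by (intro set_integral_Un ind) auto
    moreover have "(LINT x:UNIV|lborel. h x) = 0"
      unfolding set_lebesgue_integral_def by (rule op) simp
    ultimately show ?case using compl by simp
  next
    case (union A)
    have A: "A i \<in> sets borel" for i using union(2) unfolding borel_def by auto
    have "(LINT x:(\<Union>i. A i)|lborel. h x) = (\<Sum>i. LINT x:A i|lborel. h x)"
      using A union(1) by (intro lebesgue_integral_countable_add ind) (auto simp: disjoint_family_on_def)
    then show ?case using union by simp
  qed (use op in \<open>simp_all add: set_lebesgue_integral_def\<close>)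
  then have "(LINT x:A|lborel. h x) = (LINT x:A|lborel. 0)" if "A \<in> sets lborel" for A
    using that by (simp add: borel_def set_lebesgue_integral_def)
  then show ?thesis using density_unique_real[of lborel h "\<lambda>_. 0"] h by simp
qed

text \<open>The fundamental lemma of the calculus of variations: test functions approximate indicators
  of open subsets of \<open>K\<close>.  The proof passes to a Borel representative of \<open>g\<close> because open sets
  generate only the Borel sets.\<close>

lemma fundamental_lemma:
  fixes g :: "point \<Rightarrow> real"
  assumes K: "open K" and g: "integrable (lebesgue_on K) g"
    and test: "\<And>\<psi>. test_function K \<psi> \<Longrightarrow> (LINT x|lebesgue_on K. \<psi> x * g x) = 0"
  shows "AE x in lebesgue_on K. g x = 0"
proof -
  define h where "h = (\<lambda>x. indicator K x *\<^sub>R g x)"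
  have Kl: "K \<inter> space lebesgue \<in> sets lebesgue" using K by auto
  have h: "integrable lebesgue h"
    using g unfolding h_def integrable_restrict_space[OF Kl] .
  obtain h' where h': "h' \<in> borel_measurable lborel" "AE x in lborel. h x = h' x"
    using completion_ex_borel_measurable_real[OF borel_measurable_integrable[OF h]] by blast
  have AEh: "AE x in lebesgue. h x = h' x" by (rule AE_completion[OF h'(2)])
  have h'm: "h' \<in> borel_measurable lebesgue" using h'(1) by (rule measurable_completion)
  have "integrable lebesgue h'"
    using h h'm AEh by (rule_tac integrable_cong_AE_imp[OF h]) auto
  then have ih': "integrable lborel h'" using h'(1) by (simp add: integrable_completion)
  have bounded_test: "(\<integral>x. \<psi> x * h' x \<partial>lborel) = 0" if \<psi>: "test_function K \<psi>" for \<psi>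
  proof -
    have cont: "continuous_on UNIV \<psi>" using \<psi> C1_continuous_on unfolding test_function_def by blast
    have [measurable]: "\<psi> \<in> borel_measurable borel" by (rule borel_measurable_continuous_onI[OF cont])
    have \<psi>l: "\<psi> \<in> borel_measurable lebesgue" by (rule measurable_completion) simp
    note [measurable] = h'(1)
    have "(\<integral>x. \<psi> x * h' x \<partial>lborel) = (\<integral>x. \<psi> x * h' x \<partial>lebesgue)"
      by (rule integral_completion[symmetric]) simp
    also have "\<dots> = (\<integral>x. indicator K x *\<^sub>R (\<psi> x * g x) \<partial>lebesgue)"
    proof (rule integral_cong_AE)
      show "(\<lambda>x. \<psi> x * h' x) \<in> borel_measurable lebesgue"
        by (rule borel_measurable_times[OF \<psi>l h'm])
      have "(\<lambda>x. \<psi> x * h x) \<in> borel_measurable lebesgue"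
        by (rule borel_measurable_times[OF \<psi>l borel_measurable_integrable[OF h]])
      then show "(\<lambda>x. indicator K x *\<^sub>R (\<psi> x * g x)) \<in> borel_measurable lebesgue"
        by (simp add: h_def algebra_simps)
      show "AE x in lebesgue. \<psi> x * h' x = indicator K x *\<^sub>R (\<psi> x * g x)"
        using AEh by eventually_elim (auto simp: h_def indicator_def split: if_splits)
    qed
    also have "\<dots> = (LINT x|lebesgue_on K. \<psi> x * g x)"
      by (rule integral_restrict_space[OF Kl, symmetric])
    also have "\<dots> = 0" by (rule test[OF \<psi>])
    finally show ?thesis .
  qed
  have "AE x in lborel. h' x = 0"
  proof (rule AE_zero_of_open_integrals[OF ih'])
    fix V :: "point set" assume V: "open V"
    obtain \<psi> where \<psi>: "\<And>n::nat. test_function (V \<inter> K) (\<psi> n)" "\<And>n x. 0 \<le> \<psi> n x \<and> \<psi> n x \<le> 1"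
      "\<And>x. (\<lambda>n. \<psi> n x) \<longlonglongrightarrow> indicator (V \<inter> K) x"
      by (rule indicator_limit_test_functions[OF open_Int[OF V K]]) (rule that)
    have \<psi>K: "test_function K (\<psi> n)" for n using test_function_subset[OF \<psi>(1)] by blast
    have cont: "continuous_on UNIV (\<psi> n)" for n
      using \<psi>K C1_continuous_on unfolding test_function_def by blast
    have [measurable]: "\<psi> n \<in> borel_measurable borel" for n
      by (rule borel_measurable_continuous_onI[OF cont])
    note [measurable] = h'(1)
    have [measurable]: "V \<in> sets borel" "K \<in> sets borel" using V K by auto
    have "(\<lambda>n. \<integral>x. \<psi> n x * h' x \<partial>lborel) \<longlonglongrightarrow> (\<integral>x. indicator (V \<inter> K) x * h' x \<partial>lborel)"
    proof (rule integral_dominated_convergence[where w = "\<lambda>x. norm (h' x)"])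
      show "AE x in lborel. (\<lambda>n. \<psi> n x * h' x) \<longlonglongrightarrow> indicator (V \<inter> K) x * h' x"
        by (intro AE_I2 tendsto_mult \<psi> tendsto_const)
      show "AE x in lborel. norm (\<psi> n x * h' x) \<le> norm (h' x)" for n
        using \<psi>(2)[of n] by (intro AE_I2) (auto simp: abs_mult intro!: mult_left_le_one_le)
    qed (use ih' in auto)
    then have "(\<integral>x. indicator (V \<inter> K) x * h' x \<partial>lborel) = 0"
      using bounded_test[OF \<psi>K] by (simp add: LIMSEQ_const_iff)
    moreover have "(\<integral>x. indicator V x *\<^sub>R h' x \<partial>lborel) = (\<integral>x. indicator (V \<inter> K) x * h' x \<partial>lborel)"
    proof (rule integral_cong_AE)
      show "AE x in lborel. indicator V x *\<^sub>R h' x = indicator (V \<inter> K) x * h' x"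
        using h'(2) by eventually_elim (auto simp: h_def indicator_def split: if_splits)
    qed measurable
    ultimately show "(\<integral>x. indicator V x *\<^sub>R h' x \<partial>lborel) = 0" by simp
  qed
  then have "AE x in lborel. h x = 0" using h'(2) by eventually_elim simp
  then have "AE x in lebesgue. h x = 0" by (rule AE_completion)
  then have "AE x in lebesgue. x \<in> K \<longrightarrow> g x = 0"
    by eventually_elim (auto simp: h_def)
  then show ?thesis by (subst AE_restrict_space_iff[OF Kl]) auto
qed

definition C2 :: "(point \<Rightarrow> real) \<Rightarrow> bool" where
  "C2 q \<longleftrightarrow> C1 q \<and> C1 (\<lambda>y. fst (grad q y)) \<and> C1 (\<lambda>y. snd (grad q y))"

lemma C2_imp_C1: "C2 q \<Longrightarrow> C1 q" by (simp add: C2_def)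

lemma H1_wgrad:
  assumes "H1 K u"
  shows "L2 K (wgrad K u)" "weak_gradient K u (wgrad K u)"
proof -
  have "\<exists>G. L2 K G \<and> weak_gradient K u G" using assms by (simp add: H1_def)
  then have "L2 K (wgrad K u) \<and> weak_gradient K u (wgrad K u)"
    unfolding wgrad_def by (rule someI_ex)
  then show "L2 K (wgrad K u)" "weak_gradient K u (wgrad K u)" by auto
qed

context polygon
begin

abbreviation "MK \<equiv> lebesgue_on K"

lemma sq_int_continuous_K: "continuous_on UNIV f \<Longrightarrow> sq_int MK f"
  for f :: "point \<Rightarrow> 'c::euclidean_space"
  by (rule sq_int_continuous[OF K_open K_bounded])

lemma sq_int_C1: "C1 f \<Longrightarrow> sq_int MK f" and sq_int_grad: "C1 f \<Longrightarrow> sq_int MK (grad f)"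
  by (auto intro!: sq_int_continuous_K C1_continuous_on C1_continuous_on_grad)

lemma finite_measure_K: "finite_measure MK"
  by (rule finite_measure_lebesgue_on_bounded[OF K_open K_bounded])

lemma weak_gradient_unique:
  assumes G: "sq_int MK G" "weak_gradient K u G" and H: "sq_int MK H" "weak_gradient K u H"
  shows "AE x in MK. G x = H x"
proof -
  have GH: "sq_int MK (\<lambda>x. G x - H x)" by (rule sq_int_diff[OF G(1) H(1)])
  have comp: "AE x in MK. (G x - H x) \<bullet> b = 0" for b
  proof (rule fundamental_lemma[OF K_open])
    have "integrable MK (\<lambda>x. G x - H x)" by (rule integrable_sq_int[OF GH finite_measure_K])
    then show "integrable MK (\<lambda>x. (G x - H x) \<bullet> b)" by simp
    fix \<psi> assume \<psi>: "test_function K \<psi>"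
    then have c: "continuous_on UNIV \<psi>" using C1_continuous_on unfolding test_function_def by blast
    have i: "integrable MK (\<lambda>x. \<psi> x *\<^sub>R F x)" if "sq_int MK F" for F :: "point \<Rightarrow> point"
      by (intro integrable_sq_int[OF _ finite_measure_K] sq_int_scaleR_continuous K_bounded c that)
    have "(LINT x|MK. \<psi> x * ((G x - H x) \<bullet> b)) = (LINT x|MK. (\<psi> x *\<^sub>R G x - \<psi> x *\<^sub>R H x) \<bullet> b)"
      by (simp add: inner_diff_left algebra_simps)
    also have "\<dots> = (LINT x|MK. \<psi> x *\<^sub>R G x - \<psi> x *\<^sub>R H x) \<bullet> b"
      by (rule integral_inner_left) (intro Bochner_Integration.integrable_diff i G H)
    also have "(LINT x|MK. \<psi> x *\<^sub>R G x - \<psi> x *\<^sub>R H x) = (LINT x|MK. \<psi> x *\<^sub>R G x) - (LINT x|MK. \<psi> x *\<^sub>R H x)"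
      by (rule Bochner_Integration.integral_diff[OF i[OF G(1)] i[OF H(1)]])
    also have "\<dots> = 0"
    proof -
      have "- (LINT x|MK. \<psi> x *\<^sub>R G x) = - (LINT x|MK. \<psi> x *\<^sub>R H x)"
        using G(2) H(2) \<psi> unfolding weak_gradient_def by metis
      then show ?thesis by simp
    qed
    finally show "(LINT x|MK. \<psi> x * ((G x - H x) \<bullet> b)) = 0" by simp
  qed
  show ?thesis using comp[of "(1, 0)"] comp[of "(0, 1)"]
    by eventually_elim (simp add: prod_eq_iff inner_prod_def)
qed

lemma wgrad_eq:
  assumes "L2 K u" "sq_int MK G" "weak_gradient K u G"
  shows "H1 K u" "AE x in MK. wgrad K u x = G x"
proof -
  show H: "H1 K u" using assms unfolding H1_def L2_iff_sq_int by blast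
  show "AE x in MK. wgrad K u x = G x"
    by (rule weak_gradient_unique[OF _ _ assms(2,3)]) (use H1_wgrad[OF H] in \<open>simp_all add: L2_iff_sq_int\<close>)
qed

lemma wlap_eq:
  assumes "weak_laplacian K u p"
  shows "sq_int MK (wlap K u)" "AE x in MK. wlap K u x = p x"
proof -
  have w: "weak_laplacian K u (wlap K u)" 
    unfolding wlap_def by (rule someI[of "weak_laplacian K u", OF assms])
  have sq: "sq_int MK p" "sq_int MK (wlap K u)"
    using w assms by (auto simp: weak_laplacian_def L2_iff_sq_int)
  then show "sq_int MK (wlap K u)" by simp
  have "AE x in MK. wlap K u x - p x = 0"
  proof (rule fundamental_lemma[OF K_open])
    show "integrable MK (\<lambda>x. wlap K u x - p x)"
      by (intro integrable_sq_int[OF _ finite_measure_K] sq_int_diff sq)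
    fix \<psi> assume \<psi>: "test_function K \<psi>"
    then have s: "sq_int MK \<psi>" using sq_int_C1 unfolding test_function_def by blast
    have "(LINT x|MK. \<psi> x * (wlap K u x - p x)) = (LINT x|MK. wlap K u x * \<psi> x - p x * \<psi> x)"
      by (simp add: algebra_simps)
    also have "\<dots> = (LINT x|MK. wlap K u x * \<psi> x) - (LINT x|MK. p x * \<psi> x)"
      by (intro Bochner_Integration.integral_diff integrable_mult_sq_int sq s)
    also have "\<dots> = 0"
    proof -
      have "- (LINT x|MK. wlap K u x * \<psi> x) = - (LINT x|MK. p x * \<psi> x)"
        using w assms \<psi> unfolding weak_laplacian_def by metis
      then show ?thesis by simp
    qed
    finally show "(LINT x|MK. \<psi> x * (wlap K u x - p x)) = 0" .
  qed
  then show "AE x in MK. wlap K u x = p x" by eventually_elim simp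
qed

section \<open>Green's formula for smooth functions\<close>

lemma test_function_frontier: "test_function K \<psi> \<Longrightarrow> x \<in> frontier K \<Longrightarrow> \<psi> x = 0"
proof -
  assume "test_function K \<psi>" "x \<in> frontier K"
  moreover from this have "x \<notin> K" using K_open by (simp add: frontier_def interior_open)
  ultimately show "\<psi> x = 0" unfolding test_function_def by blast
qed

lemma weak_gradient_C1:
  assumes f: "C1 f"
  shows "weak_gradient K f (grad f)"
  unfolding weak_gradient_def
proof (intro allI impI)
  fix \<psi> assume \<psi>: "test_function K \<psi>"
  then have C1: "C1 \<psi>" by (simp add: test_function_def)
  have i: "integrable MK (\<lambda>x. g x *\<^sub>R grad h x)" if "C1 g" "C1 h" for g h
    by (intro integrable_continuous_K continuous_intros C1_continuous_on C1_continuous_on_grad that)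
  have "((LINT x|MK. f x *\<^sub>R grad \<psi> x) + (LINT x|MK. \<psi> x *\<^sub>R grad f x)) \<bullet> a = 0" for a
  proof -
    have "((LINT x|MK. f x *\<^sub>R grad \<psi> x) + (LINT x|MK. \<psi> x *\<^sub>R grad f x)) \<bullet> a
        = (LINT x|MK. f x *\<^sub>R grad \<psi> x + \<psi> x *\<^sub>R grad f x) \<bullet> a"
      using i[OF f C1] i[OF C1 f] by simp
    also have "\<dots> = (LINT x|MK. (f x *\<^sub>R grad \<psi> x + \<psi> x *\<^sub>R grad f x) \<bullet> a)"
      by (rule integral_inner_left[symmetric]) (intro Bochner_Integration.integrable_add i f C1)
    also have "\<dots> = (LINT x|MK. grad (\<lambda>x. f x * \<psi> x) x \<bullet> a)" by (simp add: grad_mult[OF f C1])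
    also have "\<dots> = boundary_integral E (\<lambda>x. f x * \<psi> x * (outward_normal K E x \<bullet> a))"
      by (rule divergence_theorem[OF C1_mult[OF f C1]])
    also have "\<dots> = 0" by (rule boundary_integral_zero) (simp add: test_function_frontier[OF \<psi>])
    finally show ?thesis .
  qed
  then have "(LINT x|MK. f x *\<^sub>R grad \<psi> x) + (LINT x|MK. \<psi> x *\<^sub>R grad f x) = 0"
    using inner_eq_zero_iff by blast
  then show "(LINT x|MK. f x *\<^sub>R grad \<psi> x) = - (LINT x|MK. \<psi> x *\<^sub>R grad f x)"
    by (rule eq_neg_iff_add_eq_0[THEN iffD2])
qed

lemma H1_C1: "C1 f \<Longrightarrow> H1 K f"
  and wgrad_C1: "C1 f \<Longrightarrow> AE x in MK. wgrad K f x = grad f x"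
  using wgrad_eq[OF _ sq_int_grad weak_gradient_C1] sq_int_C1 by (auto simp: L2_iff_sq_int)

lemma green_C2:
  assumes q: "C2 q" and f: "C1 f"
  shows "(LINT x|MK. grad q x \<bullet> grad f x) + (LINT x|MK. laplacian q x * f x)
    = boundary_integral E (\<lambda>x. (grad q x \<bullet> outward_normal K E x) * f x)"
proof -
  let ?n = "outward_normal K E" and ?a = "(1, 0) :: point" and ?b = "(0, 1) :: point"
  define q1 q2 where "q1 = (\<lambda>y. fst (grad q y))" and "q2 = (\<lambda>y. snd (grad q y))"
  have C1q: "C1 q1" "C1 q2" using q by (simp_all add: C2_def q1_def q2_def)
  note C = C1_mult[OF f C1q(1)] C1_mult[OF f C1q(2)]
  have i: "integrable MK (\<lambda>x. grad g x \<bullet> d)" if "C1 g" for g d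
    by (intro integrable_continuous_K continuous_intros C1_continuous_on_grad that)
  have b: "integrable (lebesgue_on {0..1}) (\<lambda>t. g (\<gamma> t) * (?n (\<gamma> t) \<bullet> d) * norm (velocity \<gamma> t))"
    if "\<gamma> \<in> E" "C1 g" for \<gamma> g d
    by (rule integrable_normal_edge[OF C1_continuous_on[OF that(2)] that(1)])
  have lap: "laplacian q x = grad q1 x \<bullet> ?a + grad q2 x \<bullet> ?b" for x
    by (simp add: laplacian_def q1_def q2_def inner_prod_def)
  have eq: "grad q x \<bullet> grad f x + laplacian q x * f x
      = grad (\<lambda>x. f x * q1 x) x \<bullet> ?a + grad (\<lambda>x. f x * q2 x) x \<bullet> ?b" for x
    unfolding lap grad_mult[OF f C1q(1)] grad_mult[OF f C1q(2)]
    by (simp add: inner_prod_def q1_def q2_def algebra_simps)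
  have "integrable MK (\<lambda>x. grad q x \<bullet> grad f x)"
    by (intro integrable_continuous_K continuous_intros C1_continuous_on_grad f C2_imp_C1 q)
  moreover have "integrable MK (\<lambda>x. laplacian q x * f x)"
    unfolding lap by (intro integrable_continuous_K continuous_intros C1_continuous_on_grad C1q C1_continuous_on f)
  ultimately have "(LINT x|MK. grad q x \<bullet> grad f x) + (LINT x|MK. laplacian q x * f x)
      = (LINT x|MK. grad (\<lambda>x. f x * q1 x) x \<bullet> ?a + grad (\<lambda>x. f x * q2 x) x \<bullet> ?b)"
    by (simp only: eq[symmetric] Bochner_Integration.integral_add)
  also have "\<dots> = (LINT x|MK. grad (\<lambda>x. f x * q1 x) x \<bullet> ?a) + (LINT x|MK. grad (\<lambda>x. f x * q2 x) x \<bullet> ?b)"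
    by (rule Bochner_Integration.integral_add[OF i[OF C(1)] i[OF C(2)]])
  also have "\<dots> = boundary_integral E (\<lambda>x. f x * q1 x * (?n x \<bullet> ?a)) + boundary_integral E (\<lambda>x. f x * q2 x * (?n x \<bullet> ?b))"
    by (simp only: divergence_theorem[OF C(1)] divergence_theorem[OF C(2)])
  also have "\<dots> = boundary_integral E (\<lambda>x. f x * q1 x * (?n x \<bullet> ?a) + f x * q2 x * (?n x \<bullet> ?b))"
    by (rule boundary_integral_add[OF b b, symmetric]) (simp_all add: C)
  also have "\<dots> = boundary_integral E (\<lambda>x. (grad q x \<bullet> ?n x) * f x)"
    by (simp add: inner_prod_def q1_def q2_def algebra_simps)
  finally show ?thesis .
qed

text \<open>Uniqueness of the weak gradient is what identifies \<open>wgrad\<close> of a difference with the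
  difference of the gradients, since \<open>wgrad\<close> is an arbitrary choice among weak gradients.\<close>

lemma weak_laplacian_diff_C2:
  assumes v: "weak_laplacian K v p" and P: "C2 P" and lap: "\<forall>x\<in>K. laplacian P x = p x"
  shows "weak_laplacian K (\<lambda>x. v x - P x) (\<lambda>_. 0)"
    and "AE x in MK. wgrad K (\<lambda>x. v x - P x) x = wgrad K v x - grad P x"
proof -
  note C1 = C2_imp_C1[OF P]
  have H1v: "H1 K v" using v by (simp add: weak_laplacian_def)
  have sqv: "sq_int MK v" "sq_int MK (wgrad K v)"
    using H1v H1_wgrad(1)[OF H1v] by (simp_all add: H1_def L2_iff_sq_int)
  have sq: "sq_int MK (\<lambda>x. v x - P x)" "sq_int MK (\<lambda>x. wgrad K v x - grad P x)"
    by (intro sq_int_diff sqv sq_int_C1 sq_int_grad C1)+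
  have wg: "weak_gradient K (\<lambda>x. v x - P x) (\<lambda>x. wgrad K v x - grad P x)"
    unfolding weak_gradient_def
  proof (intro allI impI)
    fix \<psi> assume \<psi>: "test_function K \<psi>"
    then have C1\<psi>: "C1 \<psi>" by (simp add: test_function_def)
    have i1: "integrable MK (\<lambda>x. \<psi> x *\<^sub>R F x)" if "sq_int MK F" for F :: "point \<Rightarrow> point"
      by (intro integrable_sq_int[OF _ finite_measure_K] sq_int_scaleR_continuous K_bounded
          C1_continuous_on C1\<psi> that)
    have i2: "integrable MK (\<lambda>x. f x *\<^sub>R grad \<psi> x)" if "sq_int MK f" for f :: "point \<Rightarrow> real"
    proof -
      obtain B where B: "\<And>x. x \<in> K \<Longrightarrow> norm (grad \<psi> x) \<le> B"
        by (rule bounded_on_bounded_continuous[OF C1_continuous_on_grad[OF C1\<psi>] K_bounded]) (rule that)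
      show ?thesis
      proof (rule Bochner_Integration.integrable_bound)
        show "integrable MK (\<lambda>x. B * \<bar>f x\<bar>)"
          using integrable_sq_int[OF that finite_measure_K] by simp
        show "(\<lambda>x. f x *\<^sub>R grad \<psi> x) \<in> borel_measurable MK"
          by (intro borel_measurable_scaleR sq_int_measurable that sq_int_grad C1\<psi>)
        show "AE x in MK. norm (f x *\<^sub>R grad \<psi> x) \<le> norm (B * \<bar>f x\<bar>)"
        proof (rule AE_I2)
          fix x assume "x \<in> space MK"
          then have "norm (grad \<psi> x) \<le> \<bar>B\<bar>" using B[of x] by simp
          then show "norm (f x *\<^sub>R grad \<psi> x) \<le> norm (B * \<bar>f x\<bar>)"
            using mult_right_mono[of "norm (grad \<psi> x)" "\<bar>B\<bar>" "\<bar>f x\<bar>"] by (simp add: abs_mult mult.commute)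
        qed
      qed
    qed
    have "(LINT x|MK. (v x - P x) *\<^sub>R grad \<psi> x) = (LINT x|MK. v x *\<^sub>R grad \<psi> x - P x *\<^sub>R grad \<psi> x)"
      by (simp only: scaleR_diff_left)
    also have "\<dots> = (LINT x|MK. v x *\<^sub>R grad \<psi> x) - (LINT x|MK. P x *\<^sub>R grad \<psi> x)"
      by (intro Bochner_Integration.integral_diff i2 sqv sq_int_C1 C1)
    also have "\<dots> = - (LINT x|MK. \<psi> x *\<^sub>R wgrad K v x) - - (LINT x|MK. \<psi> x *\<^sub>R grad P x)"
      by (simp only: H1_wgrad(2)[OF H1v, unfolded weak_gradient_def, rule_format, OF \<psi>]
          weak_gradient_C1[OF C1, unfolded weak_gradient_def, rule_format, OF \<psi>])
    also have "\<dots> = - ((LINT x|MK. \<psi> x *\<^sub>R wgrad K v x) - (LINT x|MK. \<psi> x *\<^sub>R grad P x))" by simp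
    also have "(LINT x|MK. \<psi> x *\<^sub>R wgrad K v x) - (LINT x|MK. \<psi> x *\<^sub>R grad P x)
        = (LINT x|MK. \<psi> x *\<^sub>R wgrad K v x - \<psi> x *\<^sub>R grad P x)"
      by (intro Bochner_Integration.integral_diff[symmetric] i1 sqv sq_int_grad C1)
    finally show "(LINT x|MK. (v x - P x) *\<^sub>R grad \<psi> x) = - (LINT x|MK. \<psi> x *\<^sub>R (wgrad K v x - grad P x))"
      by (simp only: scaleR_diff_right)
  qed
  have H1: "H1 K (\<lambda>x. v x - P x)"
    and wgeq: "AE x in MK. wgrad K (\<lambda>x. v x - P x) x = wgrad K v x - grad P x"
    using wgrad_eq[OF _ sq(2) wg] sq(1) by (auto simp: L2_iff_sq_int)
  show "AE x in MK. wgrad K (\<lambda>x. v x - P x) x = wgrad K v x - grad P x" by (rule wgeq)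
  have sqw: "sq_int MK (wgrad K (\<lambda>x. v x - P x))" using H1_wgrad(1)[OF H1] by (simp add: L2_iff_sq_int)
  show "weak_laplacian K (\<lambda>x. v x - P x) (\<lambda>_. 0)"
    unfolding weak_laplacian_def
  proof (intro conjI allI impI H1)
    show "L2 K (\<lambda>_. 0 :: real)" by (simp add: L2_def)
    fix \<psi> assume \<psi>: "test_function K \<psi>"
    then have C1\<psi>: "C1 \<psi>" by (simp add: test_function_def)
    have "(LINT x|MK. wgrad K (\<lambda>x. v x - P x) x \<bullet> grad \<psi> x)
        = (LINT x|MK. wgrad K v x \<bullet> grad \<psi> x - grad P x \<bullet> grad \<psi> x)"
    proof (rule integral_cong_AE)
      show "AE x in MK. wgrad K (\<lambda>x. v x - P x) x \<bullet> grad \<psi> x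
          = wgrad K v x \<bullet> grad \<psi> x - grad P x \<bullet> grad \<psi> x"
        using wgeq by eventually_elim (simp add: inner_diff_left)
      show "(\<lambda>x. wgrad K (\<lambda>x. v x - P x) x \<bullet> grad \<psi> x) \<in> borel_measurable MK"
        by (intro borel_measurable_inner sq_int_measurable sqw sq_int_grad C1\<psi>)
      show "(\<lambda>x. wgrad K v x \<bullet> grad \<psi> x - grad P x \<bullet> grad \<psi> x) \<in> borel_measurable MK"
        by (intro borel_measurable_diff borel_measurable_inner sq_int_measurable sqv sq_int_grad C1\<psi> C1)
    qed
    also have "\<dots> = (LINT x|MK. wgrad K v x \<bullet> grad \<psi> x) - (LINT x|MK. grad P x \<bullet> grad \<psi> x)"
      by (intro Bochner_Integration.integral_diff integrable_inner_sq_int sqv sq_int_grad C1 C1\<psi>)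
    also have "(LINT x|MK. wgrad K v x \<bullet> grad \<psi> x) = - (LINT x|MK. p x * \<psi> x)"
      using v \<psi> unfolding weak_laplacian_def by blast
    also have "(LINT x|MK. grad P x \<bullet> grad \<psi> x) = - (LINT x|MK. laplacian P x * \<psi> x)"
    proof -
      have "boundary_integral E (\<lambda>x. (grad P x \<bullet> outward_normal K E x) * \<psi> x) = 0"
        by (rule boundary_integral_zero) (simp add: test_function_frontier[OF \<psi>])
      then show ?thesis using green_C2[OF P C1\<psi>] by simp
    qed
    also have "(LINT x|MK. laplacian P x * \<psi> x) = (LINT x|MK. p x * \<psi> x)"
      using lap by (intro Bochner_Integration.integral_cong) auto
    finally show "(LINT x|MK. wgrad K (\<lambda>x. v x - P x) x \<bullet> grad \<psi> x) = - (LINT x|MK. 0 * \<psi> x)" by simp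
  qed
qed

end

section \<open>Polynomials\<close>

lemma gradient_field_monomial:
  "gradient_field (\<lambda>x. c * fst x ^ i * snd x ^ k)
    (\<lambda>x. (c * real i * fst x ^ (i - 1) * snd x ^ k, c * real k * fst x ^ i * snd x ^ (k - 1)))"
  unfolding gradient_field_def
proof (intro conjI allI)
  fix x :: point
  have "((\<lambda>x::point. c * fst x ^ i * snd x ^ k) has_derivative
      (\<lambda>h. c * (real i * fst x ^ (i - 1) * fst h) * snd x ^ k + c * fst x ^ i * (real k * snd x ^ (k - 1) * snd h))) (at x)"
    by (auto intro!: derivative_eq_intros simp: algebra_simps)
  then show "((\<lambda>x::point. c * fst x ^ i * snd x ^ k) has_derivative
      (\<lambda>h. (c * real i * fst x ^ (i - 1) * snd x ^ k, c * real k * fst x ^ i * snd x ^ (k - 1)) \<bullet> h)) (at x)"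
    by (rule has_derivative_eq_rhs) (simp add: fun_eq_iff inner_prod_def algebra_simps)
qed (auto intro!: continuous_intros)

lemma C2_poly_space:
  assumes "p \<in> poly_space j"
  shows "C2 p"
proof -
  define I where "I = {(i::nat, k::nat). int i + int k \<le> j}"
  obtain c where c: "\<And>x y. p (x, y) = (\<Sum>(i, k)\<in>I. c i k * x ^ i * y ^ k)"
    using assms unfolding poly_space_def I_def by blast
  define m where "m = (\<lambda>(i, k) x. c i k * fst x ^ i * snd (x::point) ^ k)"
  define m1 where "m1 = (\<lambda>(i, k) x. (c i k * real i) * fst x ^ (i - 1) * snd (x::point) ^ k)"
  define m2 where "m2 = (\<lambda>(i, k) x. (c i k * real k) * fst x ^ i * snd (x::point) ^ (k - 1))"
  have C1m: "C1 (m1 s)" "C1 (m2 s)" for s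
    unfolding m1_def m2_def by (cases s; simp; rule gradient_fieldD(1)[OF gradient_field_monomial])+
  have gm: "gradient_field (m s) (\<lambda>x. (m1 s x, m2 s x))" for s
    unfolding m_def m1_def m2_def by (cases s) (simp add: gradient_field_monomial del: One_nat_def)
  have p: "p = (\<lambda>x. \<Sum>s\<in>I. m s x)"
    by (rule ext, rename_tac x, case_tac x) (simp add: c m_def case_prod_beta)
  have "gradient_field p (\<lambda>x. \<Sum>s\<in>I. (m1 s x, m2 s x))"
    unfolding p by (rule gradient_field_sum) (rule gm)
  moreover have "(\<lambda>x. \<Sum>s\<in>I. (m1 s x, m2 s x)) = (\<lambda>x. (\<Sum>s\<in>I. m1 s x, \<Sum>s\<in>I. m2 s x))"
    by (simp add: sum_prod)
  ultimately have "C1 p" "grad p = (\<lambda>x. (\<Sum>s\<in>I. m1 s x, \<Sum>s\<in>I. m2 s x))"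
    using gradient_fieldD by auto
  then show ?thesis unfolding C2_def by (simp add: C1_sum C1m)
qed

section \<open>Limits with vanishing trace\<close>

text \<open>The cut-off functions have to be \<open>C\<^sup>1\<close>, whereas the graph is only Lipschitz.  Averaging \<open>g\<close>
  over intervals of length \<open>w\<close> gives a \<open>C\<^sup>1\<close> function with the same Lipschitz constant, at distance
  at most \<open>L w\<close> from \<open>g\<close>.\<close>

lemma lipschitz_average:
  fixes g :: "real \<Rightarrow> real"
  assumes g: "L-lipschitz_on UNIV g" and \<delta>: "0 < \<delta>"
  obtains G G' where "\<And>s. (G has_real_derivative G' s) (at s)" "continuous_on UNIV G'"
    "\<And>s. \<bar>G s - g s\<bar> \<le> \<delta>" "\<And>s. \<bar>G' s\<bar> \<le> L"
proof -
  have L: "0 \<le> L" by (rule lipschitz_on_nonneg[OF g])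
  have cg: "continuous_on UNIV g" by (rule lipschitz_on_continuous_on[OF g])
  then have isc: "isCont g s" for s by (simp add: continuous_on_eq_continuous_at)
  obtain A where A: "\<And>s. (A has_vector_derivative g s) (at s)"
    using einterval_antiderivative[of "-\<infinity>" "\<infinity>" g] isc by auto
  have A': "(A has_real_derivative g s) (at s)" for s
    using A by (simp add: has_real_derivative_iff_has_vector_derivative)
  define w where "w = \<delta> / (L + 1)"
  have w: "0 < w" "L * w \<le> \<delta>" using \<delta> L by (auto simp: w_def field_simps)
  show ?thesis
  proof
    fix s
    have sh: "((\<lambda>s. A (s + w)) has_real_derivative g (s + w)) (at s)"
      using A'[of "s + w"] by (simp add: DERIV_shift)
    show "((\<lambda>s. (A (s + w) - A s) / w) has_real_derivative (g (s + w) - g s) / w) (at s)"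
      by (intro DERIV_cdivide DERIV_diff sh A')
    have lip: "\<bar>g x - g s\<bar> \<le> L * \<bar>x - s\<bar>" for x
      using lipschitz_onD[OF g, of x s] by (simp add: dist_real_def)
    obtain \<xi> where \<xi>: "s < \<xi>" "\<xi> < s + w" "A (s + w) - A s = (s + w - s) * g \<xi>"
      using MVT2[of s "s + w" A g] A' w by auto
    have "\<bar>(A (s + w) - A s) / w - g s\<bar> = \<bar>g \<xi> - g s\<bar>" using \<xi> w by simp
    also have "\<dots> \<le> L * \<bar>\<xi> - s\<bar>" by (rule lip)
    also have "\<dots> \<le> L * w" using \<xi> L by (intro mult_left_mono) auto
    finally show "\<bar>(A (s + w) - A s) / w - g s\<bar> \<le> \<delta>" using w by simp
    show "\<bar>(g (s + w) - g s) / w\<bar> \<le> L" using lip[of "s + w"] w by (simp add: abs_divide field_simps)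
  next
    show "continuous_on UNIV (\<lambda>s. (g (s + w) - g s) / w)"
      using w by (intro continuous_intros continuous_on_compose2[OF cg]) auto
  qed
qed

lemma smoothed_chart:
  assumes e: "norm e = 1" and g: "L-lipschitz_on UNIV g" and \<delta>: "0 < \<delta>"
  obtains k k' where "gradient_field k k'" "\<And>x. k' x \<bullet> e = 1" "\<And>x. norm (k' x) \<le> 1 + L"
    "\<And>x. \<bar>k x - ((x - z) \<bullet> e - g ((x - z) \<bullet> rot e))\<bar> \<le> \<delta>"
proof -
  obtain G G' where G: "\<And>s. (G has_real_derivative G' s) (at s)" "continuous_on UNIV G'"
    "\<And>s. \<bar>G s - g s\<bar> \<le> \<delta>" "\<And>s. \<bar>G' s\<bar> \<le> L"
    by (rule lipschitz_average[OF g \<delta>]) (rule that)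
  define k where "k = (\<lambda>x. (x - z) \<bullet> e - G ((x - z) \<bullet> rot e))"
  define k' where "k' = (\<lambda>x. e - G' ((x - z) \<bullet> rot e) *\<^sub>R rot e)"
  have o: "rot e \<bullet> e = 0" "e \<bullet> e = 1" "norm (rot e) = 1"
    using rot_orthonormal[OF e] by (auto simp: inner_commute norm_eq_1)
  show ?thesis
  proof
    show "gradient_field k k'" unfolding k_def k'_def
      by (intro gradient_field_diff gradient_field_inner gradient_field_compose G
          continuous_on_subset[OF G(2)]) simp
    show "k' x \<bullet> e = 1" for x by (simp add: k'_def inner_diff_left o)
    show "norm (k' x) \<le> 1 + L" for x
      unfolding k'_def using G(4)[of "(x - z) \<bullet> rot e"] e o
      by (intro norm_triangle_le_diff) simp
    show "\<bar>k x - ((x - z) \<bullet> e - g ((x - z) \<bullet> rot e))\<bar> \<le> \<delta>" for x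
      using G(3)[of "(x - z) \<bullet> rot e"] by (simp add: k_def abs_minus_commute)
  qed
qed

lemma tendsto_zero_of_double_bound:
  fixes a x y R :: "nat \<Rightarrow> real"
  assumes bound: "\<And>k n. (a n)\<^sup>2 \<le> C * (x n + y n * real (Suc k) + R k)"
    and "x \<longlonglongrightarrow> 0" "y \<longlonglongrightarrow> 0" "R \<longlonglongrightarrow> 0"
  shows "a \<longlonglongrightarrow> 0"
proof -
  have "\<exists>N. \<forall>n\<ge>N. (a n)\<^sup>2 < \<epsilon>" if "0 < \<epsilon>" for \<epsilon>
  proof -
    have "(\<lambda>k. C * R k) \<longlonglongrightarrow> C * 0" by (intro tendsto_intros assms)
    then have "\<forall>\<^sub>F k in sequentially. C * R k < \<epsilon> / 2"
      using \<open>0 < \<epsilon>\<close> by (intro order_tendstoD(2)[of _ "C * 0"]) auto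
    then obtain k where k: "C * R k < \<epsilon> / 2" by (auto simp: eventually_sequentially)
    have "(\<lambda>n. C * (x n + y n * real (Suc k))) \<longlonglongrightarrow> C * (0 + 0 * real (Suc k))"
      by (intro tendsto_intros assms)
    then have "\<forall>\<^sub>F n in sequentially. C * (x n + y n * real (Suc k)) < \<epsilon> / 2"
      using \<open>0 < \<epsilon>\<close> by (intro order_tendstoD(2)[of _ "C * (0 + 0 * real (Suc k))"]) auto
    then obtain N where N: "\<And>n. N \<le> n \<Longrightarrow> C * (x n + y n * real (Suc k)) < \<epsilon> / 2"
      by (auto simp: eventually_sequentially)
    have "(a n)\<^sup>2 < \<epsilon>" if "N \<le> n" for n
      using bound[of n k] N[OF that] k by (simp add: distrib_left)
    then show ?thesis by blast
  qed
  then have "(\<lambda>n. (a n)\<^sup>2) \<longlonglongrightarrow> 0" by (simp add: LIMSEQ_iff)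
  then have "(\<lambda>n. sqrt ((a n)\<^sup>2)) \<longlonglongrightarrow> sqrt 0" by (rule tendsto_real_sqrt)
  then show ?thesis by (simp add: tendsto_rabs_zero_iff)
qed

context polygon
begin

lemma integrable_edge:
  "continuous_on UNIV \<phi> \<Longrightarrow> \<gamma> \<in> E \<Longrightarrow>
    integrable (lebesgue_on {0..1}) (\<lambda>t. \<phi> (\<gamma> t) * norm (velocity \<gamma> t))"
  by (intro continuous_imp_integrable_real continuous_intros continuous_on_edge smooth_arcD(2) E_smooth)

lemma boundary_integral_mono:
  assumes "\<And>\<gamma>. \<gamma> \<in> E \<Longrightarrow> integrable (lebesgue_on {0..1}) (\<lambda>t. f (\<gamma> t) * norm (velocity \<gamma> t))"
    and "\<And>\<gamma>. \<gamma> \<in> E \<Longrightarrow> integrable (lebesgue_on {0..1}) (\<lambda>t. g (\<gamma> t) * norm (velocity \<gamma> t))"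
    and "\<And>\<gamma> t. \<gamma> \<in> E \<Longrightarrow> t \<in> {0<..<1} \<Longrightarrow> f (\<gamma> t) \<le> g (\<gamma> t)"
  shows "boundary_integral E f \<le> boundary_integral E g"
  unfolding boundary_integral_def
proof (rule sum_mono)
  fix \<gamma> assume \<gamma>: "\<gamma> \<in> E"
  show "(LINT t|lebesgue_on {0..1}. f (\<gamma> t) * norm (velocity \<gamma> t))
      \<le> (LINT t|lebesgue_on {0..1}. g (\<gamma> t) * norm (velocity \<gamma> t))"
  proof (rule integral_mono_AE)
    show "AE t in lebesgue_on {0..1}. f (\<gamma> t) * norm (velocity \<gamma> t) \<le> g (\<gamma> t) * norm (velocity \<gamma> t)"
      using AE_Icc_interior by eventually_elim (auto intro!: mult_right_mono assms(3) \<gamma>)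
  qed (use assms \<gamma> in auto)
qed

lemma boundary_integral_nonneg: "(\<And>x. 0 \<le> f x) \<Longrightarrow> 0 \<le> boundary_integral E f"
  unfolding boundary_integral_def by (intro sum_nonneg integral_nonneg_AE AE_I2) simp

text \<open>A Hardy-type inequality in the boundary layer \<open>{k < 4 \<delta>}\<close>, where \<open>k\<close> plays the role of the
  distance to \<open>\<partial>K\<close>: it comes from applying the divergence theorem to \<open>\<theta>\<^sup>2 W\<^sup>2\<close> with the weight
  \<open>W = max 0 (4 - k / \<delta>)\<close>, whose derivative along \<open>e\<close> is \<open>-1 / \<delta>\<close> in the layer.\<close>

lemma boundary_layer_inequality:
  assumes e: "norm e = 1" and \<delta>: "0 < \<delta>" and k: "gradient_field k k'" "\<And>x. k' x \<bullet> e = 1"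
    and low: "\<And>x. x \<in> U \<Longrightarrow> x \<in> closure K \<Longrightarrow> - \<delta> \<le> k x"
    and \<theta>: "test_function U \<theta>"
  shows "(LINT x|MK. (\<theta> x)\<^sup>2 * max 0 (4 - k x / \<delta>)) / \<delta>\<^sup>2
    \<le> 25 / \<delta> * boundary_integral E (\<lambda>x. (\<theta> x)\<^sup>2)
      + 125 * (LINT x|MK. min 1 (max 0 (5 - k x / \<delta>)) * (norm (grad \<theta> x))\<^sup>2)"
proof -
  let ?n = "outward_normal K E"
  define W where "W = (\<lambda>x. max 0 (4 - k x / \<delta>))"
  define \<omega> where "\<omega> = (\<lambda>x. min 1 (max 0 (5 - k x / \<delta>)))"
  have C1: "C1 \<theta>" using \<theta> by (simp add: test_function_def)
  have \<theta>0: "\<theta> x = 0" "grad \<theta> x = 0" if "x \<notin> U" for x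
    using \<theta> that test_function_grad_eq_0[OF \<theta> that] unfolding test_function_def by blast+
  have ck: "continuous_on UNIV k" by (rule gradient_field_imp_continuous[OF k(1)])
  have cW: "continuous_on UNIV W" "continuous_on UNIV \<omega>"
    unfolding W_def \<omega>_def using \<delta> by (intro continuous_intros ck; simp)+
  have c\<theta>: "continuous_on UNIV \<theta>" "continuous_on UNIV (grad \<theta>)"
    by (intro C1_continuous_on C1_continuous_on_grad C1)+
  have Wnn: "0 \<le> W x" for x by (simp add: W_def)
  \<comment> \<open>\<open>k\<close> may be as small as \<open>-\<delta>\<close> on the closure of \<open>K\<close>; the constants 25 and 125 are \<open>5\<^sup>2\<close> and \<open>5\<^sup>3\<close>\<close>
  have W5: "W x \<le> 5" if "x \<in> U" "x \<in> closure K" for x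
    using low[OF that] \<delta> by (simp add: W_def field_simps)
  have gk: "gradient_field (\<lambda>x. 4 - k x / \<delta>) (\<lambda>x. - (1 / \<delta>) *\<^sub>R k' x)"
  proof -
    have "gradient_field (\<lambda>x. 4 - (1 / \<delta>) * k x) (\<lambda>x. 0 - ((1 / \<delta>) *\<^sub>R k' x + k x *\<^sub>R 0))"
      by (intro gradient_field_diff gradient_field_mult gradient_field_const k)
    then show ?thesis by simp
  qed
  have gW: "gradient_field (\<lambda>x. (W x)\<^sup>2) (\<lambda>x. (2 * W x) *\<^sub>R (- (1 / \<delta>) *\<^sub>R k' x))"
    unfolding W_def by (rule gradient_field_max0_sq[OF gk])
  define \<phi> where "\<phi> = (\<lambda>x. \<theta> x * \<theta> x * (W x)\<^sup>2)"
  have g\<phi>: "gradient_field \<phi> (\<lambda>x. (\<theta> x * \<theta> x) *\<^sub>R ((2 * W x) *\<^sub>R (- (1 / \<delta>) *\<^sub>R k' x))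
      + (W x)\<^sup>2 *\<^sub>R (\<theta> x *\<^sub>R grad \<theta> x + \<theta> x *\<^sub>R grad \<theta> x))"
    unfolding \<phi>_def by (intro gradient_field_mult C1_gradient_field C1 gW)
  have C1\<phi>: "C1 \<phi>" by (rule gradient_fieldD(1)[OF g\<phi>])
  have grad\<phi>: "grad \<phi> x \<bullet> e = 2 * \<theta> x * (grad \<theta> x \<bullet> e) * (W x)\<^sup>2 - 2 / \<delta> * ((\<theta> x)\<^sup>2 * W x)" for x
    unfolding gradient_fieldD(2)[OF g\<phi>] by (simp add: inner_add_left k power2_eq_square algebra_simps)
  have pw: "grad \<phi> x \<bullet> e \<le> 125 * \<delta> * (\<omega> x * (norm (grad \<theta> x))\<^sup>2) - 1 / \<delta> * ((\<theta> x)\<^sup>2 * W x)"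
    if x: "x \<in> K" for x
  proof (cases "x \<in> U \<and> 0 < W x")
    case True
    have xc: "x \<in> closure K" using x closure_subset by blast
    have w: "0 < W x" "W x \<le> 5" using True W5[OF _ xc] by auto
    have \<omega>1: "\<omega> x = 1" using w unfolding W_def \<omega>_def by auto
    define q where "q = grad \<theta> x \<bullet> e"
    have q2: "q\<^sup>2 \<le> (norm (grad \<theta> x))\<^sup>2"
      using Cauchy_Schwarz_ineq2[of "grad \<theta> x" e] e unfolding q_def
      by (intro abs_le_square_iff[THEN iffD1]) simp
    \<comment> \<open>completing the square, at the expense of half of the good term \<open>-2 \<theta>\<^sup>2 W / \<delta>\<close>\<close>
    have "0 \<le> (\<theta> x / \<delta> - q * W x)\<^sup>2 * (\<delta> * W x)" using w \<delta> by simp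
    also have "\<dots> = (\<theta> x)\<^sup>2 * W x / \<delta> - 2 * \<theta> x * q * (W x)\<^sup>2 + \<delta> * (W x)^3 * q\<^sup>2"
      using \<delta> by (simp add: power2_eq_square power3_eq_cube field_simps)
    finally have 1: "2 * \<theta> x * q * (W x)\<^sup>2 \<le> (\<theta> x)\<^sup>2 * W x / \<delta> + \<delta> * (W x)^3 * q\<^sup>2" by simp
    have "(W x)^3 \<le> 5^3" using w by (intro power_mono) auto
    then have "(W x)^3 * q\<^sup>2 \<le> 125 * (norm (grad \<theta> x))\<^sup>2"
      using q2 w by (intro mult_mono) auto
    then have "\<delta> * ((W x)^3 * q\<^sup>2) \<le> \<delta> * (125 * (norm (grad \<theta> x))\<^sup>2)" using \<delta> by (intro mult_left_mono) auto
    with 1 show ?thesis unfolding grad\<phi> \<omega>1 q_def[symmetric] by (simp add: field_simps)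
  next
    case False
    then have "\<theta> x = 0 \<or> W x = 0" "grad \<theta> x = 0 \<or> W x = 0" using \<theta>0[of x] Wnn[of x] by auto
    then show ?thesis unfolding grad\<phi> using \<delta> by (auto simp: \<omega>_def)
  qed
  have i1: "integrable MK (\<lambda>x. \<omega> x * (norm (grad \<theta> x))\<^sup>2)"
    and i2: "integrable MK (\<lambda>x. (\<theta> x)\<^sup>2 * W x)"
    and i3: "integrable MK (\<lambda>x. grad \<phi> x \<bullet> e)"
    by (intro integrable_continuous_K continuous_intros cW c\<theta> C1_continuous_on_grad[OF C1\<phi>])+
  have "(LINT x|MK. grad \<phi> x \<bullet> e)
      \<le> (LINT x|MK. 125 * \<delta> * (\<omega> x * (norm (grad \<theta> x))\<^sup>2) - 1 / \<delta> * ((\<theta> x)\<^sup>2 * W x))"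
    using i1 i2 i3 pw by (intro integral_mono) auto
  also have "\<dots> = 125 * \<delta> * (LINT x|MK. \<omega> x * (norm (grad \<theta> x))\<^sup>2) - 1 / \<delta> * (LINT x|MK. (\<theta> x)\<^sup>2 * W x)"
    using i1 i2 by simp
  finally have up: "(LINT x|MK. grad \<phi> x \<bullet> e) \<le>
      125 * \<delta> * (LINT x|MK. \<omega> x * (norm (grad \<theta> x))\<^sup>2) - 1 / \<delta> * (LINT x|MK. (\<theta> x)\<^sup>2 * W x)" .
  have "- 25 * boundary_integral E (\<lambda>x. (\<theta> x)\<^sup>2) = boundary_integral E (\<lambda>x. - 25 * (\<theta> x)\<^sup>2)"
    by (rule boundary_integral_cmult[symmetric])
  also have "\<dots> \<le> boundary_integral E (\<lambda>x. \<phi> x * (?n x \<bullet> e))"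
  proof (rule boundary_integral_mono)
    fix \<gamma> assume \<gamma>: "\<gamma> \<in> E"
    show "integrable (lebesgue_on {0..1}) (\<lambda>t. - 25 * (\<theta> (\<gamma> t))\<^sup>2 * norm (velocity \<gamma> t))"
      by (rule integrable_edge[OF _ \<gamma>, of "\<lambda>x. - 25 * (\<theta> x)\<^sup>2"]) (intro continuous_intros c\<theta>)
    show "integrable (lebesgue_on {0..1}) (\<lambda>t. \<phi> (\<gamma> t) * (?n (\<gamma> t) \<bullet> e) * norm (velocity \<gamma> t))"
      by (rule integrable_normal_edge[OF C1_continuous_on[OF C1\<phi>] \<gamma>])
    fix t :: real assume t: "t \<in> {0<..<1}"
    show "- 25 * (\<theta> (\<gamma> t))\<^sup>2 \<le> \<phi> (\<gamma> t) * (?n (\<gamma> t) \<bullet> e)"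
    proof (cases "\<gamma> t \<in> U")
      case True
      have "\<gamma> t \<in> closure K" using edge_in_frontier[OF \<gamma>, of t] t by (auto simp: frontier_def)
      then have "(W (\<gamma> t))\<^sup>2 \<le> 5\<^sup>2" using W5[OF True] Wnn by (intro power_mono) auto
      moreover have "\<bar>?n (\<gamma> t) \<bullet> e\<bar> \<le> 1"
        using Cauchy_Schwarz_ineq2[of "?n (\<gamma> t)" e] norm_outward_normal[OF \<gamma> t] e by simp
      ultimately have "(W (\<gamma> t))\<^sup>2 * \<bar>?n (\<gamma> t) \<bullet> e\<bar> \<le> 5\<^sup>2 * 1" by (intro mult_mono) auto
      then have "(\<theta> (\<gamma> t))\<^sup>2 * ((W (\<gamma> t))\<^sup>2 * \<bar>?n (\<gamma> t) \<bullet> e\<bar>) \<le> (\<theta> (\<gamma> t))\<^sup>2 * 25"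
        by (intro mult_left_mono) auto
      then have "\<bar>\<phi> (\<gamma> t) * (?n (\<gamma> t) \<bullet> e)\<bar> \<le> 25 * (\<theta> (\<gamma> t))\<^sup>2"
        by (simp add: \<phi>_def abs_mult power2_eq_square algebra_simps)
      then show ?thesis by (simp add: abs_le_iff)
    qed (simp add: \<phi>_def \<theta>0)
  qed
  also have "\<dots> = (LINT x|MK. grad \<phi> x \<bullet> e)" by (rule divergence_theorem[OF C1\<phi>, symmetric])
  finally have "1 / \<delta> * (LINT x|MK. (\<theta> x)\<^sup>2 * W x) \<le> 25 * boundary_integral E (\<lambda>x. (\<theta> x)\<^sup>2)
      + 125 * \<delta> * (LINT x|MK. \<omega> x * (norm (grad \<theta> x))\<^sup>2)"
    using up by linarith
  then have "1 / \<delta> * (1 / \<delta> * (LINT x|MK. (\<theta> x)\<^sup>2 * W x)) \<le> 1 / \<delta> * (25 * boundary_integral E (\<lambda>x. (\<theta> x)\<^sup>2)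
      + 125 * \<delta> * (LINT x|MK. \<omega> x * (norm (grad \<theta> x))\<^sup>2))"
    using \<delta> by (intro mult_left_mono) auto
  moreover have "max 0 (4 - k x / \<delta>) = W x" "min 1 (max 0 (5 - k x / \<delta>)) = \<omega> x" for x
    by (simp_all add: W_def \<omega>_def)
  ultimately show ?thesis
    using \<delta> by (simp only:) (simp add: field_simps power2_eq_square)
qed

definition weak_form :: "(point \<Rightarrow> real) \<Rightarrow> (point \<Rightarrow> real) \<Rightarrow> (point \<Rightarrow> real) \<Rightarrow> real" where
  "weak_form u p \<theta> = (LINT x|MK. wgrad K u x \<bullet> grad \<theta> x) + (LINT x|MK. p x * \<theta> x)"

lemma weak_laplacianD:
  assumes "weak_laplacian K u p"
  shows "H1 K u" "sq_int MK (wgrad K u)" "sq_int MK p"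
  using assms H1_wgrad(1) unfolding weak_laplacian_def by (auto simp: L2_iff_sq_int)

lemma weak_form_test: "weak_laplacian K u p \<Longrightarrow> test_function K \<psi> \<Longrightarrow> weak_form u p \<psi> = 0"
  unfolding weak_form_def weak_laplacian_def by simp

lemma weak_form_add:
  assumes u: "weak_laplacian K u p" and C1: "C1 f" "C1 g"
  shows "weak_form u p (\<lambda>x. f x + g x) = weak_form u p f + weak_form u p g"
proof -
  note w = weak_laplacianD[OF u]
  have i: "integrable MK (\<lambda>x. wgrad K u x \<bullet> grad f x)" "integrable MK (\<lambda>x. p x * f x)" if "C1 f" for f
    by (intro integrable_inner_sq_int integrable_mult_sq_int w sq_int_C1 sq_int_grad that)+
  show ?thesis
    unfolding weak_form_def using i[OF C1(1)] i[OF C1(2)]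
    by (simp add: grad_add[OF C1] inner_add_right distrib_left)
qed

text \<open>Only the part \<open>\<theta> \<kappa>\<close> of \<open>\<theta>\<close> in the boundary layer contributes to the weak form, because
  \<open>\<theta> (1 - \<kappa>)\<close> is a test function.  The cut-off \<open>\<kappa>\<close> equals 1 for \<open>k \<le> 2 \<delta>\<close> and 0 for \<open>k \<ge> 3 \<delta>\<close>, and its
  gradient of order \<open>1 / \<delta>\<close> is compensated by the Hardy-type inequality.\<close>

lemma weak_form_boundary_layer:
  assumes u: "weak_laplacian K u p"
    and e: "norm e = 1" and \<delta>: "0 < \<delta>" "\<delta> \<le> 1" and k: "gradient_field k k'" "\<And>x. k' x \<bullet> e = 1"
    and M: "\<And>x. norm (k' x) \<le> M"
    and low: "\<And>x. x \<in> U \<Longrightarrow> x \<in> closure K \<Longrightarrow> - \<delta> \<le> k x"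
    and inside: "\<And>x. x \<in> U \<Longrightarrow> 2 * \<delta> \<le> k x \<Longrightarrow> x \<in> K"
    and \<theta>: "test_function U \<theta>"
  shows "(weak_form u p \<theta>)\<^sup>2
    \<le> (sqrt (LINT x|MK. (norm (wgrad K u x))\<^sup>2) + sqrt (LINT x|MK. (norm (p x))\<^sup>2))\<^sup>2 * (4127 * (1 + M\<^sup>2))
      * ((LINT x|MK. min 1 (max 0 (5 - k x / \<delta>)) * (norm (grad \<theta> x))\<^sup>2)
        + boundary_integral E (\<lambda>x. (\<theta> x)\<^sup>2) / \<delta>)"
proof -
  define W where "W = (\<lambda>x. max 0 (4 - k x / \<delta>))"
  define \<omega> where "\<omega> = (\<lambda>x. min 1 (max 0 (5 - k x / \<delta>)))"
  define \<kappa>1 where "\<kappa>1 = (\<lambda>x. max 0 (k x / \<delta> - 2))"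
  define \<kappa>2 where "\<kappa>2 = (\<lambda>x. max 0 (1 - (\<kappa>1 x)\<^sup>2))"
  define \<kappa> where "\<kappa> = (\<lambda>x. (\<kappa>2 x)\<^sup>2)"
  define \<kappa>' where "\<kappa>' = (\<lambda>x. (2 * \<kappa>2 x) *\<^sub>R (- ((2 * \<kappa>1 x) *\<^sub>R ((1 / \<delta>) *\<^sub>R k' x))))"
  have C1: "C1 \<theta>" using \<theta> by (simp add: test_function_def)
  have ck: "continuous_on UNIV k" by (rule gradient_field_imp_continuous[OF k(1)])
  have cW: "continuous_on UNIV W" "continuous_on UNIV \<omega>"
    unfolding W_def \<omega>_def using \<delta> by (intro continuous_intros ck; simp)+
  have c\<theta>: "continuous_on UNIV \<theta>" "continuous_on UNIV (grad \<theta>)"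
    by (intro C1_continuous_on C1_continuous_on_grad C1)+
  have g\<kappa>: "gradient_field \<kappa> \<kappa>'"
  proof -
    have "gradient_field (\<lambda>x. (1 / \<delta>) * k x - 2) (\<lambda>x. ((1 / \<delta>) *\<^sub>R k' x + k x *\<^sub>R 0) - 0)"
      by (intro gradient_field_diff gradient_field_mult gradient_field_const k)
    then have "gradient_field (\<lambda>x. k x / \<delta> - 2) (\<lambda>x. (1 / \<delta>) *\<^sub>R k' x)" by simp
    then have "gradient_field (\<lambda>x. (\<kappa>1 x)\<^sup>2) (\<lambda>x. (2 * \<kappa>1 x) *\<^sub>R ((1 / \<delta>) *\<^sub>R k' x))"
      unfolding \<kappa>1_def by (rule gradient_field_max0_sq)
    then have "gradient_field (\<lambda>x. 1 - (\<kappa>1 x)\<^sup>2) (\<lambda>x. 0 - (2 * \<kappa>1 x) *\<^sub>R ((1 / \<delta>) *\<^sub>R k' x))"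
      by (rule gradient_field_diff[OF gradient_field_const])
    from gradient_field_max0_sq[OF this] show ?thesis
      unfolding \<kappa>_def \<kappa>2_def \<kappa>'_def by simp
  qed
  have C1\<kappa>: "C1 \<kappa>" and grad\<kappa>: "grad \<kappa> = \<kappa>'" using gradient_fieldD[OF g\<kappa>] by auto
  have \<kappa>1nn: "0 \<le> \<kappa>1 x" and \<kappa>2nn: "0 \<le> \<kappa>2 x" and \<kappa>21: "\<kappa>2 x \<le> 1" for x
    by (simp_all add: \<kappa>1_def \<kappa>2_def)
  have \<kappa>01: "0 \<le> \<kappa> x" "\<kappa> x \<le> 1" for x
    using \<kappa>2nn[of x] \<kappa>21[of x] by (auto simp: \<kappa>_def power_le_one)
  have \<kappa>one: "\<kappa> x = 1" if "k x < 2 * \<delta>" for x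
  proof -
    have "k x / \<delta> < 2" using that \<delta> by (simp add: field_simps)
    then show ?thesis by (simp add: \<kappa>_def \<kappa>2_def \<kappa>1_def)
  qed
  have layer: "\<kappa>1 x \<le> 1" "1 \<le> W x" "\<omega> x = 1" if "\<kappa>2 x \<noteq> 0" for x
  proof -
    have "(\<kappa>1 x)\<^sup>2 < 1" using that by (auto simp: \<kappa>2_def max_def split: if_splits)
    then have k1: "\<kappa>1 x < 1" using \<kappa>1nn[of x] by (simp add: abs_square_less_1[of "\<kappa>1 x", simplified])
    then show "\<kappa>1 x \<le> 1" by simp
    have "k x / \<delta> < 3" using k1 by (simp add: \<kappa>1_def)
    then show "1 \<le> W x" "\<omega> x = 1" by (auto simp: W_def \<omega>_def)
  qed
  have Wnn: "0 \<le> W x" and \<omega>nn: "0 \<le> \<omega> x" for x by (auto simp: W_def \<omega>_def)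
  have M0: "0 \<le> M" using M[of 0] norm_ge_zero order_trans by blast
  have \<kappa>'bd: "norm (\<kappa>' x) \<le> 4 * M / \<delta>" for x
  proof (cases "\<kappa>2 x = 0")
    case False
    have "norm (\<kappa>' x) = 4 * (\<kappa>2 x * \<kappa>1 x) * (norm (k' x) / \<delta>)"
      using \<kappa>1nn[of x] \<kappa>2nn[of x] \<delta> by (simp add: \<kappa>'_def)
    also have "\<dots> \<le> 4 * (1 * 1) * (M / \<delta>)"
      using \<kappa>1nn[of x] \<kappa>2nn[of x] \<kappa>21[of x] layer(1)[OF False] \<delta> M[of x] M0
      by (intro mult_mono divide_right_mono) auto
    finally show ?thesis by simp
  qed (use M0 \<delta> in \<open>simp add: \<kappa>'_def\<close>)
  define \<theta>1 where "\<theta>1 = (\<lambda>x. \<theta> x * \<kappa> x)"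
  have C1\<theta>1: "C1 \<theta>1" unfolding \<theta>1_def by (rule C1_mult[OF C1 C1\<kappa>])
  have "test_function K (\<lambda>x. \<theta> x * (1 - \<kappa> x))"
  proof -
    obtain C where C: "compact C" "C \<subseteq> U" "\<forall>x. x \<notin> C \<longrightarrow> \<theta> x = 0"
      using \<theta> unfolding test_function_def by blast
    have "closed {x. 2 * \<delta> \<le> k x}"
      by (intro closed_Collect_le continuous_on_const ck)
    then have "compact (C \<inter> {x. 2 * \<delta> \<le> k x})" by (intro compact_Int_closed C)
    moreover have "C \<inter> {x. 2 * \<delta> \<le> k x} \<subseteq> K" using C(2) inside by blast
    moreover have "\<theta> x * (1 - \<kappa> x) = 0" if "x \<notin> C \<inter> {x. 2 * \<delta> \<le> k x}" for x
    proof (cases "x \<in> C")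
      case True
      then have "\<kappa> x = 1" using that by (intro \<kappa>one) auto
      then show ?thesis by simp
    next
      case False
      then have "\<theta> x = 0" using C(3) by blast
      then show ?thesis by simp
    qed
    moreover have "C1 (\<lambda>x. \<theta> x * (1 - \<kappa> x))" by (intro C1_mult C1_diff C1_const C1 C1\<kappa>)
    ultimately show ?thesis unfolding test_function_def by blast
  qed
  from weak_form_test[OF u this]
  have "weak_form u p (\<lambda>x. \<theta> x * (1 - \<kappa> x) + \<theta>1 x) = weak_form u p \<theta>1"
    by (subst weak_form_add[OF u]) (auto intro!: C1_mult C1_diff C1_const C1 C1\<kappa> C1\<theta>1)
  then have wf: "weak_form u p \<theta> = weak_form u p \<theta>1"
    by (simp add: \<theta>1_def algebra_simps)
  define a where "a = sqrt (LINT x|MK. (norm (wgrad K u x))\<^sup>2)"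
  define b where "b = sqrt (LINT x|MK. (norm (p x))\<^sup>2)"
  define D where "D = (LINT x|MK. \<omega> x * (norm (grad \<theta> x))\<^sup>2)"
  define B where "B = boundary_integral E (\<lambda>x. (\<theta> x)\<^sup>2)"
  define X where "X = (LINT x|MK. (\<theta> x)\<^sup>2 * W x)"
  define Y where "Y = B / \<delta>"
  \<comment> \<open>\<open>4127 = 2 + 32 * 125 + 125\<close> dominates the coefficients in both estimates below\<close>
  define N where "N = 4127 * (1 + M\<^sup>2) * (D + Y)"
  have B0: "0 \<le> B" unfolding B_def by (rule boundary_integral_nonneg) simp
  have D0: "0 \<le> D" unfolding D_def using \<omega>nn by (intro integral_nonneg_AE AE_I2) simp
  have X0: "0 \<le> X" unfolding X_def using Wnn by (intro integral_nonneg_AE AE_I2) simp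
  have hardy: "X / \<delta>\<^sup>2 \<le> 25 * Y + 125 * D"
    using boundary_layer_inequality[OF e \<delta>(1) k low \<theta>]
    unfolding X_def Y_def B_def D_def W_def \<omega>_def by simp
  have Y0: "0 \<le> Y" using B0 \<delta> by (simp add: Y_def)
  have MY: "0 \<le> M\<^sup>2 * Y" "0 \<le> M\<^sup>2 * D"
    by (intro mult_nonneg_nonneg zero_le_power2 Y0 D0)+
  have iD: "integrable MK (\<lambda>x. \<omega> x * (norm (grad \<theta> x))\<^sup>2)"
    and iX: "integrable MK (\<lambda>x. (\<theta> x)\<^sup>2 * W x)"
    and i\<theta>1: "integrable MK (\<lambda>x. (norm (grad \<theta>1 x))\<^sup>2)" "integrable MK (\<lambda>x. (norm (\<theta>1 x))\<^sup>2)"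
    by (intro integrable_continuous_K continuous_intros cW c\<theta> C1_continuous_on_grad[OF C1\<theta>1]
        C1_continuous_on[OF C1\<theta>1])+
  have grad1: "(norm (grad \<theta>1 x))\<^sup>2 \<le> 2 * (\<omega> x * (norm (grad \<theta> x))\<^sup>2) + 32 * M\<^sup>2 / \<delta>\<^sup>2 * ((\<theta> x)\<^sup>2 * W x)" for x
  proof (cases "\<kappa>2 x = 0")
    case True
    then have "grad \<theta>1 x = 0"
      unfolding \<theta>1_def grad_mult[OF C1 C1\<kappa>] grad\<kappa> by (simp add: \<kappa>_def \<kappa>'_def)
    then show ?thesis using \<omega>nn[of x] Wnn[of x] by simp
  next
    case False
    note l = layer[OF False]
    have "(norm (grad \<theta>1 x))\<^sup>2 = (norm (\<kappa> x *\<^sub>R grad \<theta> x - (- \<theta> x) *\<^sub>R \<kappa>' x))\<^sup>2"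
      unfolding \<theta>1_def grad_mult[OF C1 C1\<kappa>] grad\<kappa> by (simp add: add.commute)
    also have "\<dots> \<le> 2 * (norm (\<kappa> x *\<^sub>R grad \<theta> x))\<^sup>2 + 2 * (norm ((- \<theta> x) *\<^sub>R \<kappa>' x))\<^sup>2"
      by (rule norm_diff_sq_le)
    also have "\<dots> = 2 * ((\<kappa> x)\<^sup>2 * (norm (grad \<theta> x))\<^sup>2) + 2 * ((\<theta> x)\<^sup>2 * (norm (\<kappa>' x))\<^sup>2)"
      by (simp add: power_mult_distrib)
    also have "\<dots> \<le> 2 * (1 * (norm (grad \<theta> x))\<^sup>2) + 2 * ((\<theta> x)\<^sup>2 * ((4 * M / \<delta>)\<^sup>2 * W x))"
    proof (intro add_mono mult_left_mono mult_right_mono)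
      show "(\<kappa> x)\<^sup>2 \<le> 1" using \<kappa>01[of x] by (simp add: power_le_one)
      have "(norm (\<kappa>' x))\<^sup>2 \<le> (4 * M / \<delta>)\<^sup>2" by (intro power_mono \<kappa>'bd) simp
      also have "\<dots> \<le> (4 * M / \<delta>)\<^sup>2 * W x" using l(2) mult_left_mono[of 1 "W x" "(4 * M / \<delta>)\<^sup>2"] by simp
      finally show "(norm (\<kappa>' x))\<^sup>2 \<le> (4 * M / \<delta>)\<^sup>2 * W x" .
    qed auto
    finally show ?thesis using l(3) \<delta> by (simp add: power_divide power_mult_distrib field_simps)
  qed
  have val1: "(norm (\<theta>1 x))\<^sup>2 \<le> (\<theta> x)\<^sup>2 * W x" for x
  proof (cases "\<kappa>2 x = 0")
    case True
    then show ?thesis using Wnn[of x] by (simp add: \<theta>1_def \<kappa>_def)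
  next
    case False
    have "(\<kappa> x)\<^sup>2 \<le> 1" using \<kappa>01[of x] by (simp add: power_le_one)
    then have "(\<kappa> x)\<^sup>2 \<le> W x" using layer(2)[OF False] by simp
    then show ?thesis by (simp add: \<theta>1_def power_mult_distrib mult_left_mono)
  qed
  have "(LINT x|MK. (norm (grad \<theta>1 x))\<^sup>2)
      \<le> (LINT x|MK. 2 * (\<omega> x * (norm (grad \<theta> x))\<^sup>2) + 32 * M\<^sup>2 / \<delta>\<^sup>2 * ((\<theta> x)\<^sup>2 * W x))"
    using iD iX i\<theta>1 grad1 by (intro integral_mono) auto
  also have "\<dots> = 2 * D + 32 * M\<^sup>2 * (X / \<delta>\<^sup>2)"
    using iD iX by (simp add: D_def X_def)
  also have "\<dots> \<le> 2 * D + 32 * M\<^sup>2 * (25 * Y + 125 * D)"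
    using hardy by (intro add_left_mono mult_left_mono) auto
  also have "\<dots> \<le> N"
    using MY Y0 D0 unfolding N_def by (simp add: algebra_simps)
  finally have n1: "(LINT x|MK. (norm (grad \<theta>1 x))\<^sup>2) \<le> N" .
  have "(LINT x|MK. (norm (\<theta>1 x))\<^sup>2) \<le> X" unfolding X_def
    using iX i\<theta>1 val1 by (intro integral_mono) auto
  also have "\<dots> \<le> X / \<delta>\<^sup>2"
  proof -
    have "\<delta>\<^sup>2 \<le> 1" using \<delta> by (simp add: power_le_one)
    then have "X * \<delta>\<^sup>2 \<le> X" using X0 by (metis mult.right_neutral mult_left_mono)
    then show ?thesis using \<delta> by (simp add: field_simps)
  qed
  also have "\<dots> \<le> 25 * Y + 125 * D" by (rule hardy)
  also have "\<dots> \<le> N"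
    using MY Y0 D0 unfolding N_def by (simp add: algebra_simps)
  finally have n2: "(LINT x|MK. (norm (\<theta>1 x))\<^sup>2) \<le> N" .
  note w = weak_laplacianD[OF u]
  have a0: "0 \<le> a" "0 \<le> b" by (simp_all add: a_def b_def)
  have N0: "0 \<le> N" using n2 by (rule order_trans[rotated]) (intro integral_nonneg_AE AE_I2, simp)
  have "\<bar>LINT x|MK. wgrad K u x \<bullet> grad \<theta>1 x\<bar> \<le> a * sqrt (LINT x|MK. (norm (grad \<theta>1 x))\<^sup>2)"
    unfolding a_def by (rule Cauchy_Schwarz_integral[OF w(2) sq_int_grad[OF C1\<theta>1]])
  also have "\<dots> \<le> a * sqrt N" using n1 a0 by (intro mult_left_mono) auto
  finally have 1: "\<bar>LINT x|MK. wgrad K u x \<bullet> grad \<theta>1 x\<bar> \<le> a * sqrt N" .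
  have "\<bar>LINT x|MK. p x \<bullet> \<theta>1 x\<bar> \<le> b * sqrt (LINT x|MK. (norm (\<theta>1 x))\<^sup>2)"
    unfolding b_def by (rule Cauchy_Schwarz_integral[OF w(3) sq_int_C1[OF C1\<theta>1]])
  also have "\<dots> \<le> b * sqrt N" using n2 a0 by (intro mult_left_mono) auto
  finally have 2: "\<bar>LINT x|MK. p x * \<theta>1 x\<bar> \<le> b * sqrt N" by simp
  have "\<bar>weak_form u p \<theta>\<bar> \<le> (a + b) * sqrt N"
    using 1 2 unfolding wf unfolding weak_form_def by (simp add: distrib_right)
  then have "\<bar>weak_form u p \<theta>\<bar>\<^sup>2 \<le> ((a + b) * sqrt N)\<^sup>2" by (intro power_mono) auto
  then have "(weak_form u p \<theta>)\<^sup>2 \<le> (a + b)\<^sup>2 * N" using N0 by (simp add: power_mult_distrib)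
  moreover have "min 1 (max 0 (5 - k x / \<delta>)) = \<omega> x" for x by (simp add: \<omega>_def)
  ultimately show ?thesis
    by (simp only: a_def[symmetric] b_def[symmetric] D_def[symmetric] B_def[symmetric] Y_def[symmetric] N_def mult.assoc)
qed

text \<open>For fixed \<open>k\<close>, the boundary values of \<open>d n\<close> and its distance from \<open>\<eta>\<close> disappear as \<open>n \<rightarrow> \<infinity>\<close>,
  even after division by the width \<open>\<delta> k\<close> of the layer.  What remains is the energy \<open>R k\<close> of the
  limit in a layer that shrinks to \<open>\<partial>K\<close>, which tends to zero by dominated convergence.\<close>

lemma weak_form_boundary_limit:
  assumes u: "weak_laplacian K u p"
    and e: "norm e = 1" and g: "L-lipschitz_on UNIV g" and oU: "open U"
    and chart: "\<And>x. x \<in> U \<Longrightarrow> x \<in> K \<longleftrightarrow> 0 < (x - z) \<bullet> e - g ((x - z) \<bullet> rot e)"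
    and \<zeta>: "test_function U \<zeta>"
    and C1d: "\<And>n::nat. C1 (d n)" and sq: "sq_int MK \<eta>" "sq_int MK \<Gamma>"
    and lim: "(\<lambda>n. LINT x|MK. (norm (d n x - \<eta> x))\<^sup>2) \<longlonglongrightarrow> 0"
      "(\<lambda>n. LINT x|MK. (norm (grad (d n) x - \<Gamma> x))\<^sup>2) \<longlonglongrightarrow> 0"
      "(\<lambda>n. boundary_integral E (\<lambda>x. (d n x)\<^sup>2)) \<longlonglongrightarrow> 0"
  shows "(\<lambda>n. weak_form u p (\<lambda>x. \<zeta> x * d n x)) \<longlonglongrightarrow> 0"
proof -
  define h where "h = (\<lambda>x. (x - z) \<bullet> e - g ((x - z) \<bullet> rot e))"
  have hdf: "defining_function K U h" unfolding h_def by (rule chart_defining_function[OF e g oU chart])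
  have htr: "transversal h e" unfolding h_def using chart_transversal[OF e g, of 0 z] by simp
  have h_nonneg: "0 \<le> h x" if "x \<in> U" "x \<in> closure K" for x
  proof (cases "x \<in> K")
    case True
    then show ?thesis using chart[OF that(1)] by (simp add: h_def)
  next
    case False
    then have "x \<in> frontier K" using that K_open by (simp add: frontier_def interior_open)
    then show ?thesis using frontier_iff_defining_zero[OF hdf htr K_open that(1)] by simp
  qed
  have L0: "0 \<le> L" by (rule lipschitz_on_nonneg[OF g])
  define \<delta> where "\<delta> = (\<lambda>k. 1 / real (Suc k))"
  have \<delta>: "0 < \<delta> k" "\<delta> k \<le> 1" for k by (auto simp: \<delta>_def)
  have "\<exists>f f'. gradient_field f f' \<and> (\<forall>x. f' x \<bullet> e = 1) \<and> (\<forall>x. norm (f' x) \<le> 1 + L) \<and> (\<forall>x. \<bar>f x - h x\<bar> \<le> \<delta> k)"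
    for k
    unfolding h_def by (rule smoothed_chart[OF e g \<delta>(1)[of k], of z]) blast
  then obtain f f' where f: "\<And>k. gradient_field (f k) (f' k)" "\<And>k x. f' k x \<bullet> e = 1"
    "\<And>k x. norm (f' k x) \<le> 1 + L" "\<And>k x. \<bar>f k x - h x\<bar> \<le> \<delta> k"
    by metis
  have low: "- \<delta> k \<le> f k x" if "x \<in> U" "x \<in> closure K" for k x
    using h_nonneg[OF that] f(4)[of k x] by linarith
  have inside: "x \<in> K" if "x \<in> U" "2 * \<delta> k \<le> f k x" for k x
  proof -
    have "0 < h x" using that(2) f(4)[of k x] \<delta>(1)[of k] by linarith
    then show ?thesis using chart[OF that(1)] by (simp add: h_def)
  qed
  define \<omega> where "\<omega> = (\<lambda>k x. min 1 (max 0 (5 - f k x / \<delta> k)))"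
  have \<omega>: "0 \<le> \<omega> k x" "\<omega> k x \<le> 1" for k x by (auto simp: \<omega>_def)
  have c\<omega>: "continuous_on UNIV (\<omega> k)" for k
    unfolding \<omega>_def using \<delta>(1)[of k]
    by (intro continuous_intros gradient_field_imp_continuous[OF f(1)]) simp
  have C1\<zeta>: "C1 \<zeta>" using \<zeta> by (simp add: test_function_def)
  define q where "q = (\<lambda>x. 2 * ((\<zeta> x)\<^sup>2 + (norm (grad \<zeta> x))\<^sup>2))"
  have cq: "continuous_on UNIV q" unfolding q_def
    by (intro continuous_intros C1_continuous_on C1_continuous_on_grad C1\<zeta>)
  have q0: "q x = 0" if "x \<notin> U" for x
  proof -
    have "\<zeta> x = 0" using \<zeta> that unfolding test_function_def by blast
    then show ?thesis using test_function_grad_eq_0[OF \<zeta> that] by (simp add: q_def)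
  qed
  have qnn: "0 \<le> q x" for x by (simp add: q_def)
  obtain b where b: "0 \<le> b" "\<And>x. x \<in> closure K \<Longrightarrow> norm (q x) \<le> b"
    by (rule bounded_on_bounded_continuous[OF cq bounded_closure[OF K_bounded]]) (rule that)
  have qb: "q x \<le> b" if "x \<in> closure K" for x using b(2)[OF that] qnn[of x] by simp
  have Kc: "x \<in> closure K" if "x \<in> K" for x using that closure_subset by blast
  define r where "r = (\<lambda>n. (LINT x|MK. (norm (d n x - \<eta> x))\<^sup>2) + (LINT x|MK. (norm (grad (d n) x - \<Gamma> x))\<^sup>2))"
  define \<beta> where "\<beta> = (\<lambda>n. boundary_integral E (\<lambda>x. (d n x)\<^sup>2))"
  define N where "N = (\<lambda>x. (norm (\<eta> x))\<^sup>2 + (norm (\<Gamma> x))\<^sup>2)"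
  define R where "R = (\<lambda>k. LINT x|MK. \<omega> k x * q x * N x)"
  have iN: "integrable MK N" unfolding N_def by (intro Bochner_Integration.integrable_add sq_int_norm_sq sq)
  have Nnn: "0 \<le> N x" for x by (simp add: N_def)
  have mR: "(\<lambda>x. \<omega> k x * q x * N x) \<in> borel_measurable MK" for k
    by (intro borel_measurable_times borel_measurable_lebesgue_on_continuous c\<omega> cq borel_measurable_integrable iN)
  have dom: "norm (\<omega> k x * q x * N x) \<le> b * N x" if "x \<in> K" for k x
  proof -
    have "\<omega> k x * q x \<le> 1 * b" using \<omega>[of k x] qnn qb[OF Kc[OF that]] by (intro mult_mono) auto
    then have "\<omega> k x * q x * N x \<le> b * N x" using Nnn by (intro mult_right_mono) auto
    then show ?thesis using \<omega>[of k x] qnn[of x] Nnn[of x] by (simp add: abs_mult)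
  qed
  have iR: "integrable MK (\<lambda>x. \<omega> k x * q x * N x)" for k
    by (rule Bochner_Integration.integrable_bound[OF integrable_mult_right[OF iN, of b] mR])
       (use dom Nnn b(1) in \<open>auto intro!: AE_I2\<close>)
  have R: "R \<longlonglongrightarrow> 0"
  proof -
    have "(\<lambda>k. LINT x|MK. \<omega> k x * q x * N x) \<longlonglongrightarrow> (LINT x|MK. 0)"
    proof (rule integral_dominated_convergence[where w = "\<lambda>x. b * N x"])
      show "AE x in MK. (\<lambda>k. \<omega> k x * q x * N x) \<longlonglongrightarrow> 0"
      proof (rule AE_I2)
        fix x assume "x \<in> space MK"
        then have x: "x \<in> K" by simp
        show "(\<lambda>k. \<omega> k x * q x * N x) \<longlonglongrightarrow> 0"
        proof (cases "x \<in> U")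
          case True
          then have hx: "0 < h x" using chart[OF True] x by (simp add: h_def)
          have "(\<lambda>k. 6 * \<delta> k) \<longlonglongrightarrow> 6 * 0"
            unfolding \<delta>_def by (intro tendsto_intros LIMSEQ_Suc[OF lim_1_over_n])
          then have "\<forall>\<^sub>F k in sequentially. 6 * \<delta> k < h x"
            using hx by (intro order_tendstoD(2)[of _ "6 * 0"]) auto
          then have "\<forall>\<^sub>F k in sequentially. \<omega> k x * q x * N x = 0"
          proof eventually_elim
            case (elim k)
            have "5 * \<delta> k \<le> f k x" using elim f(4)[of k x] by linarith
            then have "5 \<le> f k x / \<delta> k" using \<delta>(1)[of k] by (simp add: field_simps)
            then show ?case by (simp add: \<omega>_def)
          qed
          then show ?thesis by (rule tendsto_eventually)
        qed (simp add: q0)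
      qed
      show "AE x in MK. norm (\<omega> k x * q x * N x) \<le> b * N x" for k
        using dom by (intro AE_I2) simp
    qed (use mR iN in auto)
    then show ?thesis by (simp add: R_def)
  qed
  define A where "A = (sqrt (LINT x|MK. (norm (wgrad K u x))\<^sup>2) + sqrt (LINT x|MK. (norm (p x))\<^sup>2))\<^sup>2
      * (4127 * (1 + (1 + L)\<^sup>2))"
  have A0: "0 \<le> A" unfolding A_def by (intro mult_nonneg_nonneg) auto
  have bound: "(weak_form u p (\<lambda>x. \<zeta> x * d n x))\<^sup>2 \<le> A * (2 * b * r n + b * \<beta> n * real (Suc k) + 2 * R k)" for k n
  proof -
    define \<theta> where "\<theta> = (\<lambda>x. \<zeta> x * d n x)"
    have \<theta>: "test_function U \<theta>" unfolding \<theta>_def by (rule test_function_mult[OF \<zeta> C1d])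
    have C1\<theta>: "C1 \<theta>" using \<theta> by (simp add: test_function_def)
    define D where "D = (LINT x|MK. \<omega> k x * (norm (grad \<theta> x))\<^sup>2)"
    have layer: "(weak_form u p \<theta>)\<^sup>2 \<le> A * (D + boundary_integral E (\<lambda>x. (\<theta> x)\<^sup>2) / \<delta> k)"
      unfolding A_def D_def \<omega>_def
      by (rule weak_form_boundary_layer[OF u e \<delta> f(1,2,3) low inside \<theta>])
    have i1: "integrable MK (\<lambda>x. (norm (d n x - \<eta> x))\<^sup>2 + (norm (grad (d n) x - \<Gamma> x))\<^sup>2)"
      by (intro Bochner_Integration.integrable_add sq_int_norm_sq sq_int_diff sq sq_int_C1 sq_int_grad C1d)
    have "D \<le> (LINT x|MK. 2 * b * ((norm (d n x - \<eta> x))\<^sup>2 + (norm (grad (d n) x - \<Gamma> x))\<^sup>2)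
        + 2 * (\<omega> k x * q x * N x))"
      unfolding D_def
    proof (rule integral_mono)
      show "integrable MK (\<lambda>x. \<omega> k x * (norm (grad \<theta> x))\<^sup>2)"
        by (intro integrable_continuous_K continuous_intros c\<omega> C1_continuous_on_grad C1\<theta>)
      show "integrable MK (\<lambda>x. 2 * b * ((norm (d n x - \<eta> x))\<^sup>2 + (norm (grad (d n) x - \<Gamma> x))\<^sup>2)
          + 2 * (\<omega> k x * q x * N x))"
        by (rule Bochner_Integration.integrable_add[OF integrable_mult_right[OF i1] integrable_mult_right[OF iR]])
      fix x assume "x \<in> space MK"
      then have x: "x \<in> closure K" using Kc by simp
      define s where "s = (norm (d n x - \<eta> x))\<^sup>2 + (norm (grad (d n) x - \<Gamma> x))\<^sup>2"
      define t where "t = (d n x)\<^sup>2 + (norm (grad (d n) x))\<^sup>2"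
      have ts: "t \<le> 2 * s + 2 * N x"
      proof -
        have "(norm (d n x))\<^sup>2 \<le> 2 * (norm (d n x - \<eta> x))\<^sup>2 + 2 * (norm (- \<eta> x))\<^sup>2"
          using norm_diff_sq_le[of "d n x - \<eta> x" "- \<eta> x"] by simp
        moreover have "(norm (grad (d n) x))\<^sup>2 \<le> 2 * (norm (grad (d n) x - \<Gamma> x))\<^sup>2 + 2 * (norm (- \<Gamma> x))\<^sup>2"
          using norm_diff_sq_le[of "grad (d n) x - \<Gamma> x" "- \<Gamma> x"] by simp
        ultimately show ?thesis by (simp add: t_def s_def N_def)
      qed
      have "(norm (grad \<theta> x))\<^sup>2 = (norm (\<zeta> x *\<^sub>R grad (d n) x - (- d n x) *\<^sub>R grad \<zeta> x))\<^sup>2"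
        unfolding \<theta>_def by (simp add: grad_mult[OF C1\<zeta> C1d])
      also have "\<dots> \<le> 2 * (norm (\<zeta> x *\<^sub>R grad (d n) x))\<^sup>2 + 2 * (norm ((- d n x) *\<^sub>R grad \<zeta> x))\<^sup>2"
        by (rule norm_diff_sq_le)
      also have "\<dots> \<le> q x * t"
        by (simp add: q_def t_def power_mult_distrib algebra_simps)
      also have "\<dots> \<le> q x * (2 * s + 2 * N x)" using ts qnn by (intro mult_left_mono)
      finally have "\<omega> k x * (norm (grad \<theta> x))\<^sup>2 \<le> \<omega> k x * (q x * (2 * s + 2 * N x))"
        using \<omega> by (intro mult_left_mono) auto
      also have "\<dots> = 2 * ((\<omega> k x * q x) * s) + 2 * (\<omega> k x * q x * N x)" by (simp add: algebra_simps)
      also have "(\<omega> k x * q x) * s \<le> (1 * b) * s"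
        using \<omega>[of k x] qnn[of x] qb[OF x] by (intro mult_right_mono mult_mono) (auto simp: s_def)
      finally show "\<omega> k x * (norm (grad \<theta> x))\<^sup>2
          \<le> 2 * b * ((norm (d n x - \<eta> x))\<^sup>2 + (norm (grad (d n) x - \<Gamma> x))\<^sup>2) + 2 * (\<omega> k x * q x * N x)"
        unfolding s_def[symmetric] by simp
    qed
    also have "\<dots> = 2 * b * r n + 2 * R k"
    proof -
      have r: "(LINT x|MK. (norm (d n x - \<eta> x))\<^sup>2 + (norm (grad (d n) x - \<Gamma> x))\<^sup>2) = r n"
        unfolding r_def
        by (intro Bochner_Integration.integral_add sq_int_norm_sq sq_int_diff sq sq_int_C1 sq_int_grad C1d)
      have lin: "(LINT x|MK. c1 * S x + c2 * T x) = c1 * (LINT x|MK. S x) + c2 * (LINT x|MK. T x)"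
        if "integrable MK S" "integrable MK T" for c1 c2 :: real and S T
        using that by simp
      from lin[OF i1 iR[of k], of "2 * b" 2] show ?thesis unfolding r R_def .
    qed
    finally have D: "D \<le> 2 * b * r n + 2 * R k" .
    have "boundary_integral E (\<lambda>x. (\<theta> x)\<^sup>2) \<le> boundary_integral E (\<lambda>x. b * (d n x)\<^sup>2)"
    proof (rule boundary_integral_mono)
      fix \<gamma> assume \<gamma>: "\<gamma> \<in> E"
      show "integrable (lebesgue_on {0..1}) (\<lambda>t. (\<theta> (\<gamma> t))\<^sup>2 * norm (velocity \<gamma> t))"
        by (rule integrable_edge[OF _ \<gamma>, of "\<lambda>x. (\<theta> x)\<^sup>2"]) (intro continuous_intros C1_continuous_on C1\<theta>)
      show "integrable (lebesgue_on {0..1}) (\<lambda>t. b * (d n (\<gamma> t))\<^sup>2 * norm (velocity \<gamma> t))"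
        by (rule integrable_edge[OF _ \<gamma>, of "\<lambda>x. b * (d n x)\<^sup>2"]) (intro continuous_intros C1_continuous_on C1d)
      fix t :: real assume "t \<in> {0<..<1}"
      then have x: "\<gamma> t \<in> closure K" using edge_in_frontier[OF \<gamma>, of t] by (auto simp: frontier_def)
      have "(\<zeta> (\<gamma> t))\<^sup>2 \<le> q (\<gamma> t)" by (simp add: q_def)
      then have "(\<zeta> (\<gamma> t))\<^sup>2 \<le> b" using qb[OF x] by linarith
      then show "(\<theta> (\<gamma> t))\<^sup>2 \<le> b * (d n (\<gamma> t))\<^sup>2"
        by (simp add: \<theta>_def power_mult_distrib mult_right_mono)
    qed
    also have "\<dots> = b * \<beta> n" by (simp add: boundary_integral_cmult \<beta>_def)
    finally have "boundary_integral E (\<lambda>x. (\<theta> x)\<^sup>2) / \<delta> k \<le> b * \<beta> n / \<delta> k"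
      using \<delta>(1)[of k] by (intro divide_right_mono) auto
    also have "b * \<beta> n / \<delta> k = b * \<beta> n * real (Suc k)" by (simp add: \<delta>_def)
    finally have "D + boundary_integral E (\<lambda>x. (\<theta> x)\<^sup>2) / \<delta> k \<le> 2 * b * r n + b * \<beta> n * real (Suc k) + 2 * R k"
      using D by linarith
    from mult_left_mono[OF this A0] layer show ?thesis unfolding \<theta>_def by linarith
  qed
  show ?thesis
  proof (rule tendsto_zero_of_double_bound[OF bound])
    have "r \<longlonglongrightarrow> 0 + 0" unfolding r_def by (intro tendsto_add lim)
    then show "(\<lambda>n. 2 * b * r n) \<longlonglongrightarrow> 0" using tendsto_mult_left[of r 0 _ "2 * b"] by simp
    show "(\<lambda>n. b * \<beta> n) \<longlonglongrightarrow> 0" unfolding \<beta>_def using tendsto_mult_left[OF lim(3), of b] by simp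
    show "(\<lambda>k. 2 * R k) \<longlonglongrightarrow> 0" using tendsto_mult_left[OF R, of 2] by simp
  qed
qed

text \<open>This takes the place of the fact that functions with zero trace are limits of test
  functions.  The locality principle is applied to the set of multipliers \<open>\<zeta>\<close> for which the weak form of \<open>\<zeta> d\<^sub>n\<close>
  tends to zero, and \<open>\<zeta> = 1\<close> is the case of interest.\<close>

theorem weak_form_zero_trace:
  assumes u: "weak_laplacian K u p"
    and C1d: "\<And>n::nat. C1 (d n)" and sq: "sq_int MK \<eta>" "sq_int MK \<Gamma>"
    and lim: "(\<lambda>n. LINT x|MK. (norm (d n x - \<eta> x))\<^sup>2) \<longlonglongrightarrow> 0"
      "(\<lambda>n. LINT x|MK. (norm (grad (d n) x - \<Gamma> x))\<^sup>2) \<longlonglongrightarrow> 0"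
      "(\<lambda>n. boundary_integral E (\<lambda>x. (d n x)\<^sup>2)) \<longlonglongrightarrow> 0"
  shows "(LINT x|MK. wgrad K u x \<bullet> \<Gamma> x) + (LINT x|MK. p x * \<eta> x) = 0"
proof -
  note w = weak_laplacianD[OF u]
  have "(\<lambda>n. weak_form u p (\<lambda>x. 1 * d n x)) \<longlonglongrightarrow> 0"
  proof (rule C1_localisation[of "closure K" "\<lambda>\<zeta>. (\<lambda>n. weak_form u p (\<lambda>x. \<zeta> x * d n x)) \<longlonglongrightarrow> 0"])
    show "compact (closure K)" using K_bounded by (simp add: compact_closure)
    show "C1 (\<lambda>_. 1)" by (rule C1_const)
  next
    fix \<phi> \<psi> :: "point \<Rightarrow> real"
    assume C1: "C1 \<phi>" "C1 \<psi>" and l: "(\<lambda>n. weak_form u p (\<lambda>x. \<phi> x * d n x)) \<longlonglongrightarrow> 0"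
      "(\<lambda>n. weak_form u p (\<lambda>x. \<psi> x * d n x)) \<longlonglongrightarrow> 0"
    have "weak_form u p (\<lambda>x. (\<phi> x + \<psi> x) * d n x)
        = weak_form u p (\<lambda>x. \<phi> x * d n x) + weak_form u p (\<lambda>x. \<psi> x * d n x)" for n
      unfolding distrib_right by (rule weak_form_add[OF u]) (intro C1_mult C1 C1d)+
    then show "(\<lambda>n. weak_form u p (\<lambda>x. (\<phi> x + \<psi> x) * d n x)) \<longlonglongrightarrow> 0"
      using tendsto_add[OF l] by simp
  next
    fix \<phi> :: "point \<Rightarrow> real" and V
    assume V: "open V" "closure K \<subseteq> V" "\<And>x. x \<in> V \<Longrightarrow> \<phi> x = 0"
    have z: "\<phi> x * d n x = 0" "grad (\<lambda>x. \<phi> x * d n x) x = 0" if "x \<in> K" for n x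
    proof -
      have "x \<in> V" using V(2) that closure_subset by blast
      then show "\<phi> x * d n x = 0" "grad (\<lambda>x. \<phi> x * d n x) x = 0"
        using V by (auto intro!: grad_eq_0_open[of V])
    qed
    have "weak_form u p (\<lambda>x. \<phi> x * d n x) = 0" for n
    proof -
      have "(LINT x|MK. wgrad K u x \<bullet> grad (\<lambda>x. \<phi> x * d n x) x) = 0"
        by (intro integral_eq_zero_AE AE_I2) (simp add: z)
      moreover have "(LINT x|MK. p x * (\<phi> x * d n x)) = 0"
        by (intro integral_eq_zero_AE AE_I2) (use z(1) in simp)
      ultimately show ?thesis by (simp add: weak_form_def)
    qed
    then show "(\<lambda>n. weak_form u p (\<lambda>x. \<phi> x * d n x)) \<longlonglongrightarrow> 0" by simp
  next
    fix z assume z: "z \<in> closure K"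
    have "\<exists>U. open U \<and> z \<in> U \<and>
        (\<forall>\<zeta>. test_function U \<zeta> \<longrightarrow> (\<lambda>n. weak_form u p (\<lambda>x. \<zeta> x * d n x)) \<longlonglongrightarrow> 0)"
    proof (cases "z \<in> K")
      case True
      have "(\<lambda>n. weak_form u p (\<lambda>x. \<zeta> x * d n x)) \<longlonglongrightarrow> 0" if "test_function K \<zeta>" for \<zeta>
        using weak_form_test[OF u test_function_mult[OF that C1d]] by simp
      then show ?thesis using K_open True by blast
    next
      case False
      then have f: "z \<in> frontier K" using z K_open by (simp add: frontier_def interior_open)
      obtain e g L U where c: "norm e = 1" "0 \<le> L" "L-lipschitz_on UNIV g" "open U" "z \<in> U"
        "\<And>x. x \<in> U \<Longrightarrow> x \<in> K \<longleftrightarrow> 0 < (x - z) \<bullet> e - g ((x - z) \<bullet> rot e)"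
        by (rule lipschitz_boundary_chart[OF K_lipschitz f]) (rule that)
      have "(\<lambda>n. weak_form u p (\<lambda>x. \<zeta> x * d n x)) \<longlonglongrightarrow> 0" if "test_function U \<zeta>" for \<zeta>
        by (rule weak_form_boundary_limit[OF u c(1,3,4,6) that C1d sq lim])
      then show ?thesis using c(4,5) by blast
    qed
    then obtain U where U: "open U" "z \<in> U" and
      l: "\<forall>\<zeta>. test_function U \<zeta> \<longrightarrow> (\<lambda>n. weak_form u p (\<lambda>x. \<zeta> x * d n x)) \<longlonglongrightarrow> 0" by blast
    obtain \<rho> where \<rho>: "0 < \<rho>" "cball z \<rho> \<subseteq> U" using U open_contains_cball by blast
    have "test_function U \<zeta>" if "C1 \<zeta>" "\<forall>x. x \<notin> ball z \<rho> \<longrightarrow> \<zeta> x = 0" for \<zeta>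
      unfolding test_function_def using that \<rho>(2)
      by (intro conjI exI[of _ "cball z \<rho>"]) auto
    then show "\<exists>\<rho>>0. \<forall>\<phi>. C1 \<phi> \<longrightarrow> (\<forall>x. x \<notin> ball z \<rho> \<longrightarrow> \<phi> x = 0) \<longrightarrow>
        (\<lambda>n. weak_form u p (\<lambda>x. \<phi> x * d n x)) \<longlonglongrightarrow> 0"
      using l \<rho>(1) by blast
  qed
  then have l0: "(\<lambda>n. weak_form u p (d n)) \<longlonglongrightarrow> 0" by simp
  have "(\<lambda>n. weak_form u p (d n)) \<longlonglongrightarrow> (LINT x|MK. wgrad K u x \<bullet> \<Gamma> x) + (LINT x|MK. p x * \<eta> x)"
    unfolding weak_form_def
  proof (rule tendsto_add)
    show "(\<lambda>n. LINT x|MK. wgrad K u x \<bullet> grad (d n) x) \<longlonglongrightarrow> (LINT x|MK. wgrad K u x \<bullet> \<Gamma> x)"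
      by (rule tendsto_integral_inner[OF w(2) sq(2) sq_int_grad[OF C1d] lim(2)])
    show "(\<lambda>n. LINT x|MK. p x * d n x) \<longlonglongrightarrow> (LINT x|MK. p x * \<eta> x)"
      using tendsto_integral_inner[OF w(3) sq(1) sq_int_C1[OF C1d] lim(1)] by simp
  qed
  from LIMSEQ_unique[OF this l0] show ?thesis .
qed

end

section \<open>Traces and normal derivatives\<close>

lemma weighted_diff_sq:
  fixes x y :: real
  shows "(norm (sqrt (norm a) * x - sqrt (norm a) * y))\<^sup>2 = (x - y)\<^sup>2 * norm a"
proof -
  have "sqrt (norm a) * x - sqrt (norm a) * y = sqrt (norm a) * (x - y)" by (simp only: right_diff_distrib)
  then show ?thesis by (simp add: power_mult_distrib)
qed

context polygon
begin

lemma sq_int_edge_continuous: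
  assumes \<phi>: "continuous_on UNIV \<phi>" and \<gamma>: "\<gamma> \<in> E"
  shows "sq_int (lebesgue_on {0..1}) (\<lambda>t. sqrt (norm (velocity \<gamma> t)) * \<phi> (\<gamma> t))"
proof -
  have c: "continuous_on {0..1} (\<lambda>t. sqrt (norm (velocity \<gamma> t)) * \<phi> (\<gamma> t))"
    by (intro continuous_intros continuous_on_edge \<phi> \<gamma> smooth_arcD(2) E_smooth)
  show ?thesis
    unfolding sq_int_def
    by (intro conjI continuous_imp_measurable_on_sets_lebesgue c continuous_imp_integrable_real
        continuous_intros) simp
qed

lemma sq_int_edge_L2:
  assumes h: "L2_boundary E h" and \<gamma>: "\<gamma> \<in> E"
  shows "sq_int (lebesgue_on {0..1}) (\<lambda>t. sqrt (norm (velocity \<gamma> t)) * h (\<gamma> t))"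
proof -
  have c: "continuous_on {0..1} (\<lambda>t. sqrt (norm (velocity \<gamma> t)))"
    by (intro continuous_intros smooth_arcD(2) E_smooth \<gamma>)
  have m: "(\<lambda>t. sqrt (norm (velocity \<gamma> t)) * h (\<gamma> t)) \<in> borel_measurable (lebesgue_on {0..1})"
    using h \<gamma> unfolding L2_boundary_def
    by (intro borel_measurable_times[OF continuous_imp_measurable_on_sets_lebesgue[OF c]]) auto
  have "integrable (lebesgue_on {0..1}) (\<lambda>t. (h (\<gamma> t))\<^sup>2 * norm (velocity \<gamma> t))"
    using h \<gamma> unfolding L2_boundary_def by blast
  then show ?thesis using m by (simp add: sq_int_def power_mult_distrib mult.commute)
qed

lemma integrable_edge_diff_sq:
  assumes h: "L2_boundary E h" and \<phi>: "continuous_on UNIV \<phi>" and \<gamma>: "\<gamma> \<in> E"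
  shows "integrable (lebesgue_on {0..1}) (\<lambda>t. (\<phi> (\<gamma> t) - h (\<gamma> t))\<^sup>2 * norm (velocity \<gamma> t))"
  using sq_int_norm_sq[OF sq_int_diff[OF sq_int_edge_continuous[OF \<phi> \<gamma>] sq_int_edge_L2[OF h \<gamma>]]]
  by (simp only: weighted_diff_sq)

lemma L2_boundary_diff:
  assumes h: "L2_boundary E h" and \<phi>: "continuous_on UNIV \<phi>"
  shows "L2_boundary E (\<lambda>x. h x - \<phi> x)"
  unfolding L2_boundary_def
proof
  fix \<gamma> assume \<gamma>: "\<gamma> \<in> E"
  have "(\<lambda>t. h (\<gamma> t)) \<in> borel_measurable (lebesgue_on {0..1})"
    using h \<gamma> unfolding L2_boundary_def by blast
  moreover have "(\<lambda>t. \<phi> (\<gamma> t)) \<in> borel_measurable (lebesgue_on {0..1})"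
    by (intro continuous_imp_measurable_on_sets_lebesgue continuous_on_edge \<phi> \<gamma>) simp
  ultimately have "(\<lambda>t. h (\<gamma> t) - \<phi> (\<gamma> t)) \<in> borel_measurable (lebesgue_on {0..1})"
    by (rule borel_measurable_diff)
  then show "(\<lambda>t. h (\<gamma> t) - \<phi> (\<gamma> t)) \<in> borel_measurable (lebesgue_on {0..1}) \<and>
      integrable (lebesgue_on {0..1}) (\<lambda>t. (h (\<gamma> t) - \<phi> (\<gamma> t))\<^sup>2 * norm (velocity \<gamma> t))"
    using integrable_edge_diff_sq[OF h \<phi> \<gamma>] by (simp add: power2_commute)
qed

lemma L2_boundary_continuous: "continuous_on UNIV \<phi> \<Longrightarrow> L2_boundary E \<phi>"
  unfolding L2_boundary_def
proof
  fix \<gamma> assume \<phi>: "continuous_on UNIV \<phi>" and \<gamma>: "\<gamma> \<in> E"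
  have "(\<lambda>t. \<phi> (\<gamma> t)) \<in> borel_measurable (lebesgue_on {0..1})"
    by (intro continuous_imp_measurable_on_sets_lebesgue continuous_on_edge \<phi> \<gamma>) simp
  moreover have "integrable (lebesgue_on {0..1}) (\<lambda>t. (\<phi> (\<gamma> t))\<^sup>2 * norm (velocity \<gamma> t))"
    by (rule integrable_edge[OF _ \<gamma>, of "\<lambda>x. (\<phi> x)\<^sup>2"]) (intro continuous_intros \<phi>)
  ultimately show "(\<lambda>t. \<phi> (\<gamma> t)) \<in> borel_measurable (lebesgue_on {0..1}) \<and>
      integrable (lebesgue_on {0..1}) (\<lambda>t. (\<phi> (\<gamma> t))\<^sup>2 * norm (velocity \<gamma> t))" by blast
qed

lemma has_traceE:
  assumes "has_trace K E u h"
  obtains \<psi> where "\<And>n::nat. C1 (\<psi> n)" "sq_int MK u" "sq_int MK (wgrad K u)" "H1 K u" "L2_boundary E h"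
    "(\<lambda>n. LINT x|MK. (norm (\<psi> n x - u x))\<^sup>2) \<longlonglongrightarrow> 0"
    "(\<lambda>n. LINT x|MK. (norm (grad (\<psi> n) x - wgrad K u x))\<^sup>2) \<longlonglongrightarrow> 0"
    "(\<lambda>n. boundary_integral E (\<lambda>x. (\<psi> n x - h x)\<^sup>2)) \<longlonglongrightarrow> 0"
proof -
  have H: "H1 K u" "L2_boundary E h" using assms by (auto simp: has_trace_def)
  have sq: "sq_int MK u" "sq_int MK (wgrad K u)"
    using H(1) H1_wgrad(1)[OF H(1)] by (simp_all add: H1_def L2_iff_sq_int)
  obtain \<psi> :: "nat \<Rightarrow> point \<Rightarrow> real" where "\<forall>n. C1 (\<psi> n)"
    "(\<lambda>n. LINT x|MK. (\<psi> n x - u x)\<^sup>2) \<longlonglongrightarrow> 0"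
    "(\<lambda>n. LINT x|MK. (norm (grad (\<psi> n) x - wgrad K u x))\<^sup>2) \<longlonglongrightarrow> 0"
    "(\<lambda>n. boundary_integral E (\<lambda>x. (\<psi> n x - h x)\<^sup>2)) \<longlonglongrightarrow> 0"
    using assms unfolding has_trace_def by blast
  then show ?thesis using sq H by (intro that[of \<psi>]) simp_all
qed

lemma has_trace_C1:
  assumes f: "C1 f"
  shows "has_trace K E f f"
  unfolding has_trace_def
proof (intro conjI exI[of _ "\<lambda>_. f"] allI)
  show "H1 K f" by (rule H1_C1[OF f])
  show "L2_boundary E f" by (intro L2_boundary_continuous C1_continuous_on f)
  have "(LINT x|MK. (norm (grad f x - wgrad K f x))\<^sup>2) = 0"
    by (rule integral_eq_zero_AE) (use wgrad_C1[OF f] in \<open>eventually_elim, simp\<close>)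
  then show "(\<lambda>n. LINT x|MK. (norm (grad f x - wgrad K f x))\<^sup>2) \<longlonglongrightarrow> 0" by simp
qed (use f in \<open>simp_all add: boundary_integral_def\<close>)

lemma has_trace_diff_C1:
  assumes u: "has_trace K E u h" and P: "C1 P" and H: "H1 K (\<lambda>x. u x - P x)"
    and wg: "AE x in MK. wgrad K (\<lambda>x. u x - P x) x = wgrad K u x - grad P x"
  shows "has_trace K E (\<lambda>x. u x - P x) (\<lambda>x. h x - P x)"
proof -
  obtain \<psi> where \<psi>: "\<And>n::nat. C1 (\<psi> n)" "sq_int MK u" "sq_int MK (wgrad K u)" "H1 K u" "L2_boundary E h"
    "(\<lambda>n. LINT x|MK. (norm (\<psi> n x - u x))\<^sup>2) \<longlonglongrightarrow> 0"
    "(\<lambda>n. LINT x|MK. (norm (grad (\<psi> n) x - wgrad K u x))\<^sup>2) \<longlonglongrightarrow> 0"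
    "(\<lambda>n. boundary_integral E (\<lambda>x. (\<psi> n x - h x)\<^sup>2)) \<longlonglongrightarrow> 0"
    by (rule has_traceE[OF u]) (rule that)
  have sqH: "sq_int MK (wgrad K (\<lambda>x. u x - P x))" using H1_wgrad(1)[OF H] by (simp add: L2_iff_sq_int)
  show ?thesis
    unfolding has_trace_def
  proof (intro conjI exI[of _ "\<lambda>n x. \<psi> n x - P x"] allI H)
    show "L2_boundary E (\<lambda>x. h x - P x)" by (intro L2_boundary_diff \<psi> C1_continuous_on P)
    show "C1 (\<lambda>x. \<psi> n x - P x)" for n by (intro C1_diff \<psi> P)
    show "(\<lambda>n. LINT x|MK. (\<psi> n x - P x - (u x - P x))\<^sup>2) \<longlonglongrightarrow> 0" using \<psi>(6) by simp
    show "(\<lambda>n. boundary_integral E (\<lambda>x. (\<psi> n x - P x - (h x - P x))\<^sup>2)) \<longlonglongrightarrow> 0" using \<psi>(8) by simp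
    have "(LINT x|MK. (norm (grad (\<lambda>x. \<psi> n x - P x) x - wgrad K (\<lambda>x. u x - P x) x))\<^sup>2)
        = (LINT x|MK. (norm (grad (\<psi> n) x - wgrad K u x))\<^sup>2)" for n
    proof (rule integral_cong_AE)
      show "(\<lambda>x. (norm (grad (\<lambda>x. \<psi> n x - P x) x - wgrad K (\<lambda>x. u x - P x) x))\<^sup>2) \<in> borel_measurable MK"
        by (intro borel_measurable_integrable sq_int_norm_sq sq_int_diff sqH sq_int_grad C1_diff \<psi> P)
      show "(\<lambda>x. (norm (grad (\<psi> n) x - wgrad K u x))\<^sup>2) \<in> borel_measurable MK"
        by (intro borel_measurable_integrable sq_int_norm_sq sq_int_diff sq_int_grad \<psi>)
      show "AE x in MK. (norm (grad (\<lambda>x. \<psi> n x - P x) x - wgrad K (\<lambda>x. u x - P x) x))\<^sup>2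
          = (norm (grad (\<psi> n) x - wgrad K u x))\<^sup>2"
        using wg by eventually_elim (simp add: grad_diff[OF \<psi>(1) P])
    qed
    then show "(\<lambda>n. LINT x|MK. (norm (grad (\<lambda>x. \<psi> n x - P x) x - wgrad K (\<lambda>x. u x - P x) x))\<^sup>2) \<longlonglongrightarrow> 0"
      using \<psi>(7) by simp
  qed
qed

text \<open>Two functions with the same trace differ by a function with zero trace, so the pairing does
  not depend on the chosen extension.\<close>

lemma green_same_trace:
  assumes u: "weak_laplacian K u p" and t: "has_trace K E \<eta>1 h" "has_trace K E \<eta>2 h"
  shows "(LINT x|MK. wgrad K u x \<bullet> wgrad K \<eta>1 x) + (LINT x|MK. p x * \<eta>1 x)
    = (LINT x|MK. wgrad K u x \<bullet> wgrad K \<eta>2 x) + (LINT x|MK. p x * \<eta>2 x)"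
proof -
  obtain a where a: "\<And>n::nat. C1 (a n)" "sq_int MK \<eta>1" "sq_int MK (wgrad K \<eta>1)" "H1 K \<eta>1" "L2_boundary E h"
    "(\<lambda>n. LINT x|MK. (norm (a n x - \<eta>1 x))\<^sup>2) \<longlonglongrightarrow> 0"
    "(\<lambda>n. LINT x|MK. (norm (grad (a n) x - wgrad K \<eta>1 x))\<^sup>2) \<longlonglongrightarrow> 0"
    "(\<lambda>n. boundary_integral E (\<lambda>x. (a n x - h x)\<^sup>2)) \<longlonglongrightarrow> 0"
    by (rule has_traceE[OF t(1)]) (rule that)
  obtain b where b: "\<And>n::nat. C1 (b n)" "sq_int MK \<eta>2" "sq_int MK (wgrad K \<eta>2)" "H1 K \<eta>2" "L2_boundary E h"
    "(\<lambda>n. LINT x|MK. (norm (b n x - \<eta>2 x))\<^sup>2) \<longlonglongrightarrow> 0"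
    "(\<lambda>n. LINT x|MK. (norm (grad (b n) x - wgrad K \<eta>2 x))\<^sup>2) \<longlonglongrightarrow> 0"
    "(\<lambda>n. boundary_integral E (\<lambda>x. (b n x - h x)\<^sup>2)) \<longlonglongrightarrow> 0"
    by (rule has_traceE[OF t(2)]) (rule that)
  note w = weak_laplacianD[OF u]
  have "(LINT x|MK. wgrad K u x \<bullet> (wgrad K \<eta>1 x - wgrad K \<eta>2 x)) + (LINT x|MK. p x * (\<eta>1 x - \<eta>2 x)) = 0"
  proof (rule weak_form_zero_trace[OF u, where d = "\<lambda>n x. a n x - b n x"])
    show "C1 (\<lambda>x. a n x - b n x)" for n by (intro C1_diff a b)
    show "sq_int MK (\<lambda>x. \<eta>1 x - \<eta>2 x)" "sq_int MK (\<lambda>x. wgrad K \<eta>1 x - wgrad K \<eta>2 x)"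
      by (intro sq_int_diff a b)+
    show "(\<lambda>n. LINT x|MK. (norm (a n x - b n x - (\<eta>1 x - \<eta>2 x)))\<^sup>2) \<longlonglongrightarrow> 0"
      by (rule sq_int_lim_diff[OF a(2) b(2) sq_int_C1[OF a(1)] sq_int_C1[OF b(1)] a(6) b(6)])
    show "(\<lambda>n. LINT x|MK. (norm (grad (\<lambda>x. a n x - b n x) x - (wgrad K \<eta>1 x - wgrad K \<eta>2 x)))\<^sup>2) \<longlonglongrightarrow> 0"
      unfolding grad_diff[OF a(1) b(1)]
      by (rule sq_int_lim_diff[OF a(3) b(3) sq_int_grad[OF a(1)] sq_int_grad[OF b(1)] a(7) b(7)])
    show "(\<lambda>n. boundary_integral E (\<lambda>x. (a n x - b n x)\<^sup>2)) \<longlonglongrightarrow> 0"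
    proof (rule tendsto_sandwich)
      show "\<forall>\<^sub>F n in sequentially. 0 \<le> boundary_integral E (\<lambda>x. (a n x - b n x)\<^sup>2)"
        by (intro always_eventually allI boundary_integral_nonneg) simp
      have "boundary_integral E (\<lambda>x. (a n x - b n x)\<^sup>2)
          \<le> 2 * boundary_integral E (\<lambda>x. (a n x - h x)\<^sup>2) + 2 * boundary_integral E (\<lambda>x. (b n x - h x)\<^sup>2)" for n
      proof -
        have i: "integrable (lebesgue_on {0..1}) (\<lambda>t. 2 * (c (\<gamma> t) - h (\<gamma> t))\<^sup>2 * norm (velocity \<gamma> t))"
          if "\<gamma> \<in> E" "C1 c" for \<gamma> c
          using integrable_mult_right[OF integrable_edge_diff_sq[OF a(5) C1_continuous_on[OF that(2)] that(1)], of 2]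
          by (simp add: mult.assoc)
        have "boundary_integral E (\<lambda>x. (a n x - b n x)\<^sup>2)
            \<le> boundary_integral E (\<lambda>x. 2 * (a n x - h x)\<^sup>2 + 2 * (b n x - h x)\<^sup>2)"
        proof (rule boundary_integral_mono)
          fix \<gamma> assume \<gamma>: "\<gamma> \<in> E"
          show "integrable (lebesgue_on {0..1}) (\<lambda>t. (a n (\<gamma> t) - b n (\<gamma> t))\<^sup>2 * norm (velocity \<gamma> t))"
            by (rule integrable_edge[OF _ \<gamma>, of "\<lambda>x. (a n x - b n x)\<^sup>2"])
               (intro continuous_intros C1_continuous_on a b)
          show "integrable (lebesgue_on {0..1}) (\<lambda>t. (2 * (a n (\<gamma> t) - h (\<gamma> t))\<^sup>2 + 2 * (b n (\<gamma> t) - h (\<gamma> t))\<^sup>2)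
              * norm (velocity \<gamma> t))"
            unfolding distrib_right by (intro Bochner_Integration.integrable_add i \<gamma> a b)
          show "(a n (\<gamma> t) - b n (\<gamma> t))\<^sup>2 \<le> 2 * (a n (\<gamma> t) - h (\<gamma> t))\<^sup>2 + 2 * (b n (\<gamma> t) - h (\<gamma> t))\<^sup>2" for t
            using norm_diff_sq_le[of "a n (\<gamma> t) - h (\<gamma> t)" "b n (\<gamma> t) - h (\<gamma> t)"] by simp
        qed
        also have "\<dots> = boundary_integral E (\<lambda>x. 2 * (a n x - h x)\<^sup>2) + boundary_integral E (\<lambda>x. 2 * (b n x - h x)\<^sup>2)"
          by (rule boundary_integral_add) (intro i a b, assumption)+
        finally show ?thesis by (simp add: boundary_integral_cmult)
      qed
      then show "\<forall>\<^sub>F n in sequentially. boundary_integral E (\<lambda>x. (a n x - b n x)\<^sup>2)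
          \<le> 2 * boundary_integral E (\<lambda>x. (a n x - h x)\<^sup>2) + 2 * boundary_integral E (\<lambda>x. (b n x - h x)\<^sup>2)"
        by (intro always_eventually allI)
      have "(\<lambda>n. 2 * boundary_integral E (\<lambda>x. (a n x - h x)\<^sup>2) + 2 * boundary_integral E (\<lambda>x. (b n x - h x)\<^sup>2))
          \<longlonglongrightarrow> 2 * 0 + 2 * 0"
        by (intro tendsto_intros a b)
      then show "(\<lambda>n. 2 * boundary_integral E (\<lambda>x. (a n x - h x)\<^sup>2) + 2 * boundary_integral E (\<lambda>x. (b n x - h x)\<^sup>2))
          \<longlonglongrightarrow> 0" by simp
    qed simp
  qed
  moreover have "(LINT x|MK. wgrad K u x \<bullet> (wgrad K \<eta>1 x - wgrad K \<eta>2 x))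
      = (LINT x|MK. wgrad K u x \<bullet> wgrad K \<eta>1 x) - (LINT x|MK. wgrad K u x \<bullet> wgrad K \<eta>2 x)"
    unfolding inner_diff_right by (intro Bochner_Integration.integral_diff integrable_inner_sq_int w a b)
  moreover have "(LINT x|MK. p x * (\<eta>1 x - \<eta>2 x)) = (LINT x|MK. p x * \<eta>1 x) - (LINT x|MK. p x * \<eta>2 x)"
    unfolding right_diff_distrib by (intro Bochner_Integration.integral_diff integrable_mult_sq_int w a b)
  ultimately show ?thesis by simp
qed

theorem normal_derivative_eq:
  assumes u: "weak_laplacian K u p" and \<eta>: "has_trace K E \<eta> h"
  shows "normal_derivative K E u h = (LINT x|MK. wgrad K u x \<bullet> wgrad K \<eta> x) + (LINT x|MK. p x * \<eta> x)"
proof -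
  have wl: "weak_laplacian K u (wlap K u)"
    unfolding wlap_def by (rule someI[of "weak_laplacian K u", OF u])
  have sq: "sq_int MK \<eta>" by (rule has_traceE[OF \<eta>])
  have eq: "(LINT x|MK. wlap K u x * \<eta> x) = (LINT x|MK. p x * \<eta> x)"
  proof (rule integral_cong_AE)
    show "(\<lambda>x. wlap K u x * \<eta> x) \<in> borel_measurable MK" "(\<lambda>x. p x * \<eta> x) \<in> borel_measurable MK"
      by (intro borel_measurable_times sq_int_measurable sq weak_laplacianD(3)[OF wl] weak_laplacianD(3)[OF u])+
    show "AE x in MK. wlap K u x * \<eta> x = p x * \<eta> x"
      using wlap_eq(2)[OF u] by eventually_elim simp
  qed
  have "normal_derivative K E u h = (LINT x|MK. wgrad K u x \<bullet> wgrad K \<eta> x) + (LINT x|MK. wlap K u x * \<eta> x)"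
    unfolding normal_derivative_def
  proof (rule the_equality)
    show "\<forall>\<psi>. has_trace K E \<psi> h \<longrightarrow> (LINT x|MK. wgrad K u x \<bullet> wgrad K \<eta> x) + (LINT x|MK. wlap K u x * \<eta> x)
        = (LINT x|MK. wgrad K u x \<bullet> wgrad K \<psi> x) + (LINT x|MK. wlap K u x * \<psi> x)"
      using green_same_trace[OF wl \<eta>] by blast
  qed (use \<eta> in blast)
  then show ?thesis unfolding eq .
qed

lemma normal_component_sq_int:
  assumes q: "C1 q" and \<gamma>: "\<gamma> \<in> E"
  shows "sq_int (lebesgue_on {0..1})
    (\<lambda>t. sqrt (norm (velocity \<gamma> t)) * (grad q (\<gamma> t) \<bullet> outward_normal K E (\<gamma> t)))"
proof -
  let ?n = "\<lambda>t. outward_normal K E (\<gamma> t)" and ?s = "\<lambda>t. norm (velocity \<gamma> t)"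
  note arc = smooth_arcD[OF E_smooth[OF \<gamma>]]
  have cs: "continuous_on {0<..<1} ?s" by (rule continuous_on_subset[of "{0..1}"]) (auto intro!: continuous_intros arc)
  have cn: "continuous_on {0<..<1} (\<lambda>t. ?n t \<bullet> a)" for a
  proof -
    have "continuous_on {0<..<1} (\<lambda>t. (?n t \<bullet> a) * ?s t / ?s t)"
      using arc(4) by (intro continuous_on_divide continuous_normal_speed \<gamma> cs) auto
    then show ?thesis by (rule continuous_on_eq) (use arc(4) in auto)
  qed
  have cg: "continuous_on {0<..<1} (\<lambda>t. grad q (\<gamma> t))"
    by (rule continuous_on_compose2[OF C1_continuous_on_grad[OF q, of UNIV] continuous_on_subset[OF arc(1)]]) auto
  have dec: "grad q (\<gamma> t) \<bullet> ?n t = fst (grad q (\<gamma> t)) * (?n t \<bullet> (1, 0)) + snd (grad q (\<gamma> t)) * (?n t \<bullet> (0, 1))" for t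
    by (simp add: inner_prod_def)
  have "continuous_on {0<..<1} (\<lambda>t. sqrt (?s t) * (grad q (\<gamma> t) \<bullet> ?n t))"
    unfolding dec by (intro continuous_intros cs cn cg)
  then have m: "(\<lambda>t. sqrt (?s t) * (grad q (\<gamma> t) \<bullet> ?n t)) \<in> borel_measurable (lebesgue_on {0..1})"
    by (rule borel_measurable_Icc_continuous_Ioo)
  have "integrable (lebesgue_on {0..1}) (\<lambda>t. (norm (sqrt (?s t) * (grad q (\<gamma> t) \<bullet> ?n t)))\<^sup>2)"
  proof (rule Bochner_Integration.integrable_bound)
    show "integrable (lebesgue_on {0..1}) (\<lambda>t. (norm (grad q (\<gamma> t)))\<^sup>2 * ?s t)"
      by (rule integrable_edge[OF _ \<gamma>, of "\<lambda>x. (norm (grad q x))\<^sup>2"])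
         (intro continuous_intros C1_continuous_on_grad q)
    show "(\<lambda>t. (norm (sqrt (?s t) * (grad q (\<gamma> t) \<bullet> ?n t)))\<^sup>2) \<in> borel_measurable (lebesgue_on {0..1})"
      using m by measurable
    show "AE t in lebesgue_on {0..1}. norm ((norm (sqrt (?s t) * (grad q (\<gamma> t) \<bullet> ?n t)))\<^sup>2)
        \<le> norm ((norm (grad q (\<gamma> t)))\<^sup>2 * ?s t)"
      using AE_Icc_interior
    proof eventually_elim
      case (elim t)
      have "\<bar>grad q (\<gamma> t) \<bullet> ?n t\<bar> \<le> norm (grad q (\<gamma> t))"
        using Cauchy_Schwarz_ineq2[of "grad q (\<gamma> t)" "?n t"] norm_outward_normal[OF \<gamma> elim] by simp
      then have "\<bar>grad q (\<gamma> t) \<bullet> ?n t\<bar>\<^sup>2 \<le> (norm (grad q (\<gamma> t)))\<^sup>2" by (intro power_mono) auto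
      then have "(grad q (\<gamma> t) \<bullet> ?n t)\<^sup>2 * ?s t \<le> (norm (grad q (\<gamma> t)))\<^sup>2 * ?s t"
        by (intro mult_right_mono) simp_all
      then show ?case by (simp add: power_mult_distrib mult.commute)
    qed
  qed
  then show ?thesis using m by (simp add: sq_int_def)
qed

text \<open>Both sides of Green's formula for \<open>C\<^sup>1\<close> functions are continuous under the convergence that
  defines the trace.\<close>

lemma green_C2_trace:
  assumes \<eta>: "has_trace K E \<eta> h" and q: "C2 q"
  shows "boundary_integral E (\<lambda>x. (grad q x \<bullet> outward_normal K E x) * h x)
    = (LINT x|MK. grad q x \<bullet> wgrad K \<eta> x) + (LINT x|MK. laplacian q x * \<eta> x)"
proof -
  let ?n = "outward_normal K E"
  obtain \<psi> where \<psi>: "\<And>n::nat. C1 (\<psi> n)" "sq_int MK \<eta>" "sq_int MK (wgrad K \<eta>)" "H1 K \<eta>" "L2_boundary E h"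
    "(\<lambda>n. LINT x|MK. (norm (\<psi> n x - \<eta> x))\<^sup>2) \<longlonglongrightarrow> 0"
    "(\<lambda>n. LINT x|MK. (norm (grad (\<psi> n) x - wgrad K \<eta> x))\<^sup>2) \<longlonglongrightarrow> 0"
    "(\<lambda>n. boundary_integral E (\<lambda>x. (\<psi> n x - h x)\<^sup>2)) \<longlonglongrightarrow> 0"
    by (rule has_traceE[OF \<eta>]) (rule that)
  have C1q: "C1 q" by (rule C2_imp_C1[OF q])
  have "continuous_on UNIV (laplacian q)"
    unfolding laplacian_def[abs_def] using q unfolding C2_def
    by (intro continuous_intros C1_continuous_on_grad) auto
  then have sql: "sq_int MK (laplacian q)" by (rule sq_int_continuous_K)
  have "(\<lambda>n. LINT x|MK. grad q x \<bullet> grad (\<psi> n) x) \<longlonglongrightarrow> (LINT x|MK. grad q x \<bullet> wgrad K \<eta> x)"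
    by (rule tendsto_integral_inner[OF sq_int_grad[OF C1q] \<psi>(3) sq_int_grad[OF \<psi>(1)] \<psi>(7)])
  moreover have "(\<lambda>n. LINT x|MK. laplacian q x * \<psi> n x) \<longlonglongrightarrow> (LINT x|MK. laplacian q x * \<eta> x)"
    using tendsto_integral_inner[OF sql \<psi>(2) sq_int_C1[OF \<psi>(1)] \<psi>(6)] by simp
  ultimately have "(\<lambda>n. (LINT x|MK. grad q x \<bullet> grad (\<psi> n) x) + (LINT x|MK. laplacian q x * \<psi> n x))
      \<longlonglongrightarrow> (LINT x|MK. grad q x \<bullet> wgrad K \<eta> x) + (LINT x|MK. laplacian q x * \<eta> x)"
    by (rule tendsto_add)
  then have lim1: "(\<lambda>n. boundary_integral E (\<lambda>x. (grad q x \<bullet> ?n x) * \<psi> n x))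
      \<longlonglongrightarrow> (LINT x|MK. grad q x \<bullet> wgrad K \<eta> x) + (LINT x|MK. laplacian q x * \<eta> x)"
    unfolding green_C2[OF q \<psi>(1)] .
  have lim2: "(\<lambda>n. boundary_integral E (\<lambda>x. (grad q x \<bullet> ?n x) * \<psi> n x))
      \<longlonglongrightarrow> boundary_integral E (\<lambda>x. (grad q x \<bullet> ?n x) * h x)"
    unfolding boundary_integral_def
  proof (rule tendsto_sum)
    fix \<gamma> assume \<gamma>: "\<gamma> \<in> E"
    let ?M = "lebesgue_on {0..1::real}" and ?s = "\<lambda>t. sqrt (norm (velocity \<gamma> t))"
    have "(\<lambda>n. LINT t|?M. (norm (?s t * \<psi> n (\<gamma> t) - ?s t * h (\<gamma> t)))\<^sup>2) \<longlonglongrightarrow> 0"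
    proof (rule tendsto_sandwich)
      have eq: "(LINT t|?M. (norm (?s t * \<psi> n (\<gamma> t) - ?s t * h (\<gamma> t)))\<^sup>2)
          = (LINT t|?M. (\<psi> n (\<gamma> t) - h (\<gamma> t))\<^sup>2 * norm (velocity \<gamma> t))" for n
        by (simp only: weighted_diff_sq)
      show "\<forall>\<^sub>F n in sequentially. (LINT t|?M. (norm (?s t * \<psi> n (\<gamma> t) - ?s t * h (\<gamma> t)))\<^sup>2)
          \<le> boundary_integral E (\<lambda>x. (\<psi> n x - h x)\<^sup>2)"
      proof (intro always_eventually allI)
        fix n
        show "(LINT t|?M. (norm (?s t * \<psi> n (\<gamma> t) - ?s t * h (\<gamma> t)))\<^sup>2)
          \<le> boundary_integral E (\<lambda>x. (\<psi> n x - h x)\<^sup>2)"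
          unfolding eq boundary_integral_def
          by (rule member_le_sum[OF \<gamma> _ E_finite]) (intro integral_nonneg_AE AE_I2, simp)
      qed
      show "\<forall>\<^sub>F n in sequentially. 0 \<le> (LINT t|?M. (norm (?s t * \<psi> n (\<gamma> t) - ?s t * h (\<gamma> t)))\<^sup>2)"
        by (intro always_eventually allI integral_nonneg_AE AE_I2) simp
    qed (use \<psi>(8) in auto)
    from tendsto_integral_inner[OF normal_component_sq_int[OF C1q \<gamma>] sq_int_edge_L2[OF \<psi>(5) \<gamma>]
        sq_int_edge_continuous[OF C1_continuous_on[OF \<psi>(1)] \<gamma>] this]
    have l: "(\<lambda>n. LINT t|?M. (?s t * (grad q (\<gamma> t) \<bullet> ?n (\<gamma> t))) * (?s t * \<psi> n (\<gamma> t)))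
        \<longlonglongrightarrow> (LINT t|?M. (?s t * (grad q (\<gamma> t) \<bullet> ?n (\<gamma> t))) * (?s t * h (\<gamma> t)))"
      by simp
    have re: "(?s t * x) * (?s t * y) = x * y * norm (velocity \<gamma> t)" for t x y
    proof -
      have "(?s t * x) * (?s t * y) = (?s t * ?s t) * (x * y)" by (simp only: mult_ac)
      then show ?thesis by (simp add: mult.commute)
    qed
    show "(\<lambda>n. LINT t|?M. (grad q (\<gamma> t) \<bullet> ?n (\<gamma> t)) * \<psi> n (\<gamma> t) * norm (velocity \<gamma> t))
        \<longlonglongrightarrow> (LINT t|?M. (grad q (\<gamma> t) \<bullet> ?n (\<gamma> t)) * h (\<gamma> t) * norm (velocity \<gamma> t))"
      using l unfolding re .
  qed
  show ?thesis by (rule LIMSEQ_unique[OF lim2 lim1])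
qed

text \<open>Green's second identity for a harmonic \<open>\<phi>\<close>: the two Dirichlet integrals cancel.\<close>

lemma harmonic_green_C2:
  assumes \<phi>: "weak_laplacian K \<phi> (\<lambda>_. 0)" "has_trace K E \<phi> h" and q: "C2 q"
    and r: "\<forall>x\<in>K. laplacian q x = r x"
  shows "boundary_integral E (\<lambda>x. (grad q x \<bullet> outward_normal K E x) * h x) - normal_derivative K E \<phi> q
    = (LINT x|MK. r x * \<phi> x)"
proof -
  have C1q: "C1 q" by (rule C2_imp_C1[OF q])
  note w = weak_laplacianD[OF \<phi>(1)]
  have "normal_derivative K E \<phi> q = (LINT x|MK. wgrad K \<phi> x \<bullet> wgrad K q x)"
    using normal_derivative_eq[OF \<phi>(1) has_trace_C1[OF C1q]] by simp
  also have "\<dots> = (LINT x|MK. grad q x \<bullet> wgrad K \<phi> x)"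
  proof (rule integral_cong_AE)
    have "sq_int MK (wgrad K q)" using H1_wgrad(1)[OF H1_C1[OF C1q]] by (simp add: L2_iff_sq_int)
    then show "(\<lambda>x. wgrad K \<phi> x \<bullet> wgrad K q x) \<in> borel_measurable MK"
      by (intro borel_measurable_inner sq_int_measurable w)
    show "(\<lambda>x. grad q x \<bullet> wgrad K \<phi> x) \<in> borel_measurable MK"
      by (intro borel_measurable_inner sq_int_measurable w sq_int_grad C1q)
    show "AE x in MK. wgrad K \<phi> x \<bullet> wgrad K q x = grad q x \<bullet> wgrad K \<phi> x"
      using wgrad_C1[OF C1q] by eventually_elim (simp add: inner_commute)
  qed
  finally have nd: "normal_derivative K E \<phi> q = (LINT x|MK. grad q x \<bullet> wgrad K \<phi> x)" .
  have "(LINT x|MK. laplacian q x * \<phi> x) = (LINT x|MK. r x * \<phi> x)"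
    using r by (intro Bochner_Integration.integral_cong) auto
  then show ?thesis using nd green_C2_trace[OF \<phi>(2) q] by simp
qed

end

section \<open>The integral of a product\<close>

theorem mainTheorem3:
  fixes K :: "point set" and E :: "(real \<Rightarrow> point) set" and m :: int
    and v w p q f g P Q Ps Qs \<Phi> \<Phi>b :: "point \<Rightarrow> real"
  assumes "curvilinear_polygon K E" and "m \<ge> 1"
    and "v \<in> V_space K E m" and "w \<in> V_space K E m"
    and "p \<in> poly_space (m - 2)" and "weak_laplacian K v p"
    and "f \<in> boundary_poly_space K E m" and "has_trace K E v f"
    and "q \<in> poly_space (m - 2)" and "weak_laplacian K w q"
    and "g \<in> boundary_poly_space K E m" and "has_trace K E w g"
    and "P \<in> poly_space m" and "\<forall>x\<in>K. laplacian P x = p x"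
    and "Q \<in> poly_space m" and "\<forall>x\<in>K. laplacian Q x = q x"
    and "Ps \<in> poly_space (m + 2)" and "\<forall>x\<in>K. laplacian Ps x = P x"
    and "Qs \<in> poly_space (m + 2)" and "\<forall>x\<in>K. laplacian Qs x = Q x"
    and "Phi_construction K E (\<lambda>x. v x - P x) \<Phi>"
    and "weak_laplacian K \<Phi> (\<lambda>x. v x - P x)"
    and "has_trace K E \<Phi> \<Phi>b"
  shows "(LINT x|lebesgue_on K. v x * w x) =
       (normal_derivative K E \<Phi> (\<lambda>x. g x - Q x)
        - normal_derivative K E (\<lambda>x. w x - Q x) \<Phi>b)
     + (boundary_integral E (\<lambda>x. (grad Qs x \<bullet> outward_normal K E x) * (f x - P x))
        - normal_derivative K E (\<lambda>x. v x - P x) Qs)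
     + (boundary_integral E (\<lambda>x. (grad Ps x \<bullet> outward_normal K E x) * (g x - Q x))
        - normal_derivative K E (\<lambda>x. w x - Q x) Ps)
     + (LINT x|lebesgue_on K. P x * Q x)"
proof -
  interpret polygon K E by (rule polygon.intro) fact
  let ?\<phi> = "\<lambda>x. v x - P x" and ?\<psi> = "\<lambda>x. w x - Q x"
  have C2: "C2 P" "C2 Q" "C2 Ps" "C2 Qs"
    using assms(13,15,17,19) by (auto intro: C2_poly_space)
  note \<phi> = weak_laplacian_diff_C2[OF assms(6) C2(1) assms(14)]
  note \<psi> = weak_laplacian_diff_C2[OF assms(10) C2(2) assms(16)]
  have t\<phi>: "has_trace K E ?\<phi> (\<lambda>x. f x - P x)"
    by (rule has_trace_diff_C1[OF assms(8) C2_imp_C1[OF C2(1)] weak_laplacianD(1)[OF \<phi>(1)] \<phi>(2)])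
  have t\<psi>: "has_trace K E ?\<psi> (\<lambda>x. g x - Q x)"
    by (rule has_trace_diff_C1[OF assms(12) C2_imp_C1[OF C2(2)] weak_laplacianD(1)[OF \<psi>(1)] \<psi>(2)])
  have sq: "sq_int MK ?\<phi>" "sq_int MK ?\<psi>" "sq_int MK P" "sq_int MK Q"
    using weak_laplacianD(1)[OF \<phi>(1)] weak_laplacianD(1)[OF \<psi>(1)] sq_int_C1[OF C2_imp_C1[OF C2(1)]]
      sq_int_C1[OF C2_imp_C1[OF C2(2)]]
    by (simp_all add: H1_def L2_iff_sq_int)
  have "normal_derivative K E \<Phi> (\<lambda>x. g x - Q x) - normal_derivative K E ?\<psi> \<Phi>b
      = (LINT x|MK. ?\<phi> x * ?\<psi> x)"
    using normal_derivative_eq[OF assms(22) t\<psi>] normal_derivative_eq[OF \<psi>(1) assms(23)]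
    by (simp add: inner_commute)
  moreover note harmonic_green_C2[OF \<phi>(1) t\<phi> C2(4) assms(20)] harmonic_green_C2[OF \<psi>(1) t\<psi> C2(3) assms(18)]
  moreover have "(LINT x|MK. v x * w x) = (LINT x|MK. ?\<phi> x * ?\<psi> x) + (LINT x|MK. Q x * ?\<phi> x)
      + (LINT x|MK. P x * ?\<psi> x) + (LINT x|MK. P x * Q x)"
  proof -
    note i = integrable_mult_sq_int[OF sq(1,2)] integrable_mult_sq_int[OF sq(4,1)]
      integrable_mult_sq_int[OF sq(3,2)] integrable_mult_sq_int[OF sq(3,4)]
    have "(LINT x|MK. v x * w x) = (LINT x|MK. ?\<phi> x * ?\<psi> x + Q x * ?\<phi> x + P x * ?\<psi> x + P x * Q x)"
      by (intro Bochner_Integration.integral_cong refl) (simp add: algebra_simps)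
    also have "\<dots> = (LINT x|MK. ?\<phi> x * ?\<psi> x) + (LINT x|MK. Q x * ?\<phi> x)
      + (LINT x|MK. P x * ?\<psi> x) + (LINT x|MK. P x * Q x)"
      by (simp only: Bochner_Integration.integral_add Bochner_Integration.integrable_add i)
    finally show ?thesis .
  qed
  ultimately show ?thesis by simp
qed

end
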